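(* The $\mathbb{Q}$-algebra $S(n,d)$ is the associative algebra (with $1$) given by generators $1_\lambda$ ($\lambda\in\Lambda(n,d)$), $e_i,f_i$ ($1\le i\le n-1$) (these generators corresponding to the elements of the same name in $S(n,d)$) subject to the relations: (R1$'$) $1_\lambda1_\mu=\delta_{\lambda,\mu}1_\lambda$, $\;\sum_{\lambda\in\Lambda(n,d)}1_\lambda=1$; (R2$'$) $e_i1_\lambda=1_{\lambda+\alpha_i}e_i$ if $\lambda+\alpha_i\in\Lambda(n,d)$ and $e_i1_\lambda=0$ otherwise; $f_i1_\lambda=1_{\lambda-\alpha_i}f_i$ if $\lambda-\alpha_i\in\Lambda(n,d)$ and $f_i1_\lambda=0$ otherwise; $1_\lambda e_i=e_i1_{\lambda-\alpha_i}$ if $\lambda-\alpha_i\in\Lambda(n,d)$ and $1_\lambda e_i=0$ otherwise; $1_\lambda f_i=f_i1_{\lambda+\alpha_i}$ if $\lambda+\alpha_i\in\Lambda(n,d)$ and $1_\lambda f_i=0$ otherwise; (R3$'$) $e_if_j-f_je_i=\delta_{ij}\sum_{\lambda\in\Lambda(n,d)}(\lambda_j-\lambda_{j+1})1_\lambda$; together with the Serre relations (R4) $e_i^2e_j-2e_ie_je_i+e_je_i^2=0$ if $|i-j|=1$, $e_ie_j-e_je_i=0$ otherwise; (R5) $f_i^2f_j-2f_if_jf_i+f_jf_i^2=0$ if $|i-j|=1$, $f_if_j-f_jf_i=0$ otherwise.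
   Context: $n\ge1$, $d\ge0$ are integers, $\mathbb{N}=\{0,1,2,\dots\}$. $V=\mathbb{Q}^n$; $\Sigma_d$ acts on $V^{\otimes d}$ by permuting tensor places, and $S(n,d)=\operatorname{End}_{\Sigma_d}(V^{\otimes d})$. The Lie algebra $\mathfrak{gl}_n$ acts on $V^{\otimes d}$ by derivations, which gives a surjection $U(\mathfrak{gl}_n)\to S(n,d)$; in $S(n,d)$, $e_i,f_i,H_i$ denote the images of the matrix units $e_{i,i+1}$, $e_{i+1,i}$, $e_{i,i}$. $\Lambda(n,d)=\{\lambda\in\mathbb{N}^n\mid\sum_i\lambda_i=d\}$. In $S(n,d)$, $1_\lambda=\prod_{i=1}^n\binom{H_i}{\lambda_i}$ where $\binom{H_i}{m}=H_i(H_i-1)\cdots(H_i-m+1)/m!$, $\binom{H_i}{0}=1$. $\alpha_i=\varepsilon_i-\varepsilon_{i+1}$ where $\varepsilon_1,\dots,\varepsilon_n$ is the standard basis of $\mathbb{Z}^n$. *)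

theory Defs
  imports
    Complex_Main
    "HOL-Algebra.QuotRing"
    "HOL-Algebra.Module"
    "HOL-Combinatorics.Permutations"
    "HOL-Library.Function_Algebras"
    "HOL-Library.Poly_Mapping"
begin

section \<open>Associative algebras by generators and relations\<close>

text \<open>
  Words over \<open>'g\<close> are wrapped in a type of their own so that concatenation can be their (noncommutative)
  \<open>monoid_add\<close> structure. With it, \<open>'g word \<Rightarrow>\<^sub>0 rat\<close> carries the convolution product
  of \<^theory>\<open>HOL-Library.Poly_Mapping\<close>, which is the free associative algebra on \<open>'g\<close> over the
  rationals.
\<close>

datatype 'g word = Word (letters: "'g list")

instantiation word :: (type) monoid_add
begin

definition zero_word :: "'a word" where "0 = Word []"

definition plus_word :: "'a word \<Rightarrow> 'a word \<Rightarrow> 'a word"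
  where "u + v = Word (letters u @ letters v)"

instance by standard (auto simp: zero_word_def plus_word_def)

end

type_synonym 'g ncpoly = "'g word \<Rightarrow>\<^sub>0 rat"

definition nc_const :: "rat \<Rightarrow> 'g ncpoly" where "nc_const c = Poly_Mapping.single 0 c"

definition nc_gen :: "'g \<Rightarrow> 'g ncpoly" where "nc_gen g = Poly_Mapping.single (Word [g]) 1"

definition free_alg :: "'g set \<Rightarrow> (rat, 'g ncpoly) module" where
  "free_alg X =
    \<lparr>carrier = {p. \<forall>w \<in> Poly_Mapping.keys p. set (letters w) \<subseteq> X},
     monoid.mult = (*), one = 1, zero = 0, add = (+), smult = (\<lambda>c p. nc_const c * p)\<rparr>"

lemma ring_free_alg: "ring (free_alg X)"
proof -
  have keys_times: "w \<in> Poly_Mapping.keys (p * q) \<Longrightarrow>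
      \<exists>u \<in> Poly_Mapping.keys p. \<exists>v \<in> Poly_Mapping.keys q. w = u + v" for p q :: "'a ncpoly" and w
    using keys_mult[of p q] by blast
  have times: "p * q \<in> carrier (free_alg X)"
    if "p \<in> carrier (free_alg X)" "q \<in> carrier (free_alg X)" for p q
    using that by (fastforce simp: free_alg_def plus_word_def dest!: keys_times)
  have plus: "p + q \<in> carrier (free_alg X)"
    if "p \<in> carrier (free_alg X)" "q \<in> carrier (free_alg X)" for p q
    using that Poly_Mapping.keys_add[of p q] by (auto simp: free_alg_def)
  have uminus: "- p \<in> carrier (free_alg X)" if "p \<in> carrier (free_alg X)" for p
    using that by (auto simp: free_alg_def)
  have ops: "\<one>\<^bsub>free_alg X\<^esub> = 1" "\<zero>\<^bsub>free_alg X\<^esub> = 0"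
    "p \<otimes>\<^bsub>free_alg X\<^esub> q = p * q" "p \<oplus>\<^bsub>free_alg X\<^esub> q = p + q" for p q
    by (simp_all add: free_alg_def)
  have "abelian_group (free_alg X)"
  proof (rule abelian_groupI)
    fix p assume "p \<in> carrier (free_alg X)"
    then show "\<exists>q \<in> carrier (free_alg X). q \<oplus>\<^bsub>free_alg X\<^esub> p = \<zero>\<^bsub>free_alg X\<^esub>"
      unfolding ops by (intro bexI[OF _ uminus]) simp_all
  next
    show "\<zero>\<^bsub>free_alg X\<^esub> \<in> carrier (free_alg X)"
      by (simp add: free_alg_def)
  qed (simp_all add: ops plus add_ac)
  moreover have "monoid (free_alg X)"
  proof (rule monoidI)
    show "\<one>\<^bsub>free_alg X\<^esub> \<in> carrier (free_alg X)"
      by (simp add: free_alg_def zero_word_def)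
  qed (simp_all add: ops times mult.assoc)
  ultimately show ?thesis
    by (rule ringI) (simp_all add: ops distrib_left distrib_right)
qed

text \<open>
  The algebra \<open>A\<close> is presented by the generators \<open>X\<close>, with \<open>g \<in> X\<close> corresponding to
  \<open>a g\<close>, and the relations \<open>r = 0\<close> for \<open>r \<in> R\<close>: sending each generator to its image induces
  an isomorphism of algebras from the free algebra modulo the two-sided ideal generated by \<open>R\<close>
  onto \<open>A\<close>. Ideals of \<^const>\<open>free_alg\<close> are closed under scalars, so the quotient is an algebra with
  \<open>c \<odot> [p] = [c \<odot> p]\<close>.
\<close>

definition presented_by ::
  "(rat, 'a, 'm) module_scheme \<Rightarrow> 'g set \<Rightarrow> ('g \<Rightarrow> 'a) \<Rightarrow> 'g ncpoly set \<Rightarrow> bool" where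
  "presented_by A X a R \<longleftrightarrow>
    R \<subseteq> carrier (free_alg X) \<and>
    (let F = free_alg X; I = Idl\<^bsub>F\<^esub> R in
     \<exists>\<phi> \<in> ring_iso (F Quot I) A.
       (\<forall>c. \<forall>p \<in> carrier F. \<phi> (I +>\<^bsub>F\<^esub> (c \<odot>\<^bsub>F\<^esub> p)) = c \<odot>\<^bsub>A\<^esub> \<phi> (I +>\<^bsub>F\<^esub> p)) \<and>
       (\<forall>g \<in> X. \<phi> (I +>\<^bsub>F\<^esub> nc_gen g) = a g))"


section \<open>Tensor space\<close>

text \<open>
  With \<open>V = \<rat>\<^sup>n\<close>, the \<open>d\<close>-th tensor power of \<open>V\<close> has the basis
  \<open>v\<^bsub>w 1\<^esub> \<otimes> \<dots> \<otimes> v\<^bsub>w d\<^esub>\<close> indexed by the maps \<open>w\<close> from \<open>{1..d}\<close> to \<open>{1..n}\<close>. A tensor is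
  represented by its coordinates in this basis, extended by \<open>0\<close>.
\<close>

definition multi_indices :: "nat \<Rightarrow> nat \<Rightarrow> (nat \<Rightarrow> nat) set" where
  "multi_indices n d = {1..d} \<rightarrow>\<^sub>E {1..n}"

type_synonym tensor = "(nat \<Rightarrow> nat) \<Rightarrow> rat"

definition tensor_space :: "nat \<Rightarrow> nat \<Rightarrow> tensor set" where
  "tensor_space n d = {t. \<forall>w. w \<notin> multi_indices n d \<longrightarrow> t w = 0}"

text \<open>\<open>v 1 \<otimes> \<dots> \<otimes> v d\<close>, where \<open>v k i\<close> is the \<open>i\<close>-th coordinate of the vector \<open>v k\<close>.\<close>

definition pure_tensor :: "nat \<Rightarrow> nat \<Rightarrow> (nat \<Rightarrow> nat \<Rightarrow> rat) \<Rightarrow> tensor" where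
  "pure_tensor n d v = (\<lambda>w. if w \<in> multi_indices n d then \<Prod>k=1..d. v k (w k) else 0)"

text \<open>Place permutation and the derivation action of \<open>gl\<^sub>n\<close>; see the two lemmas that follow for their
  effect on pure tensors. Matrices are indexed from \<open>1\<close>.\<close>

definition place_perm :: "(nat \<Rightarrow> nat) \<Rightarrow> tensor \<Rightarrow> tensor" where
  "place_perm \<sigma> t = (\<lambda>w. t (w \<circ> \<sigma>))"

definition gl_act :: "nat \<Rightarrow> nat \<Rightarrow> (nat \<Rightarrow> nat \<Rightarrow> rat) \<Rightarrow> tensor \<Rightarrow> tensor" where
  "gl_act n d M = (\<lambda>t \<in> tensor_space n d. \<lambda>w.
     if w \<in> multi_indices n d then \<Sum>k=1..d. \<Sum>j=1..n. M (w k) j * t (w(k := j)) else 0)"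

definition mat_unit :: "nat \<Rightarrow> nat \<Rightarrow> nat \<Rightarrow> nat \<Rightarrow> rat" where
  "mat_unit i j = (\<lambda>a b. if a = i \<and> b = j then 1 else 0)"

lemma multi_indices_comp_iff:
  assumes "\<sigma> permutes {1..d}"
  shows "w \<circ> \<sigma> \<in> multi_indices n d \<longleftrightarrow> w \<in> multi_indices n d"
proof -
  have *: "w \<circ> \<sigma> \<in> multi_indices n d" if "\<sigma> permutes {1..d}" "w \<in> multi_indices n d" for w \<sigma>
    using that permutes_in_image[OF that(1)] permutes_not_in[OF that(1)]
    unfolding multi_indices_def PiE_iff extensional_def by auto
  have "w = (w \<circ> \<sigma>) \<circ> inv_into UNIV \<sigma>"
    using permutes_inv_o(1)[OF assms] by (simp add: o_assoc[symmetric])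
  then show ?thesis
    using *[OF assms, of w] *[OF permutes_inv[OF assms], of "w \<circ> \<sigma>"] by auto
qed

lemma place_perm_pure_tensor:
  assumes "\<sigma> permutes {1..d}"
  shows "place_perm \<sigma> (pure_tensor n d v) = pure_tensor n d (v \<circ> inv_into UNIV \<sigma>)"
proof (rule ext)
  fix w
  have "(\<Prod>k=1..d. (v \<circ> inv_into UNIV \<sigma>) k (w k)) = (\<Prod>k=1..d. (v \<circ> inv_into UNIV \<sigma>) (\<sigma> k) (w (\<sigma> k)))"
    by (rule prod.permute[OF assms, unfolded o_def])
  also have "\<dots> = (\<Prod>k=1..d. v k ((w \<circ> \<sigma>) k))"
    by (simp add: permutes_inverses(2)[OF assms])
  finally show "place_perm \<sigma> (pure_tensor n d v) w = pure_tensor n d (v \<circ> inv_into UNIV \<sigma>) w"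
    by (simp add: place_perm_def pure_tensor_def multi_indices_comp_iff[OF assms])
qed

lemma gl_act_pure_tensor:
  "gl_act n d M (pure_tensor n d v) =
    (\<Sum>k=1..d. pure_tensor n d (v(k := \<lambda>i. \<Sum>j=1..n. M i j * v k j)))"
proof (rule ext)
  fix w
  have sum_app: "(\<Sum>k\<in>A. f k) w = (\<Sum>k\<in>A. f k w)" for A and f :: "nat \<Rightarrow> tensor"
    by (induction A rule: infinite_finite_induct) auto
  have pt: "pure_tensor n d v \<in> tensor_space n d"
    by (simp add: pure_tensor_def tensor_space_def)
  show "gl_act n d M (pure_tensor n d v) w =
    (\<Sum>k=1..d. pure_tensor n d (v(k := \<lambda>i. \<Sum>j=1..n. M i j * v k j))) w"
  proof (cases "w \<in> multi_indices n d")
    case True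
    have "(\<Sum>j=1..n. M (w k) j * pure_tensor n d v (w(k := j))) =
          pure_tensor n d (v(k := \<lambda>i. \<Sum>j=1..n. M i j * v k j)) w" if k: "k \<in> {1..d}" for k
    proof -
      have mem: "w(k := j) \<in> multi_indices n d" if "j \<in> {1..n}" for j
        using True k that unfolding multi_indices_def by (auto simp: PiE_iff extensional_def)
      have "pure_tensor n d v (w(k := j)) = v k j * (\<Prod>l\<in>{1..d}-{k}. v l (w l))" if "j \<in> {1..n}" for j
        using k by (simp add: pure_tensor_def mem[OF that] prod.remove[of _ k])
      moreover have "pure_tensor n d (v(k := \<lambda>i. \<Sum>j=1..n. M i j * v k j)) w =
         (\<Sum>j=1..n. M (w k) j * v k j) * (\<Prod>l\<in>{1..d}-{k}. v l (w l))"
        using k True by (simp add: pure_tensor_def prod.remove[of _ k])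
      ultimately show ?thesis by (simp add: sum_distrib_right mult.assoc)
    qed
    then show ?thesis using True pt by (simp add: gl_act_def sum_app)
  next
    case False
    then show ?thesis using pt by (simp add: gl_act_def sum_app pure_tensor_def)
  qed
qed


section \<open>The Schur algebra\<close>

text \<open>
  Endomorphisms are functions on \<^const>\<open>tensor_space\<close>, made extensional so that equality of
  functions is equality of endomorphisms.
\<close>

definition schur_alg :: "nat \<Rightarrow> nat \<Rightarrow> (rat, tensor \<Rightarrow> tensor) module" where
  "schur_alg n d =
    \<lparr>carrier = {f \<in> tensor_space n d \<rightarrow>\<^sub>E tensor_space n d.
       (\<forall>s \<in> tensor_space n d. \<forall>t \<in> tensor_space n d. f (s + t) = f s + f t) \<and>
       (\<forall>c. \<forall>t \<in> tensor_space n d. f (\<lambda>w. c * t w) = (\<lambda>w. c * f t w)) \<and>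
       (\<forall>\<sigma>. \<sigma> permutes {1..d} \<longrightarrow>
          (\<forall>t \<in> tensor_space n d. f (place_perm \<sigma> t) = place_perm \<sigma> (f t)))},
     monoid.mult = compose (tensor_space n d),
     one = (\<lambda>t \<in> tensor_space n d. t),
     zero = (\<lambda>t \<in> tensor_space n d. 0),
     add = (\<lambda>f g. \<lambda>t \<in> tensor_space n d. f t + g t),
     smult = (\<lambda>c f. \<lambda>t \<in> tensor_space n d. \<lambda>w. c * f t w)\<rparr>"

lemma ring_schur_alg: "ring (schur_alg n d)"
proof -
  define T where "T = tensor_space n d"
  define S where "S = schur_alg n d"
  have T0: "0 \<in> T" and Tadd: "\<And>s t. s \<in> T \<Longrightarrow> t \<in> T \<Longrightarrow> s + t \<in> T"
    and Tscale: "\<And>c t. t \<in> T \<Longrightarrow> (\<lambda>w. c * t w) \<in> T"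
    by (auto simp: T_def tensor_space_def)
  have Tneg: "- t \<in> T" if "t \<in> T" for t
    using that by (auto simp: T_def tensor_space_def)
  have Tperm: "place_perm \<sigma> t \<in> T" if "\<sigma> permutes {1..d}" "t \<in> T" for \<sigma> t
    using that multi_indices_comp_iff[OF that(1)] by (auto simp: T_def tensor_space_def place_perm_def)
  have perm0: "place_perm \<sigma> 0 = 0" and permadd: "place_perm \<sigma> (s + t) = place_perm \<sigma> s + place_perm \<sigma> t"
    and permneg: "place_perm \<sigma> (- t) = - place_perm \<sigma> t" for \<sigma> s t
    by (simp_all add: place_perm_def fun_eq_iff)
  have scale0: "(\<lambda>w. c * (0 :: tensor) w) = 0"
    and scale_add: "(\<lambda>w. c * (s + t) w) = (\<lambda>w. c * s w) + (\<lambda>w. c * t w)"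
    and scale_neg: "(\<lambda>w. c * (- t) w) = - (\<lambda>w. c * t w)" for c and s t :: tensor
    by (simp_all add: fun_eq_iff algebra_simps)
  have carrierI: "f \<in> carrier S"
    if "f \<in> extensional T" "\<And>t. t \<in> T \<Longrightarrow> f t \<in> T"
      "\<And>s t. s \<in> T \<Longrightarrow> t \<in> T \<Longrightarrow> f (s + t) = f s + f t"
      "\<And>c t. t \<in> T \<Longrightarrow> f (\<lambda>w. c * t w) = (\<lambda>w. c * f t w)"
      "\<And>\<sigma> t. \<sigma> permutes {1..d} \<Longrightarrow> t \<in> T \<Longrightarrow> f (place_perm \<sigma> t) = place_perm \<sigma> (f t)" for f
    using that unfolding S_def schur_alg_def T_def[symmetric] by (simp add: PiE_iff)
  have fext: "f \<in> extensional T" and fT: "t \<in> T \<Longrightarrow> f t \<in> T"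
    and fadd: "s \<in> T \<Longrightarrow> t \<in> T \<Longrightarrow> f (s + t) = f s + f t"
    and fscale: "t \<in> T \<Longrightarrow> f (\<lambda>w. c * t w) = (\<lambda>w. c * f t w)"
    and fperm: "\<sigma> permutes {1..d} \<Longrightarrow> t \<in> T \<Longrightarrow> f (place_perm \<sigma> t) = place_perm \<sigma> (f t)"
    if "f \<in> carrier S" for f s t c \<sigma>
    using that unfolding S_def schur_alg_def T_def[symmetric] by (simp_all add: PiE_iff)
  have ops: "\<one>\<^bsub>S\<^esub> = (\<lambda>t \<in> T. t)" "\<zero>\<^bsub>S\<^esub> = (\<lambda>t \<in> T. 0)"
    "f \<otimes>\<^bsub>S\<^esub> g = (\<lambda>t \<in> T. f (g t))" "f \<oplus>\<^bsub>S\<^esub> g = (\<lambda>t \<in> T. f t + g t)" for f g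
    by (simp_all add: S_def schur_alg_def T_def compose_def)
  have eqI: "f = g" if "f \<in> extensional T" "g \<in> extensional T" "\<And>t. t \<in> T \<Longrightarrow> f t = g t" for f g
    using that by (rule extensionalityI)
  have "abelian_group S"
  proof (rule abelian_groupI)
    fix f assume f: "f \<in> carrier S"
    have "(\<lambda>t \<in> T. - f t) \<in> carrier S"
      by (rule carrierI)
        (simp_all add: Tadd Tscale Tperm Tneg permneg scale_neg fT[OF f] fadd[OF f] fscale[OF f] fperm[OF f],
         simp_all add: fun_eq_iff)
    moreover have "(\<lambda>t \<in> T. - f t) \<oplus>\<^bsub>S\<^esub> f = \<zero>\<^bsub>S\<^esub>"
      unfolding ops by (rule eqI) simp_all
    ultimately show "\<exists>g \<in> carrier S. g \<oplus>\<^bsub>S\<^esub> f = \<zero>\<^bsub>S\<^esub>" by blast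
    show "\<zero>\<^bsub>S\<^esub> \<oplus>\<^bsub>S\<^esub> f = f"
      unfolding ops by (rule eqI) (simp_all add: fext[OF f])
  next
    show "\<zero>\<^bsub>S\<^esub> \<in> carrier S"
      unfolding ops by (rule carrierI) (simp_all add: T0 Tadd Tscale Tperm perm0 scale0, simp_all add: fun_eq_iff)
  next
    fix f g assume f: "f \<in> carrier S" and g: "g \<in> carrier S"
    show "f \<oplus>\<^bsub>S\<^esub> g \<in> carrier S"
      unfolding ops
      by (rule carrierI)
        (simp_all add: Tadd Tscale Tperm permadd fT[OF f] fadd[OF f] fscale[OF f] fperm[OF f]
          fT[OF g] fadd[OF g] fscale[OF g] fperm[OF g], simp_all add: fun_eq_iff algebra_simps)
    show "f \<oplus>\<^bsub>S\<^esub> g = g \<oplus>\<^bsub>S\<^esub> f"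
      unfolding ops by (rule eqI) (simp_all add: add.commute)
  next
    fix f g h assume "f \<in> carrier S" "g \<in> carrier S" "h \<in> carrier S"
    show "f \<oplus>\<^bsub>S\<^esub> g \<oplus>\<^bsub>S\<^esub> h = f \<oplus>\<^bsub>S\<^esub> (g \<oplus>\<^bsub>S\<^esub> h)"
      unfolding ops by (rule eqI) (simp_all add: add.assoc)
  qed
  moreover have "monoid S"
  proof (rule monoidI)
    show "\<one>\<^bsub>S\<^esub> \<in> carrier S"
      unfolding ops by (rule carrierI) (simp_all add: Tadd Tscale Tperm)
  next
    fix f assume f: "f \<in> carrier S"
    show "\<one>\<^bsub>S\<^esub> \<otimes>\<^bsub>S\<^esub> f = f" "f \<otimes>\<^bsub>S\<^esub> \<one>\<^bsub>S\<^esub> = f"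
      unfolding ops by (rule eqI; simp add: fext[OF f] fT[OF f])+
  next
    fix f g assume f: "f \<in> carrier S" and g: "g \<in> carrier S"
    show "f \<otimes>\<^bsub>S\<^esub> g \<in> carrier S"
      unfolding ops
      by (rule carrierI)
        (simp_all add: Tadd Tscale Tperm fT[OF f] fadd[OF f] fscale[OF f] fperm[OF f]
          fT[OF g] fadd[OF g] fscale[OF g] fperm[OF g])
  next
    fix f g h assume "f \<in> carrier S" "g \<in> carrier S" and h: "h \<in> carrier S"
    show "f \<otimes>\<^bsub>S\<^esub> g \<otimes>\<^bsub>S\<^esub> h = f \<otimes>\<^bsub>S\<^esub> (g \<otimes>\<^bsub>S\<^esub> h)"
      unfolding ops by (rule eqI) (simp_all add: fT[OF h])
  qed
  ultimately have "ring S"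
  proof (rule ringI)
    fix f g h assume f: "f \<in> carrier S" and g: "g \<in> carrier S" and h: "h \<in> carrier S"
    show "(f \<oplus>\<^bsub>S\<^esub> g) \<otimes>\<^bsub>S\<^esub> h = f \<otimes>\<^bsub>S\<^esub> h \<oplus>\<^bsub>S\<^esub> g \<otimes>\<^bsub>S\<^esub> h"
      unfolding ops by (rule eqI) (simp_all add: fT[OF h])
    show "h \<otimes>\<^bsub>S\<^esub> (f \<oplus>\<^bsub>S\<^esub> g) = h \<otimes>\<^bsub>S\<^esub> f \<oplus>\<^bsub>S\<^esub> h \<otimes>\<^bsub>S\<^esub> g"
      unfolding ops by (rule eqI) (simp_all add: fT[OF f] fT[OF g] fadd[OF h])
  qed
  then show ?thesis by (simp add: S_def)
qed

text \<open>
  Weights live in \<open>\<int>\<^sup>n\<close>, represented by functions vanishing outside \<open>{1..n}\<close>, so that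
  \<open>\<mu> \<plusminus> \<alpha>\<^sub>i\<close> always makes sense and may fail to lie in \<open>\<Lambda>(n,d)\<close>.
\<close>

type_synonym weight = "nat \<Rightarrow> int"

definition Lam :: "nat \<Rightarrow> nat \<Rightarrow> weight set" where
  "Lam n d = {\<mu>. (\<forall>i. 0 \<le> \<mu> i) \<and> (\<forall>i. i \<notin> {1..n} \<longrightarrow> \<mu> i = 0) \<and> (\<Sum>i=1..n. \<mu> i) = int d}"

lemma finite_Lam: "finite (Lam n d)"
proof (rule finite_subset)
  show "Lam n d \<subseteq> {\<mu>. \<forall>i. (i \<in> {1..n} \<longrightarrow> \<mu> i \<in> {0..int d}) \<and> (i \<notin> {1..n} \<longrightarrow> \<mu> i = 0)}"
  proof safe
    fix \<mu> i assume *: "\<mu> \<in> Lam n d" "i \<in> {1..n}"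
    then have "\<mu> i \<le> (\<Sum>i=1..n. \<mu> i)" by (intro member_le_sum) (auto simp: Lam_def)
    with * show "\<mu> i \<in> {0..int d}" by (auto simp: Lam_def)
  qed (simp add: Lam_def)
qed (rule finite_set_of_finite_funs, auto)

definition eps :: "nat \<Rightarrow> weight" where "eps i = (\<lambda>j. if j = i then 1 else 0)"

definition sroot :: "nat \<Rightarrow> weight" where "sroot i = eps i - eps (i + 1)"

definition schur_e :: "nat \<Rightarrow> nat \<Rightarrow> nat \<Rightarrow> tensor \<Rightarrow> tensor" where
  "schur_e n d i = gl_act n d (mat_unit i (i + 1))"

definition schur_f :: "nat \<Rightarrow> nat \<Rightarrow> nat \<Rightarrow> tensor \<Rightarrow> tensor" where
  "schur_f n d i = gl_act n d (mat_unit (i + 1) i)"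

definition schur_H :: "nat \<Rightarrow> nat \<Rightarrow> nat \<Rightarrow> tensor \<Rightarrow> tensor" where
  "schur_H n d i = gl_act n d (mat_unit i i)"

primrec alg_falling :: "(rat, 'a, 'm) module_scheme \<Rightarrow> 'a \<Rightarrow> nat \<Rightarrow> 'a" where
  "alg_falling A x 0 = \<one>\<^bsub>A\<^esub>"
| "alg_falling A x (Suc m) = alg_falling A x m \<otimes>\<^bsub>A\<^esub> (x \<ominus>\<^bsub>A\<^esub> (of_nat m \<odot>\<^bsub>A\<^esub> \<one>\<^bsub>A\<^esub>))"

definition alg_binomial :: "(rat, 'a, 'm) module_scheme \<Rightarrow> 'a \<Rightarrow> nat \<Rightarrow> 'a" where
  "alg_binomial A x m = (1 / fact m) \<odot>\<^bsub>A\<^esub> alg_falling A x m"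

definition schur_idem :: "nat \<Rightarrow> nat \<Rightarrow> weight \<Rightarrow> tensor \<Rightarrow> tensor" where
  "schur_idem n d \<mu> =
    foldr (\<lambda>i x. alg_binomial (schur_alg n d) (schur_H n d i) (nat (\<mu> i)) \<otimes>\<^bsub>schur_alg n d\<^esub> x)
      [1..<n + 1] \<one>\<^bsub>schur_alg n d\<^esub>"


section \<open>Generators and relations\<close>

datatype schur_gen = GIdem weight | GE nat | GF nat

definition schur_gens :: "nat \<Rightarrow> nat \<Rightarrow> schur_gen set" where
  "schur_gens n d = GIdem ` Lam n d \<union> GE ` {1..<n} \<union> GF ` {1..<n}"

primrec schur_gen_elt :: "nat \<Rightarrow> nat \<Rightarrow> schur_gen \<Rightarrow> tensor \<Rightarrow> tensor" where
  "schur_gen_elt n d (GIdem \<mu>) = schur_idem n d \<mu>"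
| "schur_gen_elt n d (GE i) = schur_e n d i"
| "schur_gen_elt n d (GF i) = schur_f n d i"

abbreviation I1 :: "weight \<Rightarrow> schur_gen ncpoly" where "I1 \<mu> \<equiv> nc_gen (GIdem \<mu>)"
abbreviation E1 :: "nat \<Rightarrow> schur_gen ncpoly" where "E1 i \<equiv> nc_gen (GE i)"
abbreviation F1 :: "nat \<Rightarrow> schur_gen ncpoly" where "F1 i \<equiv> nc_gen (GF i)"

text \<open>A relation \<open>l = r\<close> is recorded as the element \<open>l - r\<close> of the free algebra.\<close>

definition rel_R1' :: "nat \<Rightarrow> nat \<Rightarrow> schur_gen ncpoly set" where
  "rel_R1' n d =
    {I1 \<mu> * I1 \<nu> - (if \<mu> = \<nu> then I1 \<mu> else 0) | \<mu> \<nu>. \<mu> \<in> Lam n d \<and> \<nu> \<in> Lam n d} \<union>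
    {(\<Sum>\<mu> \<in> Lam n d. I1 \<mu>) - 1}"

definition rel_R2' :: "nat \<Rightarrow> nat \<Rightarrow> schur_gen ncpoly set" where
  "rel_R2' n d =
    {E1 i * I1 \<mu> - (if \<mu> + sroot i \<in> Lam n d then I1 (\<mu> + sroot i) * E1 i else 0)
       | i \<mu>. i \<in> {1..<n} \<and> \<mu> \<in> Lam n d} \<union>
    {F1 i * I1 \<mu> - (if \<mu> - sroot i \<in> Lam n d then I1 (\<mu> - sroot i) * F1 i else 0)
       | i \<mu>. i \<in> {1..<n} \<and> \<mu> \<in> Lam n d} \<union>
    {I1 \<mu> * E1 i - (if \<mu> - sroot i \<in> Lam n d then E1 i * I1 (\<mu> - sroot i) else 0)
       | i \<mu>. i \<in> {1..<n} \<and> \<mu> \<in> Lam n d} \<union>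
    {I1 \<mu> * F1 i - (if \<mu> + sroot i \<in> Lam n d then F1 i * I1 (\<mu> + sroot i) else 0)
       | i \<mu>. i \<in> {1..<n} \<and> \<mu> \<in> Lam n d}"

definition rel_R3' :: "nat \<Rightarrow> nat \<Rightarrow> schur_gen ncpoly set" where
  "rel_R3' n d =
    {E1 i * F1 j - F1 j * E1 i -
       (if i = j then \<Sum>\<mu> \<in> Lam n d. nc_const (of_int (\<mu> j - \<mu> (j + 1))) * I1 \<mu> else 0)
       | i j. i \<in> {1..<n} \<and> j \<in> {1..<n}}"

definition serre :: "(nat \<Rightarrow> 'g ncpoly) \<Rightarrow> nat \<Rightarrow> nat \<Rightarrow> 'g ncpoly" where
  "serre x i j =
    (if \<bar>int i - int j\<bar> = 1 then (x i)^2 * x j - 2 * x i * x j * x i + x j * (x i)^2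
     else x i * x j - x j * x i)"

definition rel_R4 :: "nat \<Rightarrow> schur_gen ncpoly set" where
  "rel_R4 n = {serre E1 i j | i j. i \<in> {1..<n} \<and> j \<in> {1..<n}}"

definition rel_R5 :: "nat \<Rightarrow> schur_gen ncpoly set" where
  "rel_R5 n = {serre F1 i j | i j. i \<in> {1..<n} \<and> j \<in> {1..<n}}"

definition schur_rels :: "nat \<Rightarrow> nat \<Rightarrow> schur_gen ncpoly set" where
  "schur_rels n d = rel_R1' n d \<union> rel_R2' n d \<union> rel_R3' n d \<union> rel_R4 n \<union> rel_R5 n"

end

theory Submission
  imports Defs
begin

text \<open>
  Call \<open>T\<close> the algebra given by the generators and relations. The relations hold in \<open>S(n,d)\<close>, so there is
  a homomorphism from \<open>T\<close> to \<open>S(n,d)\<close>, and it is an isomorphism because a spanning set of \<open>T\<close> is mapped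
  to a basis of \<open>S(n,d)\<close>.

  The Serre relations give root vectors in \<open>T\<close> whose span together with the weight operators
  \<open>\<Sum>\<^sub>\<mu> \<mu>\<^sub>i 1\<^sub>\<mu>\<close> is closed under commutators. Hence reordering a product of root vectors to the left of
  \<open>1\<^sub>\<mu>\<close> costs only shorter products. If column \<open>j\<close> occurs more than \<open>\<mu>\<^sub>j\<close> times, the factors of that
  column can be moved to the right, where they annihilate \<open>1\<^sub>\<mu>\<close>. So the products in which column \<open>j\<close>
  occurs at most \<open>\<mu>\<^sub>j\<close> times, one for each multiset of roots, span \<open>T\<close>.

  Such pairs of a multiset and a weight correspond to the orbits of the symmetric group on pairs \<open>(v, w)\<close>
  of multi-indices, the multiset being that of the pairs \<open>(v\<^sub>k, w\<^sub>k)\<close> with \<open>v\<^sub>k \<noteq> w\<^sub>k\<close>. An endomorphism in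
  \<open>S(n,d)\<close> is a function on these orbits, and the matrix of the spanning set with respect to the orbits
  is triangular for the size of the multiset, with positive diagonal.
\<close>

section \<open>Root vectors from the Serre relations\<close>

text \<open>A word of root vectors is always considered next to some \<open>1\<^sub>\<mu>\<close>.
  This is why commutators shorten it: they may contain weight operators, but those act on a weight
  vector by scalars and add no letter. It is also why a long block of one column vanishes: each
  factor of column \<open>j\<close> lowers the \<open>j\<close>-th entry of the weight by one, and
  below zero there is no idempotent left.

  Root vectors are iterated brackets of the generators. Stability of their span is checked for
  brackets with generators, and the Jacobi identity does the rest. One bracket, that of a root
  vector of length at least three with its second generator, does not vanish term by term; it turns
  out to equal its own negative, and the rational scalars allow division by two.

  Linear independence in \<open>T\<close> gets no proof of its own. One square triangular matrix
  yields surjectivity by solving a system, and its trivial kernel, joined with the spanning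
  property, yields injectivity.\<close>

definition lie :: "'a::ring_1 \<Rightarrow> 'a \<Rightarrow> 'a" where
  "lie a b = a * b - b * a"

lemma lie_simps [simp]:
  "lie a 0 = 0" "lie 0 a = 0" "lie a a = 0" "lie a (- b) = - lie a b" "lie (- a) b = - lie a b"
  by (simp_all add: lie_def)

lemma lie_add_right: "lie a (b + c) = lie a b + lie a c"
  and lie_diff_right: "lie a (b - c) = lie a b - lie a c"
  and lie_diff_left: "lie (b - c) a = lie b a - lie c a"
  by (simp_all add: lie_def algebra_simps)

lemma lie_flip: "lie a b = - lie b a"
  by (simp add: lie_def)

lemma lie_jacobi: "lie a (lie b c) = lie (lie a b) c + lie b (lie a c)"
  by (simp add: lie_def algebra_simps)

text \<open>\<open>root_vec x i m\<close> stands for the matrix unit in row \<open>i\<close> and column \<open>i + m + 1\<close>.\<close>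

primrec root_vec :: "(nat \<Rightarrow> 'a::ring_1) \<Rightarrow> nat \<Rightarrow> nat \<Rightarrow> 'a" where
  "root_vec x i 0 = x i"
| "root_vec x i (Suc m) = lie (x i) (root_vec x (Suc i) m)"

text \<open>Shared by both triangular halves: the instances are \<open>(e, f, H)\<close> and
  \<open>(- f, - e, - H)\<close>. \<open>two_cancel\<close> is what remains here of the rational
  scalars.\<close>

locale gl_relations =
  fixes n :: nat and x y h :: "nat \<Rightarrow> 'a::ring_1"
  assumes two_cancel: "\<And>z :: 'a. z + z = 0 \<Longrightarrow> z = 0"
    and xy: "i \<in> {1..<n} \<Longrightarrow> j \<in> {1..<n} \<Longrightarrow> lie (x i) (y j) = (if i = j then h i - h (Suc i) else 0)"
    and hx: "i \<in> {1..n} \<Longrightarrow> j \<in> {1..<n} \<Longrightarrow>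
      lie (h i) (x j) = (if i = j then x j else if i = Suc j then - x j else 0)"
    and x_far: "i \<in> {1..<n} \<Longrightarrow> j \<in> {1..<n} \<Longrightarrow> Suc i < j \<or> Suc j < i \<Longrightarrow> lie (x i) (x j) = 0"
    and x_near: "i \<in> {1..<n} \<Longrightarrow> j \<in> {1..<n} \<Longrightarrow> j = Suc i \<or> i = Suc j \<Longrightarrow> lie (x i) (lie (x i) (x j)) = 0"
begin

abbreviation "U \<equiv> root_vec x"

lemma lie_x_root_vec_far:
  assumes "1 \<le> i" "i + m < n" "k \<in> {1..<n}" "Suc k < i \<or> i + m + 1 < k"
  shows "lie (x k) (U i m) = 0"
  using assms
proof (induction m arbitrary: i)
  case 0
  then show ?case using x_far[of k i] by auto
next
  case (Suc m)
  have "lie (x k) (x i) = 0" using Suc.prems by (intro x_far) auto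
  moreover have "lie (x k) (U (Suc i) m) = 0" using Suc.prems by (intro Suc.IH) auto
  ultimately show ?case by (simp add: lie_jacobi[of "x k"])
qed

text \<open>\<open>root_vec\<close> grows at its left end. Appending at the right agrees with this
  because the first generator commutes with the appended one, so Jacobi carries the bracket
  inwards.\<close>

lemma root_vec_Suc_right:
  assumes "1 \<le> i" "i + m + 1 < n"
  shows "lie (U i m) (x (i + m + 1)) = U i (Suc m)"
  using assms
proof (induction m arbitrary: i)
  case (Suc m)
  have "lie (x i) (x (i + m + 2)) = 0" using Suc.prems by (intro x_far) auto
  moreover have "lie (U (Suc i) m) (x (i + m + 2)) = U (Suc i) (Suc m)"
    using Suc.IH[of "Suc i"] Suc.prems by simp
  ultimately show ?case
    using lie_jacobi[of "x i" "U (Suc i) m" "x (i + m + 2)"] by simp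
qed simp

text \<open>\<open>x i\<close> commutes with the tail from \<open>i + 2\<close> on, so the bracket
  regroups around \<open>lie (x i) (x (Suc i))\<close>, the element that the cubic Serre relations
  speak about.\<close>

lemma root_vec_Suc_Suc:
  assumes "1 \<le> i" "i + m + 2 < n"
  shows "U i (Suc (Suc m)) = lie (lie (x i) (x (Suc i))) (U (Suc (Suc i)) m)"
proof -
  have "lie (x i) (U (Suc (Suc i)) m) = 0"
    using assms by (intro lie_x_root_vec_far) auto
  then show ?thesis by (simp add: lie_jacobi[of "x i"])
qed

lemma lie_x_root_vec_first:
  assumes "1 \<le> i" "i + m + 1 < n"
  shows "lie (x i) (U i (Suc m)) = 0"
proof (cases m)
  case 0
  then show ?thesis using x_near[of i "Suc i"] assms by simp
next
  case (Suc m')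
  have "lie (x i) (U (Suc (Suc i)) m') = 0"
    using assms Suc by (intro lie_x_root_vec_far) auto
  moreover have "lie (x i) (lie (x i) (x (Suc i))) = 0"
    using assms by (intro x_near) auto
  ultimately show ?thesis
    using root_vec_Suc_Suc[of i m'] lie_jacobi[of "x i" "lie (x i) (x (Suc i))" "U (Suc (Suc i)) m'"] assms Suc
    by simp
qed

text \<open>Expanding through \<open>x i\<close> gives
  \<open>?X = - lie ?a (lie (x (Suc i)) ?V)\<close>. Carrying \<open>?a\<close> inwards, with
  \<open>lie ?a (x (Suc i)) = 0\<close> by Serre, turns the right side into
  \<open>- ?X\<close>.\<close>

lemma lie_x_root_vec_second:
  assumes "1 \<le> i" "i + m + 2 < n"
  shows "lie (x (Suc i)) (U i (Suc (Suc m))) = 0"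
proof -
  let ?a = "lie (x i) (x (Suc i))" and ?V = "U (Suc (Suc i)) m"
  let ?X = "lie (x (Suc i)) (U i (Suc (Suc m)))"
  have a: "lie (x (Suc i)) ?a = 0"
    using x_near[of "Suc i" i] assms lie_flip[of "x i" "x (Suc i)"] by simp
  have V: "U i (Suc (Suc m)) = lie ?a ?V"
    using assms by (rule root_vec_Suc_Suc)
  have "lie (x (Suc i)) (U (Suc i) (Suc m)) = 0"
    using assms by (intro lie_x_root_vec_first) auto
  then have "?X = lie (lie (x (Suc i)) (x i)) (U (Suc i) (Suc m))"
    using lie_jacobi[of "x (Suc i)" "x i" "U (Suc i) (Suc m)"] by simp
  also have "\<dots> = - lie ?a (lie (x (Suc i)) ?V)"
    by (simp add: lie_flip[of "x (Suc i)" "x i"])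
  also have "\<dots> = - (lie (lie ?a (x (Suc i))) ?V + lie (x (Suc i)) (lie ?a ?V))"
    by (simp add: lie_jacobi[of ?a])
  also have "\<dots> = - ?X"
    using a V lie_flip[of ?a "x (Suc i)"] by simp
  finally have "?X + ?X = 0" by (metis add.right_inverse)
  then show ?thesis by (rule two_cancel)
qed

text \<open>Beyond the second generator, \<open>x k\<close> commutes with \<open>x i\<close> and the
  claim passes to the tail. The first two generators are the special cases above.\<close>

lemma lie_x_root_vec_inner:
  assumes "1 \<le> i" "i + m < n" "i \<le> k" "k \<le> i + m"
  shows "lie (x k) (U i m) = 0"
  using assms
proof (induction m arbitrary: i)
  case (Suc m)
  consider "k = i" | "k = Suc i" "m = 0" | m' where "k = Suc i" "m = Suc m'" | "Suc i < k"
    using Suc.prems by (metis le_neq_implies_less not0_implies_Suc not_less_eq not_less_iff_gr_or_eq)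
  then show ?case
  proof cases
    case 1
    then show ?thesis using lie_x_root_vec_first[of i m] Suc.prems by simp
  next
    case 2
    then show ?thesis
      using x_near[of "Suc i" i] Suc.prems lie_flip[of "x i" "x (Suc i)"] by simp
  next
    case 3
    then show ?thesis using lie_x_root_vec_second[of i m'] Suc.prems by simp
  next
    case 4
    have "lie (x k) (x i) = 0" using Suc.prems 4 by (intro x_far) auto
    moreover have "lie (x k) (U (Suc i) m) = 0" using Suc.prems 4 by (intro Suc.IH) auto
    ultimately show ?thesis by (simp add: lie_jacobi[of "x k"])
  qed
qed simp

text \<open>The product rule of matrix units for \<open>(k, k + 1)\<close> against
  \<open>(i, i + m + 1)\<close>, obtained from the relations among the \<open>x\<close>
  alone.\<close>

lemma lie_x_root_vec:
  assumes "1 \<le> i" "i + m < n" "k \<in> {1..<n}"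
  shows "lie (x k) (U i m) =
    (if Suc k = i then U k (Suc m) else if k = i + m + 1 then - U i (Suc m) else 0)"
proof -
  consider "Suc k = i" | "k = i + m + 1" | "i \<le> k" "k \<le> i + m" | "Suc k < i \<or> i + m + 1 < k"
    by linarith
  then show ?thesis
  proof cases
    case 1
    then show ?thesis by simp
  next
    case 2
    then show ?thesis
      using root_vec_Suc_right[of i m] lie_flip[of "x k" "U i m"] assms by simp
  next
    case 3
    then show ?thesis using lie_x_root_vec_inner[of i m k] assms by simp
  next
    case 4
    then show ?thesis using lie_x_root_vec_far[of i m k] assms by auto
  qed
qed

lemma lie_h_root_vec:
  assumes "1 \<le> i" "i + m < n" "k \<in> {1..n}"
  shows "lie (h k) (U i m) = (if k = i then U i m else if k = i + m + 1 then - U i m else 0)"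
  using assms
proof (induction m arbitrary: i)
  case 0
  then show ?case using hx[of k i] by simp
next
  case (Suc m)
  have 1: "lie (h k) (x i) = (if k = i then x i else if k = Suc i then - x i else 0)"
    using Suc.prems by (intro hx) auto
  have 2: "lie (h k) (U (Suc i) m) =
      (if k = Suc i then U (Suc i) m else if k = Suc i + m + 1 then - U (Suc i) m else 0)"
    using Suc.prems by (intro Suc.IH) auto
  show ?case
    using lie_jacobi[of "h k" "x i" "U (Suc i) m"] by (simp add: 1 2)
qed

lemma lie_y_root_vec_0:
  assumes "i \<in> {1..<n}" "k \<in> {1..<n}"
  shows "lie (y k) (U i 0) = (if k = i then h (Suc i) - h i else 0)"
  using xy[of i k] assms lie_flip[of "y k" "x i"] by auto

text \<open>\<open>y k\<close> strips the first or the last generator. Two generators form the base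
  because there both inner brackets are differences of \<open>h\<close>; in a longer vector only the
  first generator meets \<open>h\<close>, and the tail is treated by induction.\<close>

lemma lie_y_root_vec_Suc:
  assumes "1 \<le> i" "i + Suc m < n" "k \<in> {1..<n}"
  shows "lie (y k) (U i (Suc m)) =
    (if k = i then U (Suc i) m else if k = i + Suc m then - U i m else 0)"
  using assms
proof (induction m arbitrary: i)
  case 0
  have 1: "lie (y k) (x i) = (if k = i then h (Suc i) - h i else 0)"
    using lie_y_root_vec_0[of i k] 0 by simp
  have 2: "lie (y k) (x (Suc i)) = (if k = Suc i then h (Suc (Suc i)) - h (Suc i) else 0)"
    using lie_y_root_vec_0[of "Suc i" k] 0 by simp
  have 3: "lie (x i) (h j) = - (if j = i then x i else if j = Suc i then - x i else 0)"
    if "j \<in> {1..n}" for j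
    using hx[of j i] lie_flip[of "x i" "h j"] 0 that by simp
  show ?case
    using 0 hx[of i "Suc i"] hx[of "Suc i" "Suc i"]
    by (auto simp: lie_jacobi[of "y k"] 1 2 3 lie_diff_left lie_diff_right)
next
  case (Suc m)
  have 1: "lie (y k) (x i) = (if k = i then h (Suc i) - h i else 0)"
    using lie_y_root_vec_0[of i k] Suc.prems by simp
  have 2: "lie (y k) (U (Suc i) (Suc m)) =
      (if k = Suc i then U (Suc (Suc i)) m else if k = Suc i + Suc m then - U (Suc i) m else 0)"
    using Suc.prems by (intro Suc.IH) auto
  have 3: "lie (x i) (U (Suc (Suc i)) m) = 0"
    using Suc.prems by (intro lie_x_root_vec_far) auto
  have 4: "lie (h j) (U (Suc i) (Suc m)) = (if j = Suc i then U (Suc i) (Suc m) else 0)" if "j = i \<or> j = Suc i" for j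
    using lie_h_root_vec[of "Suc i" "Suc m" j] that Suc.prems by auto
  show ?case
    unfolding root_vec.simps(2)[of x i "Suc m"] lie_jacobi[of "y k" "x i"]
    using 3 by (auto simp: 1 2 4 lie_diff_left simp del: root_vec.simps(2)) simp
qed

end

section \<open>A spanning set of the presented algebra\<close>

text \<open>An arbitrary order suffices: in front of an idempotent, two orders of the same root
  vectors differ by shorter words.\<close>

definition mset_list :: "'b multiset \<Rightarrow> 'b list" where
  "mset_list D = (SOME ps. mset ps = D)"

lemma mset_mset_list [simp]: "mset (mset_list D) = D"
  unfolding mset_list_def using ex_mset[of D] by (rule someI_ex)

definition roots :: "nat \<Rightarrow> (nat \<times> nat) set" where
  "roots n = {(i, j). i \<in> {1..n} \<and> j \<in> {1..n} \<and> i \<noteq> j}"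

text \<open>The pair \<open>(D, \<mu>)\<close> indexes the products of the root vectors in \<open>D\<close> (in some order) with \<open>1\<^sub>\<mu>\<close>;
  the side condition says that \<open>D\<close> asks for at most \<open>\<mu> j\<close> replacements of the basis vector \<open>v\<^sub>j\<close>.\<close>

definition pbw_index :: "nat \<Rightarrow> nat \<Rightarrow> ((nat \<times> nat) multiset \<times> weight) set" where
  "pbw_index n d = {(D, \<mu>). set_mset D \<subseteq> roots n \<and> \<mu> \<in> Lam n d \<and>
     (\<forall>j. int (count (image_mset snd D) j) \<le> \<mu> j)}"

text \<open>The relations of \<open>gl\<^sub>n\<close> are preserved by exchanging \<open>(e, f, H)\<close> with \<open>(- f, - e, - H)\<close>, which sends the matrix
  unit \<open>(i, j)\<close> to minus the matrix unit \<open>(j, i)\<close>. This explains the signs below the diagonal.\<close>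

definition mat_elt :: "(nat \<Rightarrow> 'a::ring_1) \<Rightarrow> (nat \<Rightarrow> 'a) \<Rightarrow> nat \<times> nat \<Rightarrow> 'a" where
  "mat_elt x y p = (case p of (i, j) \<Rightarrow>
     if i < j then root_vec x i (j - i - 1) else - root_vec (\<lambda>k. - y k) j (i - j - 1))"

definition mat_word :: "(nat \<Rightarrow> 'a::ring_1) \<Rightarrow> (nat \<Rightarrow> 'a) \<Rightarrow> (nat \<times> nat) list \<Rightarrow> 'a" where
  "mat_word x y ps = prod_list (map (mat_elt x y) ps)"

lemma mat_word_simps [simp]:
  "mat_word x y [] = 1" "mat_word x y (p # ps) = mat_elt x y p * mat_word x y ps"
  "mat_word x y (ps @ qs) = mat_word x y ps * mat_word x y qs"
  by (simp_all add: mat_word_def)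

text \<open>A rational algebra in type-class form: \<open>\<kappa>\<close> is the structure map into
  the centre. The instances are the operators on tensors and the product of the presented
  algebras.\<close>

locale rat_scalars =
  fixes \<kappa> :: "rat \<Rightarrow> 'a::ring_1"
  assumes scalar_add: "\<kappa> (a + b) = \<kappa> a + \<kappa> b"
    and scalar_mult: "\<kappa> (a * b) = \<kappa> a * \<kappa> b"
    and scalar_1: "\<kappa> 1 = 1"
    and scalar_comm: "z * \<kappa> a = \<kappa> a * z"
begin

sublocale V: vector_space "\<lambda>c z. \<kappa> c * z"
  by unfold_locales (simp_all add: scalar_add scalar_mult scalar_1 distrib_left distrib_right mult.assoc)

lemma scalar_0 [simp]: "\<kappa> 0 = 0"
  using scalar_add[of 0 0] by simp

lemma scalar_neg: "\<kappa> (- a) = - \<kappa> a"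
  using scalar_add[of a "- a"] by (simp add: eq_neg_iff_add_eq_0 add.commute)

lemma scalar_diff: "\<kappa> (a - b) = \<kappa> a - \<kappa> b"
  using scalar_add[of a "- b"] by (simp add: scalar_neg)

lemma scalar_left_commute: "z * (\<kappa> a * w) = \<kappa> a * (z * w)"
  by (metis scalar_comm mult.assoc)

lemma span_image_subset:
  assumes z: "z \<in> V.span S" and S: "\<And>s. s \<in> S \<Longrightarrow> \<phi> s \<in> V.span T"
    and add: "\<And>a b. \<phi> (a + b) = \<phi> a + \<phi> b" and scale: "\<And>c a. \<phi> (\<kappa> c * a) = \<kappa> c * \<phi> a"
  shows "\<phi> z \<in> V.span T"
  using z
proof (induction rule: V.span_induct_alt)
  case base
  have "\<phi> 0 = 0" using add[of 0 0] by simp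
  then show ?case by (simp add: V.span_zero)
next
  case (step c x y)
  then show ?case by (simp add: add scale V.span_add V.span_scale S)
qed

end

text \<open>\<open>P\<close> vanishes outside \<open>\<Lambda>(n,d)\<close>, which merges the two
  cases of each relation in R2' into one equation. The sum of the \<open>P \<mu>\<close> acts as a
  unit on the generators but may differ from \<open>1\<close>, because the presented algebra will be
  one factor of a larger ring.\<close>

locale schur_presentation = rat_scalars \<kappa> for \<kappa> :: "rat \<Rightarrow> 'a::ring_1" +
  fixes n d :: nat and P :: "weight \<Rightarrow> 'a" and e f :: "nat \<Rightarrow> 'a"
  assumes P_outside: "\<mu> \<notin> Lam n d \<Longrightarrow> P \<mu> = 0"
    and P_mult: "P \<mu> * P \<nu> = (if \<mu> = \<nu> then P \<mu> else 0)"
    and e_P: "i \<in> {1..<n} \<Longrightarrow> e i * P \<mu> = P (\<mu> + sroot i) * e i"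
    and f_P: "i \<in> {1..<n} \<Longrightarrow> f i * P \<mu> = P (\<mu> - sroot i) * f i"
    and e_unit: "i \<in> {1..<n} \<Longrightarrow> e i * (\<Sum>\<mu>\<in>Lam n d. P \<mu>) = e i"
    and f_unit: "i \<in> {1..<n} \<Longrightarrow> f i * (\<Sum>\<mu>\<in>Lam n d. P \<mu>) = f i"
    and lie_e_f: "i \<in> {1..<n} \<Longrightarrow> j \<in> {1..<n} \<Longrightarrow> lie (e i) (f j) =
      (if i = j then (\<Sum>\<mu>\<in>Lam n d. \<kappa> (of_int (\<mu> j - \<mu> (Suc j))) * P \<mu>) else 0)"
    and e_far: "i \<in> {1..<n} \<Longrightarrow> j \<in> {1..<n} \<Longrightarrow> Suc i < j \<or> Suc j < i \<Longrightarrow> lie (e i) (e j) = 0"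
    and e_near: "i \<in> {1..<n} \<Longrightarrow> j \<in> {1..<n} \<Longrightarrow> j = Suc i \<or> i = Suc j \<Longrightarrow> lie (e i) (lie (e i) (e j)) = 0"
    and f_far: "i \<in> {1..<n} \<Longrightarrow> j \<in> {1..<n} \<Longrightarrow> Suc i < j \<or> Suc j < i \<Longrightarrow> lie (f i) (f j) = 0"
    and f_near: "i \<in> {1..<n} \<Longrightarrow> j \<in> {1..<n} \<Longrightarrow> j = Suc i \<or> i = Suc j \<Longrightarrow> lie (f i) (lie (f i) (f j)) = 0"
begin

definition H :: "nat \<Rightarrow> 'a" where "H i = (\<Sum>\<mu>\<in>Lam n d. \<kappa> (of_int (\<mu> i)) * P \<mu>)"

lemma H_P: "H i * P \<mu> = \<kappa> (of_int (\<mu> i)) * P \<mu>"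
proof (cases "\<mu> \<in> Lam n d")
  case True
  then show ?thesis
    by (simp add: H_def sum_distrib_right mult.assoc P_mult finite_Lam if_distrib[of "\<lambda>z. \<kappa> _ * z"]
        cong: if_cong)
qed (simp add: P_outside)

text \<open>In \<open>lie (H i) z * P \<mu>\<close> the first product contributes the scalar
  \<open>(\<mu> + \<gamma>) i\<close> and the second \<open>\<mu> i\<close>. Summing over
  \<open>\<mu>\<close> and using the unit property removes \<open>P \<mu>\<close>.\<close>

lemma lie_H_shift:
  assumes "\<And>\<mu>. z * P \<mu> = P (\<mu> + \<gamma>) * z" and "z * (\<Sum>\<mu>\<in>Lam n d. P \<mu>) = z"
  shows "lie (H i) z = \<kappa> (of_int (\<gamma> i)) * z"
proof -
  have "lie (H i) z * P \<mu> = \<kappa> (of_int (\<gamma> i)) * (z * P \<mu>)" for \<mu>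
  proof -
    have "H i * z * P \<mu> = H i * P (\<mu> + \<gamma>) * z"
      by (simp add: assms(1) mult.assoc)
    also have "\<dots> = \<kappa> (of_int (\<mu> i) + of_int (\<gamma> i)) * (z * P \<mu>)"
      by (simp add: H_P assms(1) mult.assoc)
    finally show ?thesis
      by (simp add: lie_def left_diff_distrib mult.assoc H_P scalar_add scalar_left_commute distrib_right)
  qed
  then have "(\<Sum>\<mu>\<in>Lam n d. lie (H i) z * P \<mu>) = \<kappa> (of_int (\<gamma> i)) * (\<Sum>\<mu>\<in>Lam n d. z * P \<mu>)"
    by (simp add: sum_distrib_left)
  moreover have "(\<Sum>\<mu>\<in>Lam n d. lie (H i) z * P \<mu>) = lie (H i) z * (\<Sum>\<mu>\<in>Lam n d. P \<mu>)"
    by (simp add: sum_distrib_left)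
  moreover have "H i * (\<Sum>\<mu>\<in>Lam n d. P \<mu>) = H i"
    by (simp add: sum_distrib_left H_P) (simp add: H_def)
  ultimately show ?thesis
    by (simp add: lie_def left_diff_distrib mult.assoc assms(2) flip: sum_distrib_left)
qed

lemma lie_H_e:
  assumes "i \<in> {1..n}" "j \<in> {1..<n}"
  shows "lie (H i) (e j) = (if i = j then e j else if i = Suc j then - e j else 0)"
  using lie_H_shift[OF e_P e_unit, of j i] assms
  by (auto simp: sroot_def eps_def scalar_1 scalar_neg)

lemma lie_H_f:
  assumes "i \<in> {1..n}" "j \<in> {1..<n}"
  shows "lie (H i) (f j) = (if i = j then - f j else if i = Suc j then f j else 0)"
proof -
  have "lie (H i) (f j) = \<kappa> (of_int ((- sroot j) i)) * f j"
    by (rule lie_H_shift) (use f_P[of j] f_unit[of j] assms in \<open>simp_all only: diff_conv_add_uminus\<close>)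
  then show ?thesis by (auto simp: sroot_def eps_def scalar_1 scalar_neg)
qed

lemma lie_e_f_H:
  assumes "i \<in> {1..<n}" "j \<in> {1..<n}"
  shows "lie (e i) (f j) = (if i = j then H i - H (Suc i) else 0)"
  unfolding lie_e_f[OF assms] by (auto simp: H_def scalar_diff left_diff_distrib sum_subtractf)

lemma two_cancel: "z + z = 0 \<Longrightarrow> z = 0" for z :: 'a
proof -
  assume "z + z = 0"
  then have "\<kappa> (1 / 2) * (z + z) = 0" by simp
  moreover have "\<kappa> (1 / 2) * (z + z) = \<kappa> (1 / 2 + 1 / 2) * z"
    unfolding scalar_add by (simp add: distrib_left distrib_right)
  ultimately show "z = 0" by (simp add: scalar_1)
qed

sublocale upper: gl_relations n e f H
  by unfold_locales (rule two_cancel, assumption, simp_all add: lie_e_f_H lie_H_e e_far e_near)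

sublocale lower: gl_relations n "\<lambda>i. - f i" "\<lambda>i. - e i" "\<lambda>i. - H i"
proof unfold_locales
  show "lie (- f i) (- e j) = (if i = j then - H i - - H (Suc i) else 0)"
    if "i \<in> {1..<n}" "j \<in> {1..<n}" for i j
    using lie_e_f_H[of j i] that by (simp add: lie_flip[of "f i"])
qed (rule two_cancel, assumption, simp_all add: lie_H_f f_far f_near)

section \<open>The image of the Lie algebra and its closure under commutators\<close>

definition G :: "nat \<times> nat \<Rightarrow> 'a" where
  "G p = (if fst p = snd p then H (fst p) else mat_elt e f p)"

lemma G_upper: "i < j \<Longrightarrow> G (i, j) = root_vec e i (j - i - 1)"
  and G_lower: "j < i \<Longrightarrow> G (i, j) = - root_vec (\<lambda>k. - f k) j (i - j - 1)"
  and G_diag: "G (i, i) = H i"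
  by (simp_all add: G_def mat_elt_def)

text \<open>The image of \<open>gl\<^sub>n\<close>. Membership in a span is enough for the
  straightening, so the structure constants of general pairs of matrix units are never
  computed.\<close>

definition gl_span :: "'a set" where
  "gl_span = V.span (G ` ({1..n} \<times> {1..n}))"

lemma G_gl_span: "i \<in> {1..n} \<Longrightarrow> j \<in> {1..n} \<Longrightarrow> G (i, j) \<in> gl_span"
  unfolding gl_span_def by (rule V.span_base) auto

lemma gl_span_closed:
  "0 \<in> gl_span" "a \<in> gl_span \<Longrightarrow> - a \<in> gl_span"
  "a \<in> gl_span \<Longrightarrow> b \<in> gl_span \<Longrightarrow> a - b \<in> gl_span"
  by (simp_all add: gl_span_def V.span_zero V.span_neg V.span_diff)

lemma root_vec_gl_span:
  assumes "1 \<le> i" "i + m < n"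
  shows "root_vec e i m \<in> gl_span" "root_vec (\<lambda>k. - f k) i m \<in> gl_span"
proof -
  show "root_vec e i m \<in> gl_span"
    using G_gl_span[of i "i + m + 1"] G_upper[of i "i + m + 1"] assms by simp
  have "root_vec (\<lambda>k. - f k) i m = - G (i + m + 1, i)"
    using G_lower[of i "i + m + 1"] by simp
  then show "root_vec (\<lambda>k. - f k) i m \<in> gl_span"
    using G_gl_span[of "i + m + 1" i] assms by (simp add: gl_span_closed(2))
qed

lemma gl_span_lie:
  assumes "\<And>i j. i \<in> {1..n} \<Longrightarrow> j \<in> {1..n} \<Longrightarrow> lie a (G (i, j)) \<in> gl_span" and z: "z \<in> gl_span"
  shows "lie a z \<in> gl_span"
  using z unfolding gl_span_def
proof (rule span_image_subset[where \<phi> = "lie a"])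
  show "lie a s \<in> V.span (G ` ({1..n} \<times> {1..n}))" if "s \<in> G ` ({1..n} \<times> {1..n})" for s
    using that assms(1) by (auto simp: gl_span_def)
  show "lie a (\<kappa> c * b) = \<kappa> c * lie a b" for c b
    by (simp add: lie_def right_diff_distrib scalar_left_commute mult.assoc)
qed (rule lie_add_right)

lemma H_gl_span: "i \<in> {1..n} \<Longrightarrow> H i \<in> gl_span"
  using G_gl_span[of i i] by (simp add: G_diag)

text \<open>Above the diagonal \<open>e k\<close> lengthens a root vector of \<open>upper\<close> or
  kills it. Below, \<open>- e k\<close> is the opposite generator of \<open>lower\<close>: it
  shortens a root vector or kills it, and turns a single generator into a difference of weight
  operators or zero.\<close>

lemma ad_e_gl_span:
  assumes k: "k \<in> {1..<n}" and z: "z \<in> gl_span"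
  shows "lie (e k) z \<in> gl_span"
proof (rule gl_span_lie[OF _ z])
  fix i j assume i: "i \<in> {1..n}" and j: "j \<in> {1..n}"
  consider "i = j" | "i < j" | "j < i" "i - j - 1 = 0" | m where "j < i" "i - j - 1 = Suc m"
    by (metis linorder_cases not0_implies_Suc)
  then show "lie (e k) (G (i, j)) \<in> gl_span"
  proof cases
    case 1
    then show ?thesis
      using root_vec_gl_span(1)[of k 0] lie_H_e[of i k] k i lie_flip[of "e k" "H i"]
      by (simp add: G_diag gl_span_closed)
  next
    case 2
    show ?thesis
      using upper.lie_x_root_vec[of i "j - i - 1" k] root_vec_gl_span[of i "Suc (j - i - 1)"]
        root_vec_gl_span[of k "Suc (j - i - 1)"] 2 i j k
      by (auto simp: G_upper gl_span_closed simp del: root_vec.simps)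
  next
    case 3
    show ?thesis
      using lower.lie_y_root_vec_0[of j k] 3 i j k H_gl_span[of j] H_gl_span[of "Suc j"]
      by (auto simp: G_lower gl_span_closed)
  next
    case 4
    show ?thesis
      using lower.lie_y_root_vec_Suc[of j m k] 4 i j k root_vec_gl_span(2)[of "Suc j" m] root_vec_gl_span(2)[of j m]
      by (auto simp: G_lower gl_span_closed simp del: root_vec.simps)
  qed
qed

lemma ad_f_gl_span:
  assumes k: "k \<in> {1..<n}" and z: "z \<in> gl_span"
  shows "lie (- f k) z \<in> gl_span"
proof (rule gl_span_lie[OF _ z])
  fix i j assume i: "i \<in> {1..n}" and j: "j \<in> {1..n}"
  consider "i = j" | "j < i" | "i < j" "j - i - 1 = 0" | m where "i < j" "j - i - 1 = Suc m"
    by (metis linorder_cases not0_implies_Suc)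
  then show "lie (- f k) (G (i, j)) \<in> gl_span"
  proof cases
    case 1
    then show ?thesis
      using root_vec_gl_span(2)[of k 0] lie_H_f[of i k] k i lie_flip[of "f k" "H i"] gl_span_closed(2)[of "- f k"]
      by (simp add: G_diag gl_span_closed)
  next
    case 2
    show ?thesis
      using lower.lie_x_root_vec[of j "i - j - 1" k] root_vec_gl_span[of j "Suc (i - j - 1)"]
        root_vec_gl_span[of k "Suc (i - j - 1)"] 2 i j k
      by (auto simp: G_lower gl_span_closed simp del: root_vec.simps)
  next
    case 3
    show ?thesis
      using upper.lie_y_root_vec_0[of i k] 3 i j k H_gl_span[of i] H_gl_span[of "Suc i"]
      by (auto simp: G_upper gl_span_closed)
  next
    case 4
    show ?thesis
      using upper.lie_y_root_vec_Suc[of i m k] 4 i j k root_vec_gl_span(1)[of "Suc i" m] root_vec_gl_span(1)[of i m]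
      by (auto simp: G_upper gl_span_closed simp del: root_vec.simps)
  qed
qed

text \<open>Bracketing with \<open>lie a b\<close> is the commutator of bracketing with
  \<open>a\<close> and with \<open>b\<close>, so stability under the generators passes to all
  iterated brackets.\<close>

lemma ad_root_vec_gl_span:
  assumes x: "\<And>k z. k \<in> {1..<n} \<Longrightarrow> z \<in> gl_span \<Longrightarrow> lie (x k) z \<in> gl_span"
    and "1 \<le> i" "i + m < n" "z \<in> gl_span"
  shows "lie (root_vec x i m) z \<in> gl_span"
  using assms(2-)
proof (induction m arbitrary: i z)
  case (Suc m)
  have "lie (lie (x i) (root_vec x (Suc i) m)) z =
      lie (x i) (lie (root_vec x (Suc i) m) z) - lie (root_vec x (Suc i) m) (lie (x i) z)"
    using lie_jacobi[of "x i" "root_vec x (Suc i) m" z] by simp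
  moreover have "lie (x i) (lie (root_vec x (Suc i) m) z) \<in> gl_span"
    using Suc.prems by (intro x Suc.IH) auto
  moreover have "lie (root_vec x (Suc i) m) (lie (x i) z) \<in> gl_span"
    using Suc.prems by (intro x Suc.IH) auto
  ultimately show ?case by (simp add: gl_span_closed)
qed (use x in simp)

lemma ad_mat_elt_gl_span:
  assumes "(i, j) \<in> roots n" "z \<in> gl_span"
  shows "lie (G (i, j)) z \<in> gl_span"
proof (cases "i < j")
  case True
  then show ?thesis
    using ad_root_vec_gl_span[where x = e and i = i and m = "j - i - 1" and z = z, OF ad_e_gl_span] assms
    by (auto simp: G_upper roots_def)
next
  case False
  with assms have "j < i" by (auto simp: roots_def)
  then show ?thesis
    using ad_root_vec_gl_span[where x = "\<lambda>k. - f k" and i = j and m = "i - j - 1" and z = z, OF ad_f_gl_span] assms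
    by (auto simp: G_lower roots_def gl_span_closed)
qed

end

definition word_wt :: "(nat \<times> nat) list \<Rightarrow> weight" where
  "word_wt ps = sum_list (map (\<lambda>(i, j). eps i - eps j) ps)"

lemma word_wt_simps [simp]:
  "word_wt [] = 0" "word_wt (p # ps) = eps (fst p) - eps (snd p) + word_wt ps"
  by (simp_all add: word_wt_def case_prod_beta)

lemma word_wt_single_column:
  assumes "\<And>p. p \<in> set ps \<Longrightarrow> snd p = j \<and> fst p \<noteq> j"
  shows "word_wt ps j = - int (length ps)"
  using assms
proof (induction ps)
  case (Cons p ps)
  then have "word_wt ps j = - int (length ps)" "snd p = j" "fst p \<noteq> j" by auto
  then show ?case by (auto simp: eps_def)
qed simp

context schur_presentation
begin

text \<open>The weights along the brackets telescope. Taking \<open>\<gamma>\<close> as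
  \<open>eps\<close> or as \<open>\<lambda>k. - eps k\<close> covers both triangular halves.\<close>

lemma root_vec_P:
  assumes x: "\<And>k \<mu>. k \<in> {1..<n} \<Longrightarrow> x k * P \<mu> = P (\<mu> + (\<gamma> k - \<gamma> (Suc k))) * x k"
    and "1 \<le> i" "i + m < n"
  shows "root_vec x i m * P \<mu> = P (\<mu> + (\<gamma> i - \<gamma> (i + m + 1))) * root_vec x i m"
  using assms(2-)
proof (induction m arbitrary: i \<mu>)
  case 0
  then have "i \<in> {1..<n}" by simp
  from x[OF this, of \<mu>] show ?case by (simp only: root_vec.simps add_0_right Suc_eq_plus1)
next
  case (Suc m)
  let ?V = "root_vec x (Suc i) m"
  define a b where "a = \<gamma> i - \<gamma> (Suc i)" and "b = \<gamma> (Suc i) - \<gamma> (i + Suc m + 1)"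
  have ab: "\<nu> + b + a = \<nu> + (\<gamma> i - \<gamma> (i + Suc m + 1))" "\<nu> + a + b = \<nu> + (\<gamma> i - \<gamma> (i + Suc m + 1))" for \<nu>
    by (simp_all add: a_def b_def)
  have V: "?V * P \<nu> = P (\<nu> + b) * ?V" for \<nu>
    using Suc.IH[of "Suc i"] Suc.prems by (simp add: plus_fun_def fun_diff_def b_def)
  have X: "x i * P \<nu> = P (\<nu> + a) * x i" for \<nu>
    unfolding a_def using x[of i] Suc.prems by simp
  have "x i * ?V * P \<mu> = P (\<mu> + (\<gamma> i - \<gamma> (i + Suc m + 1))) * (x i * ?V)"
    by (metis V X ab(1) mult.assoc)
  moreover have "?V * x i * P \<mu> = P (\<mu> + (\<gamma> i - \<gamma> (i + Suc m + 1))) * (?V * x i)"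
    by (metis V X ab(2) mult.assoc)
  ultimately show ?case
    by (simp only: root_vec.simps lie_def left_diff_distrib right_diff_distrib)
qed

lemma mat_elt_P:
  assumes "(i, j) \<in> roots n"
  shows "mat_elt e f (i, j) * P \<mu> = P (eps i - eps j + \<mu>) * mat_elt e f (i, j)"
proof (cases "i < j")
  case True
  have e: "e k * P \<nu> = P (\<nu> + (eps k - eps (Suc k))) * e k" if "k \<in> {1..<n}" for k \<nu>
    using e_P[OF that, of \<nu>] by (simp only: sroot_def Suc_eq_plus1)
  have ij: "1 \<le> i" "i + (j - i - 1) < n" "i + (j - i - 1) + 1 = j"
    using assms True by (auto simp: roots_def)
  have "root_vec e i (j - i - 1) * P \<mu> = P (eps i - eps j + \<mu>) * root_vec e i (j - i - 1)"
    using root_vec_P[where x = e and \<gamma> = eps, OF e ij(1,2), of \<mu>]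
    by (simp only: ij(3) add.commute[of \<mu>])
  then show ?thesis using True by (simp only: mat_elt_def prod.case if_True)
next
  case False
  then have "j < i" using assms by (auto simp: roots_def)
  have f: "- f k * P \<nu> = P (\<nu> + (- eps k - - eps (Suc k))) * - f k" if "k \<in> {1..<n}" for k \<nu>
  proof -
    have "\<nu> - sroot k = \<nu> + (- eps k - - eps (Suc k))" by (simp add: sroot_def)
    then show ?thesis using f_P[OF that, of \<nu>] by (simp only: mult_minus_left mult_minus_right)
  qed
  have ij: "1 \<le> j" "j + (i - j - 1) < n" "j + (i - j - 1) + 1 = i"
    using assms \<open>j < i\<close> by (auto simp: roots_def)
  have "\<mu> + (- eps j - - eps i) = eps i - eps j + \<mu>" by simp
  then have "root_vec (\<lambda>k. - f k) j (i - j - 1) * P \<mu> =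
      P (eps i - eps j + \<mu>) * root_vec (\<lambda>k. - f k) j (i - j - 1)"
    using root_vec_P[where x = "\<lambda>k. - f k" and \<gamma> = "\<lambda>k. - eps k", OF f ij(1,2), of \<mu>]
    by (simp only: ij(3))
  then show ?thesis using False by (simp only: mat_elt_def prod.case if_False mult_minus_left mult_minus_right)
qed

section \<open>Straightening words of root vectors\<close>

abbreviation "M \<equiv> mat_word e f"

lemma mat_word_P:
  assumes "set ps \<subseteq> roots n"
  shows "M ps * P \<mu> = P (word_wt ps + \<mu>) * M ps"
  using assms
proof (induction ps)
  case (Cons p ps)
  obtain i j where p: "p = (i, j)" by (cases p)
  have "M ps * P \<mu> = P (word_wt ps + \<mu>) * M ps"
    using Cons by (auto simp: plus_fun_def)
  then have "M (p # ps) * P \<mu> = mat_elt e f p * P (word_wt ps + \<mu>) * M ps"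
    by (simp only: mat_word_simps mult.assoc)
  also have "mat_elt e f p * P (word_wt ps + \<mu>) = P (eps i - eps j + (word_wt ps + \<mu>)) * mat_elt e f p"
    using mat_elt_P[of i j] Cons.prems p by auto
  finally show ?case by (simp only: mat_word_simps word_wt_simps mult.assoc add.assoc p fst_conv snd_conv)
qed simp

text \<open>Moved to the left of the word, \<open>P \<mu>\<close> becomes
  \<open>P (word_wt ps + \<mu>)\<close>. Each letter lowers entry \<open>j\<close> of the weight by
  one, and its row differs from \<open>j\<close>, so nothing is restored and the entry ends up
  negative.\<close>

lemma mat_word_single_column_zero:
  assumes "set ps \<subseteq> roots n" "\<And>p. p \<in> set ps \<Longrightarrow> snd p = j" "\<mu> j < int (length ps)"
  shows "M ps * P \<mu> = 0"
proof -
  have "word_wt ps j = - int (length ps)"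
    using assms by (intro word_wt_single_column) (auto simp: roots_def)
  then have "(word_wt ps + \<mu>) j < 0" using assms(3) by simp
  then have "word_wt ps + \<mu> \<notin> Lam n d" unfolding Lam_def by (metis (mono_tags, lifting) linorder_not_le mem_Collect_eq)
  then show ?thesis using assms(1) by (simp add: mat_word_P P_outside)
qed

text \<open>The root vectors commute up to shorter words.\<close>

definition short_words :: "nat \<Rightarrow> weight \<Rightarrow> 'a set" where
  "short_words m \<mu> = V.span ((\<lambda>ps. M ps * P \<mu>) ` {ps. set ps \<subseteq> roots n \<and> length ps < m})"

lemma short_words_base: "set ps \<subseteq> roots n \<Longrightarrow> length ps < m \<Longrightarrow> M ps * P \<mu> \<in> short_words m \<mu>"
  unfolding short_words_def by (rule V.span_base) auto

lemma short_words_mono: "m \<le> m' \<Longrightarrow> z \<in> short_words m \<mu> \<Longrightarrow> z \<in> short_words m' \<mu>"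
  unfolding short_words_def by (erule rev_subsetD, rule V.span_mono) auto

lemma short_words_add: "a \<in> short_words m \<mu> \<Longrightarrow> b \<in> short_words m \<mu> \<Longrightarrow> a + b \<in> short_words m \<mu>"
  unfolding short_words_def by (rule V.span_add)

lemma mat_elt_short_words:
  assumes "p \<in> roots n" "z \<in> short_words m \<mu>"
  shows "mat_elt e f p * z \<in> short_words (Suc m) \<mu>"
  using assms(2) unfolding short_words_def
proof (rule span_image_subset[where \<phi> = "\<lambda>z. mat_elt e f p * z"])
  fix s assume "s \<in> (\<lambda>ps. M ps * P \<mu>) ` {ps. set ps \<subseteq> roots n \<and> length ps < m}"
  then obtain ps where ps: "s = M ps * P \<mu>" "set ps \<subseteq> roots n" "length ps < m" by auto
  then show "mat_elt e f p * s \<in> V.span ((\<lambda>ps. M ps * P \<mu>) ` {ps. set ps \<subseteq> roots n \<and> length ps < Suc m})"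
    using short_words_base[of "p # ps" "Suc m" \<mu>] assms(1) by (simp add: short_words_def mult.assoc)
qed (simp_all add: distrib_left scalar_left_commute)

text \<open>A word times \<open>P \<mu>\<close> is a weight vector, so \<open>H i\<close> acts on it
  by a scalar and adds no letter. Brackets that land on the diagonal therefore shorten words
  too.\<close>

lemma H_short_words:
  assumes "z \<in> short_words m \<mu>"
  shows "H i * z \<in> short_words m \<mu>"
  using assms unfolding short_words_def
proof (rule span_image_subset[where \<phi> = "\<lambda>z. H i * z"])
  fix s assume "s \<in> (\<lambda>ps. M ps * P \<mu>) ` {ps. set ps \<subseteq> roots n \<and> length ps < m}"
  then obtain ps where ps: "s = M ps * P \<mu>" "set ps \<subseteq> roots n" "length ps < m" by auto
  have "H i * s = \<kappa> (of_int ((word_wt ps + \<mu>) i)) * s"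
    unfolding ps mat_word_P[OF ps(2)] mult.assoc[symmetric] H_P ..
  then show "H i * s \<in> V.span ((\<lambda>ps. M ps * P \<mu>) ` {ps. set ps \<subseteq> roots n \<and> length ps < m})"
    using short_words_base[OF ps(2,3), of \<mu>] by (simp add: short_words_def V.span_scale ps(1))
qed (simp_all add: distrib_left scalar_left_commute)

lemma gl_span_short_words:
  assumes a: "a \<in> gl_span" and z: "z \<in> short_words m \<mu>"
  shows "a * z \<in> short_words (Suc m) \<mu>"
  using a unfolding gl_span_def short_words_def
proof (rule span_image_subset[where \<phi> = "\<lambda>a. a * z"])
  fix s assume "s \<in> G ` ({1..n} \<times> {1..n})"
  then obtain i j where s: "s = G (i, j)" "i \<in> {1..n}" "j \<in> {1..n}" by auto
  have "s * z \<in> short_words (Suc m) \<mu>"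
  proof (cases "i = j")
    case True
    then show ?thesis
      using H_short_words[OF z, of i] s by (simp add: G_diag short_words_mono[of m "Suc m"])
  next
    case False
    then show ?thesis
      using mat_elt_short_words[of "(i, j)", OF _ z] s by (simp add: roots_def G_def)
  qed
  then show "s * z \<in> V.span ((\<lambda>ps. M ps * P \<mu>) ` {ps. set ps \<subseteq> roots n \<and> length ps < Suc m})"
    by (simp add: short_words_def)
qed (simp_all add: distrib_right mult.assoc)

text \<open>Exchanging two neighbours costs their bracket, where one element of
  \<open>gl_span\<close> stands in place of two letters. The bound is the length of the whole word,
  so all errors are strictly shorter.\<close>

lemma mat_word_move_front:
  assumes "set (p # qs @ rs) \<subseteq> roots n"
  shows "M (p # qs @ rs) * P \<mu> - M (qs @ p # rs) * P \<mu> \<in> short_words (Suc (length qs + length rs)) \<mu>"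
  using assms
proof (induction qs)
  case Nil
  then show ?case by (simp add: short_words_def V.span_zero)
next
  case (Cons q qs)
  have "lie (G p) (G q) \<in> gl_span"
    using Cons.prems ad_mat_elt_gl_span[of "fst p" "snd p" "G q"] G_gl_span[of "fst q" "snd q"]
    by (auto simp: roots_def)
  moreover have "G p = mat_elt e f p" "G q = mat_elt e f q"
    using Cons.prems by (auto simp: G_def roots_def)
  ultimately have "lie (mat_elt e f p) (mat_elt e f q) * (M (qs @ rs) * P \<mu>) \<in>
      short_words (Suc (Suc (length qs + length rs))) \<mu>"
    using Cons.prems by (intro gl_span_short_words short_words_base) auto
  moreover have "mat_elt e f q * (M (p # qs @ rs) * P \<mu> - M (qs @ p # rs) * P \<mu>) \<in>
      short_words (Suc (Suc (length qs + length rs))) \<mu>"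
    using Cons by (intro mat_elt_short_words Cons.IH) auto
  ultimately have "lie (mat_elt e f p) (mat_elt e f q) * (M (qs @ rs) * P \<mu>) +
      mat_elt e f q * (M (p # qs @ rs) * P \<mu> - M (qs @ p # rs) * P \<mu>) \<in>
      short_words (Suc (Suc (length qs + length rs))) \<mu>"
    by (rule short_words_add)
  then show ?case
    by (simp add: lie_def left_diff_distrib right_diff_distrib mult.assoc)
qed

lemma mat_word_permute:
  assumes "mset ps = mset qs" "set ps \<subseteq> roots n"
  shows "M ps * P \<mu> - M qs * P \<mu> \<in> short_words (length ps) \<mu>"
  using assms
proof (induction ps arbitrary: qs)
  case Nil
  then show ?case by (simp add: short_words_def V.span_zero)
next
  case (Cons p ps)
  have "p \<in> set qs" using mset_eq_setD[OF Cons.prems(1)] by auto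
  then obtain q1 q2 where qs: "qs = q1 @ p # q2" by (blast dest: split_list)
  have eq: "mset ps = mset (q1 @ q2)" using Cons.prems(1) qs by simp
  have len: "length ps = length q1 + length q2" using mset_eq_length[OF eq] by simp
  have sub: "set (p # q1 @ q2) \<subseteq> roots n"
    using Cons.prems(2) mset_eq_setD[OF eq] by auto
  have "mat_elt e f p * (M ps * P \<mu> - M (q1 @ q2) * P \<mu>) \<in> short_words (Suc (length ps)) \<mu>"
    using Cons.prems by (intro mat_elt_short_words Cons.IH eq) auto
  moreover have "M (p # q1 @ q2) * P \<mu> - M (q1 @ p # q2) * P \<mu> \<in> short_words (Suc (length ps)) \<mu>"
    using mat_word_move_front[OF sub] len by simp
  ultimately have "mat_elt e f p * (M ps * P \<mu> - M (q1 @ q2) * P \<mu>) +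
      (M (p # q1 @ q2) * P \<mu> - M (q1 @ p # q2) * P \<mu>) \<in> short_words (Suc (length ps)) \<mu>"
    by (rule short_words_add)
  then show ?case
    by (simp add: qs right_diff_distrib mult.assoc)
qed

definition pbw :: "(nat \<times> nat) multiset \<times> weight \<Rightarrow> 'a" where
  "pbw \<theta> = M (mset_list (fst \<theta>)) * P (snd \<theta>)"

definition pbw_span :: "'a set" where "pbw_span = V.span (pbw ` pbw_index n d)"

lemma mat_word_reduce:
  assumes "set ps \<subseteq> roots n" "\<mu> \<in> Lam n d" "(mset ps, \<mu>) \<notin> pbw_index n d"
  shows "M ps * P \<mu> \<in> short_words (length ps) \<mu>"
proof -
  obtain j where j: "\<mu> j < int (count (image_mset snd (mset ps)) j)"
    using assms by (auto simp: pbw_index_def not_le)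
  let ?A = "filter (\<lambda>p. snd p \<noteq> j) ps" and ?B = "filter (\<lambda>p. snd p = j) ps"
  have "count (image_mset snd (mset ps)) j = length ?B"
    by (induction ps) auto
  then have "M ?B * P \<mu> = 0"
    using assms j by (intro mat_word_single_column_zero[of _ j]) auto
  moreover have "mset ps = mset (?A @ ?B)"
    by (induction ps) auto
  ultimately show ?thesis
    using mat_word_permute[of ps "?A @ ?B" \<mu>] assms(1) by (simp add: mult.assoc)
qed

text \<open>Induction on the length bound. A word of maximal length either has its index in
  \<open>pbw_index\<close>, and then differs from the chosen order by shorter words, or is itself a
  combination of shorter words.\<close>

lemma short_words_pbw_span: "\<mu> \<in> Lam n d \<Longrightarrow> short_words m \<mu> \<subseteq> pbw_span"
proof (induction m)
  case 0
  then show ?case by (simp add: short_words_def pbw_span_def V.span_zero)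
next
  case (Suc m)
  have "M ps * P \<mu> \<in> pbw_span" if ps: "set ps \<subseteq> roots n" "length ps < Suc m" for ps
  proof (cases "length ps < m")
    case True
    then show ?thesis using short_words_base[OF ps(1)] Suc by blast
  next
    case False
    with ps have len: "length ps = m" by simp
    show ?thesis
    proof (cases "(mset ps, \<mu>) \<in> pbw_index n d")
      case True
      then have "pbw (mset ps, \<mu>) \<in> pbw_span" unfolding pbw_span_def by (intro V.span_base) auto
      moreover have "M ps * P \<mu> - pbw (mset ps, \<mu>) \<in> pbw_span"
        using mat_word_permute[of ps "mset_list (mset ps)" \<mu>] ps(1) Suc len by (auto simp: pbw_def)
      ultimately show ?thesis
        unfolding pbw_span_def by (auto dest: V.span_add)
    next
      case False
      then show ?thesis using mat_word_reduce[OF ps(1)] Suc len by blast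
    qed
  qed
  then show ?case
    unfolding short_words_def pbw_span_def by (intro V.span_minimal) (auto simp: V.subspace_span)
qed

lemma mat_word_pbw_span: "set ps \<subseteq> roots n \<Longrightarrow> M ps * P \<mu> \<in> pbw_span"
  using short_words_pbw_span[of \<mu> "Suc (length ps)"] short_words_base[of ps "Suc (length ps)" \<mu>]
  by (cases "\<mu> \<in> Lam n d") (auto simp: P_outside pbw_span_def V.span_zero)

lemma pbw_span_mult:
  assumes "z \<in> pbw_span" "\<And>ps \<mu>. set ps \<subseteq> roots n \<Longrightarrow> a * (M ps * P \<mu>) \<in> pbw_span"
  shows "a * z \<in> pbw_span"
  using assms(1) unfolding pbw_span_def
proof (rule span_image_subset[where \<phi> = "\<lambda>z. a * z"])
  fix s assume "s \<in> pbw ` pbw_index n d"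
  then obtain D \<mu> where s: "s = pbw (D, \<mu>)" "(D, \<mu>) \<in> pbw_index n d" by auto
  then have "set (mset_list D) \<subseteq> roots n" by (simp add: pbw_index_def flip: set_mset_mset)
  then show "a * s \<in> V.span (pbw ` pbw_index n d)"
    using assms(2) s(1) by (simp add: pbw_def pbw_span_def)
qed (simp_all add: distrib_left scalar_left_commute)

text \<open>A generator is a root vector, so left multiplication by it prepends a letter to a
  word.\<close>

lemma e_pbw_span: "i \<in> {1..<n} \<Longrightarrow> z \<in> pbw_span \<Longrightarrow> e i * z \<in> pbw_span"
  using mat_word_pbw_span[of "(i, Suc i) # _"]
  by (elim pbw_span_mult) (auto simp: mat_elt_def roots_def mult.assoc)

lemma f_pbw_span: "i \<in> {1..<n} \<Longrightarrow> z \<in> pbw_span \<Longrightarrow> f i * z \<in> pbw_span"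
  using mat_word_pbw_span[of "(Suc i, i) # _"]
  by (elim pbw_span_mult) (auto simp: mat_elt_def roots_def mult.assoc)

lemma P_pbw_span: "z \<in> pbw_span \<Longrightarrow> P \<nu> * z \<in> pbw_span"
proof (erule pbw_span_mult)
  fix ps \<mu> assume ps: "set ps \<subseteq> roots n"
  then have "P \<nu> * (M ps * P \<mu>) = (if \<nu> = word_wt ps + \<mu> then M ps * P \<mu> else 0)"
    by (simp add: mat_word_P P_mult flip: mult.assoc)
  then show "P \<nu> * (M ps * P \<mu>) \<in> pbw_span"
    using mat_word_pbw_span[OF ps, of \<mu>] by (simp add: pbw_span_def V.span_zero)
qed

text \<open>The start of the spanning argument: \<open>pbw_span\<close> contains the unit and is
  stable under left multiplication by all generators.\<close>

lemma unit_pbw_span: "(\<Sum>\<mu>\<in>Lam n d. P \<mu>) \<in> pbw_span"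
  unfolding pbw_span_def using mat_word_pbw_span[of "[]"] by (intro V.span_sum) (simp add: pbw_span_def)

end

section \<open>Matrix units acting on tensor space\<close>

text \<open>Linear operators on all functions of type \<open>tensor\<close> do not depend on
  \<open>n\<close> and \<open>d\<close>. They form a type and a ring in the type-class sense, so
  \<open>root_vec\<close> and \<open>mat_word\<close> apply to them; restriction to
  \<open>tensor_space\<close> comes afterwards.\<close>

typedef linop = "{F :: tensor \<Rightarrow> tensor. (\<forall>s t. F (s + t) = F s + F t) \<and>
    (\<forall>c t. F (\<lambda>w. c * t w) = (\<lambda>w. c * F t w))}"
  morphisms app_op Abs_linop
  by (rule exI[of _ "\<lambda>t. t"]) simp

setup_lifting type_definition_linop

lemma app_op_add: "app_op A (s + t) = app_op A s + app_op A t"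
  and app_op_scale: "app_op A (\<lambda>w. c * t w) = (\<lambda>w. c * app_op A t w)"
  using app_op[of A] by auto

lemma app_op_0: "app_op A 0 = 0"
  using app_op_add[of A 0 0] by simp

instantiation linop :: ring_1
begin

lift_definition zero_linop :: linop is "\<lambda>_. 0" by (simp add: fun_eq_iff)
lift_definition one_linop :: linop is "\<lambda>t. t" by simp
lift_definition plus_linop :: "linop \<Rightarrow> linop \<Rightarrow> linop" is "\<lambda>F G t. F t + G t"
  by (simp add: fun_eq_iff algebra_simps)
lift_definition uminus_linop :: "linop \<Rightarrow> linop" is "\<lambda>F t. - F t"
  by (simp add: fun_eq_iff algebra_simps)
lift_definition minus_linop :: "linop \<Rightarrow> linop \<Rightarrow> linop" is "\<lambda>F G t. F t - G t"
  by (simp add: fun_eq_iff algebra_simps)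
lift_definition times_linop :: "linop \<Rightarrow> linop \<Rightarrow> linop" is "\<lambda>F G t. F (G t)"
  by simp

instance
proof
  show "(0 :: linop) \<noteq> 1"
  proof transfer
    show "(\<lambda>_. 0) \<noteq> (\<lambda>t :: tensor. t)"
    proof
      assume "(\<lambda>_. 0) = (\<lambda>t :: tensor. t)"
      from fun_cong[OF this, of "\<lambda>_. 1"] have "(0 :: tensor) w = 1" for w by metis
      then show False by simp
    qed
  qed
qed (transfer; simp add: fun_eq_iff algebra_simps; fail)+

end

lemma app_op_simps [simp]:
  "app_op 0 t = 0" "app_op 1 t = t" "app_op (A + B) t = app_op A t + app_op B t"
  "app_op (- A) t = - app_op A t" "app_op (A - B) t = app_op A t - app_op B t"
  "app_op (A * B) t = app_op A (app_op B t)"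
  by (transfer; simp)+

lemma linop_eqI: "(\<And>t. app_op A t = app_op B t) \<Longrightarrow> A = B"
  using app_op_inject by blast

definition diag_op :: "((nat \<Rightarrow> nat) \<Rightarrow> rat) \<Rightarrow> linop" where
  "diag_op c = Abs_linop (\<lambda>t w. c w * t w)"

lemma app_diag_op [simp]: "app_op (diag_op c) t = (\<lambda>w. c w * t w)"
  unfolding diag_op_def by (subst Abs_linop_inverse) (auto simp: fun_eq_iff algebra_simps)

definition scalar_op :: "rat \<Rightarrow> linop" where "scalar_op c = diag_op (\<lambda>_. c)"

lemma app_scalar_op [simp]: "app_op (scalar_op c) t = (\<lambda>w. c * t w)"
  by (simp add: scalar_op_def)

text \<open>In coordinates the matrix unit replaces \<open>i\<close> by \<open>j\<close> in the
  index of the result, the transpose of its effect on basis tensors. The value outside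
  \<open>multi_indices\<close> is that of \<open>gl_act\<close>.\<close>

definition mat_op :: "nat \<Rightarrow> nat \<Rightarrow> nat \<Rightarrow> nat \<Rightarrow> linop" where
  "mat_op n d i j = Abs_linop (\<lambda>t w. if w \<in> multi_indices n d
     then \<Sum>k=1..d. if w k = i then t (w(k := j)) else 0 else 0)"

lemma app_mat_op: "app_op (mat_op n d i j) t w =
    (if w \<in> multi_indices n d then \<Sum>k=1..d. if w k = i then t (w(k := j)) else 0 else 0)"
  unfolding mat_op_def
  by (subst Abs_linop_inverse)
    (auto simp: fun_eq_iff sum.distrib[symmetric] sum_distrib_left intro!: sum.cong)

lemma multi_indices_upd:
  "w \<in> multi_indices n d \<Longrightarrow> k \<in> {1..d} \<Longrightarrow> j \<in> {1..n} \<Longrightarrow> w(k := j) \<in> multi_indices n d"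
  by (auto simp: multi_indices_def PiE_iff extensional_def)

lemma finite_multi_indices: "finite (multi_indices n d)"
  unfolding multi_indices_def by (intro finite_PiE) auto

text \<open>The two factors act at the same place, which gives the matrix product, or at different
  places. The second part is symmetric in the two factors and cancels in the commutator.\<close>

lemma app_mat_op_mat_op:
  assumes "j \<in> {1..n}" "l \<in> {1..n}" and w: "w \<in> multi_indices n d"
  shows "app_op (mat_op n d i j) (app_op (mat_op n d k l) t) w =
    (if j = k then app_op (mat_op n d i l) t w else 0) +
    (\<Sum>a=1..d. \<Sum>b=1..d. if a \<noteq> b \<and> w a = i \<and> w b = k then t (w(a := j, b := l)) else 0)"
proof -
  have "(if w a = i then app_op (mat_op n d k l) t (w(a := j)) else 0) =
      (if j = k then if w a = i then t (w(a := l)) else 0 else 0) +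
      (\<Sum>b=1..d. if a \<noteq> b \<and> w a = i \<and> w b = k then t (w(a := j, b := l)) else 0)"
    if a: "a \<in> {1..d}" for a
  proof (cases "w a = i")
    case True
    have "app_op (mat_op n d k l) t (w(a := j)) =
        (\<Sum>b=1..d. if (w(a := j)) b = k then t (w(a := j, b := l)) else 0)"
      using multi_indices_upd[OF w a assms(1)] by (simp add: app_mat_op)
    also have "\<dots> = (\<Sum>b=1..d. (if a = b then if j = k then t (w(a := l)) else 0 else 0) +
        (if a \<noteq> b \<and> w a = i \<and> w b = k then t (w(a := j, b := l)) else 0))"
      using True by (intro sum.cong) auto
    finally show ?thesis using a True by (simp add: sum.distrib)
  qed simp
  note step = this
  have "app_op (mat_op n d i j) (app_op (mat_op n d k l) t) w =
      (\<Sum>a=1..d. if w a = i then app_op (mat_op n d k l) t (w(a := j)) else 0)"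
    using w by (simp only: app_mat_op[of n d i j] if_True)
  also have "\<dots> = (\<Sum>a=1..d. (if j = k then if w a = i then t (w(a := l)) else 0 else 0) +
        (\<Sum>b=1..d. if a \<noteq> b \<and> w a = i \<and> w b = k then t (w(a := j, b := l)) else 0))"
    by (rule sum.cong[OF refl step])
  finally show ?thesis using w by (simp add: sum.distrib app_mat_op)
qed

lemma lie_mat_op:
  assumes "i \<in> {1..n}" "j \<in> {1..n}" "k \<in> {1..n}" "l \<in> {1..n}"
  shows "lie (mat_op n d i j) (mat_op n d k l) =
    (if j = k then mat_op n d i l else 0) - (if l = i then mat_op n d k j else 0)"
proof (rule linop_eqI, rule ext)
  fix t :: tensor and w :: "nat \<Rightarrow> nat"
  have "(\<Sum>a=1..d. \<Sum>b=1..d. if a \<noteq> b \<and> w a = i \<and> w b = k then t (w(a := j, b := l)) else 0) =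
      (\<Sum>b=1..d. \<Sum>a=1..d. if a \<noteq> b \<and> w a = i \<and> w b = k then t (w(a := j, b := l)) else 0)"
    by (rule sum.swap)
  also have "\<dots> = (\<Sum>b=1..d. \<Sum>a=1..d. if b \<noteq> a \<and> w b = k \<and> w a = i then t (w(b := l, a := j)) else 0)"
    by (intro sum.cong) (auto simp: fun_upd_twist)
  finally have "(\<Sum>a=1..d. \<Sum>b=1..d. if a \<noteq> b \<and> w a = i \<and> w b = k then t (w(a := j, b := l)) else 0) = \<dots>" .
  note sym = this
  show "app_op (lie (mat_op n d i j) (mat_op n d k l)) t w =
      app_op ((if j = k then mat_op n d i l else 0) - (if l = i then mat_op n d k j else 0)) t w"
  proof (cases "w \<in> multi_indices n d")
    case True
    show ?thesis
      unfolding lie_def app_op_simps fun_diff_def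
        app_mat_op_mat_op[OF assms(2,4) True, of i k t] app_mat_op_mat_op[OF assms(4,2) True, of k i t] sym
      by (cases "j = k"; cases "l = i"; simp)
  qed (auto simp: lie_def app_mat_op)
qed

definition op_e :: "nat \<Rightarrow> nat \<Rightarrow> nat \<Rightarrow> linop" where "op_e n d i = mat_op n d i (Suc i)"
definition op_f :: "nat \<Rightarrow> nat \<Rightarrow> nat \<Rightarrow> linop" where "op_f n d i = mat_op n d (Suc i) i"

lemma root_vec_op:
  assumes "1 \<le> i" "i + m < n"
  shows "root_vec (op_e n d) i m = mat_op n d i (i + m + 1)"
    and "root_vec (\<lambda>k. - op_f n d k) i m = - mat_op n d (i + m + 1) i"
  using assms
proof (induction m arbitrary: i)
  case 0
  { case 1 then show ?case by (simp add: op_e_def) next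
    case 2 then show ?case by (simp add: op_f_def) }
next
  case (Suc m)
  { case 1 then show ?case using Suc.IH(1)[of "Suc i"] by (simp add: op_e_def lie_mat_op) next
    case 2 then show ?case using Suc.IH(2)[of "Suc i"] by (simp add: op_f_def lie_mat_op) }
qed

lemma mat_elt_op:
  assumes "(i, j) \<in> roots n"
  shows "mat_elt (op_e n d) (op_f n d) (i, j) = mat_op n d i j"
  using assms root_vec_op(1)[of i "j - i - 1" n d] root_vec_op(2)[of j "i - j - 1" n d]
  by (auto simp: mat_elt_def roots_def)

section \<open>Matrix entries of words at basis tensors\<close>

definition delta :: "(nat \<Rightarrow> nat) \<Rightarrow> tensor" where
  "delta w = (\<lambda>v. if v = w then 1 else 0)"

definition off_diag :: "nat \<Rightarrow> (nat \<Rightarrow> nat) \<Rightarrow> (nat \<Rightarrow> nat) \<Rightarrow> (nat \<times> nat) multiset" where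
  "off_diag d v w = image_mset (\<lambda>k. (v k, w k)) (mset_set {k \<in> {1..d}. v k \<noteq> w k})"

definition index_wt :: "nat \<Rightarrow> (nat \<Rightarrow> nat) \<Rightarrow> weight" where
  "index_wt d w = (\<lambda>i. int (card {k \<in> {1..d}. w k = i}))"

text \<open>The projection onto the weight space of \<open>\<mu>\<close> in
  \<open>tensor_space\<close>. That the product of binomial coefficients in the
  \<open>H\<^sub>i\<close> restricts to it is shown in \<open>schur_idem_op\<close>.\<close>

definition op_idem :: "nat \<Rightarrow> nat \<Rightarrow> weight \<Rightarrow> linop" where
  "op_idem n d \<mu> = diag_op (\<lambda>w. if w \<in> multi_indices n d \<and> index_wt d w = \<mu> then 1 else 0)"

lemma app_op_idem_delta:
  assumes "w \<in> multi_indices n d"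
  shows "app_op (op_idem n d \<mu>) (delta w) = (if index_wt d w = \<mu> then delta w else 0)"
  using assms by (intro ext) (auto simp: op_idem_def delta_def)

lemma off_diag_upd_other:
  assumes "k \<in> {1..d}" "v k \<noteq> w k" "j \<noteq> w k"
  shows "size (off_diag d (v(k := j)) w) = size (off_diag d v w)"
proof -
  have "{k' \<in> {1..d}. (v(k := j)) k' \<noteq> w k'} = {k' \<in> {1..d}. v k' \<noteq> w k'}"
    using assms by auto
  then show ?thesis by (simp add: off_diag_def)
qed

lemma off_diag_upd_same:
  assumes "k \<in> {1..d}" "v k \<noteq> w k"
  shows "off_diag d v w = add_mset (v k, w k) (off_diag d (v(k := w k)) w)"
proof -
  define A where "A = {k' \<in> {1..d}. (v(k := w k)) k' \<noteq> w k'}"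
  have A: "finite A" "k \<notin> A" "{k' \<in> {1..d}. v k' \<noteq> w k'} = insert k A"
    using assms by (auto simp: A_def)
  have "off_diag d (v(k := w k)) w = image_mset (\<lambda>k'. (v k', w k')) (mset_set A)"
    unfolding off_diag_def A_def[symmetric] using A by (intro image_mset_cong) auto
  then show ?thesis
    unfolding off_diag_def[of d v w] A(3) using A by simp
qed

lemma off_diag_size_upd: "size (off_diag d v w) \<le> Suc (size (off_diag d (v(k := j)) w))"
proof -
  have "card {k' \<in> {1..d}. v k' \<noteq> w k'} \<le> card (insert k {k' \<in> {1..d}. (v(k := j)) k' \<noteq> w k'})"
    by (rule card_mono) auto
  also have "\<dots> \<le> Suc (card {k' \<in> {1..d}. (v(k := j)) k' \<noteq> w k'})"
    by (simp add: card_insert_if)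
  finally show ?thesis by (simp add: off_diag_def)
qed

abbreviation op_word :: "nat \<Rightarrow> nat \<Rightarrow> (nat \<times> nat) list \<Rightarrow> linop" where
  "op_word n d \<equiv> mat_word (op_e n d) (op_f n d)"

lemma op_word_Cons:
  assumes "(i, j) \<in> roots n" "v \<in> multi_indices n d"
  shows "app_op (op_word n d ((i, j) # ps)) t v =
    (\<Sum>k=1..d. if v k = i then app_op (op_word n d ps) t (v(k := j)) else 0)"
  using assms by (simp add: mat_elt_op app_mat_op)

text \<open>Rules out cancellation, so that a single positive contribution makes a matrix entry
  positive.\<close>

lemma op_word_delta_nonneg:
  assumes "set ps \<subseteq> roots n" "v \<in> multi_indices n d"
  shows "app_op (op_word n d ps) (delta w) v \<ge> 0"
  using assms
proof (induction ps arbitrary: v)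
  case (Cons p ps)
  obtain i j where p: "p = (i, j)" by (cases p)
  have "app_op (op_word n d ps) (delta w) (v(k := j)) \<ge> 0" if "k \<in> {1..d}" for k
  proof (rule Cons.IH)
    show "v(k := j) \<in> multi_indices n d"
      using Cons.prems p that by (intro multi_indices_upd) (auto simp: roots_def)
  qed (use Cons.prems in simp)
  then have "(\<Sum>k=1..d. if v k = i then app_op (op_word n d ps) (delta w) (v(k := j)) else 0) \<ge> 0"
    by (intro sum_nonneg) simp
  then show ?case
    using Cons.prems by (simp only: p op_word_Cons[of i j n v d ps] list.set insert_subset simp_thms)
qed (simp add: delta_def)

lemma off_diag_empty_iff: "off_diag d v w = {#} \<longleftrightarrow> (\<forall>k\<in>{1..d}. v k = w k)"
  by (auto simp: off_diag_def mset_set_empty_iff)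

lemma multi_indices_eqI:
  "v \<in> multi_indices n d \<Longrightarrow> w \<in> multi_indices n d \<Longrightarrow> (\<forall>k\<in>{1..d}. v k = w k) \<Longrightarrow> v = w"
  unfolding multi_indices_def by (blast intro: PiE_ext)

text \<open>Each root vector changes one tensor place, so a word reaching \<open>v\<close> from \<open>w\<close> is at least as long as
  the number of places where they differ, and is determined up to order if the lengths agree.\<close>

lemma op_word_delta_nonzero:
  assumes "set ps \<subseteq> roots n" "v \<in> multi_indices n d" "app_op (op_word n d ps) (delta w) v \<noteq> 0"
  shows "size (off_diag d v w) \<le> length ps \<and>
    (size (off_diag d v w) = length ps \<longrightarrow> off_diag d v w = mset ps)"
  using assms
proof (induction ps arbitrary: v)
  case Nil
  then show ?case by (auto simp: delta_def off_diag_def split: if_splits)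
next
  case (Cons p ps)
  obtain i j where p: "p = (i, j)" by (cases p)
  then have "(\<Sum>k=1..d. if v k = i then app_op (op_word n d ps) (delta w) (v(k := j)) else 0) \<noteq> 0"
    using Cons.prems by (simp only: op_word_Cons[of i j n v d ps] list.set insert_subset simp_thms)
  then obtain k where "k \<in> {1..d}"
      and "(if v k = i then app_op (op_word n d ps) (delta w) (v(k := j)) else 0) \<noteq> 0"
    by (rule sum.not_neutral_contains_not_neutral)
  then have k: "k \<in> {1..d}" "v k = i" "app_op (op_word n d ps) (delta w) (v(k := j)) \<noteq> 0"
    by presburger+
  have "v(k := j) \<in> multi_indices n d"
    using Cons.prems p k(1) by (intro multi_indices_upd) (auto simp: roots_def)
  then have "size (off_diag d (v(k := j)) w) \<le> length ps \<and>
      (size (off_diag d (v(k := j)) w) = length ps \<longrightarrow> off_diag d (v(k := j)) w = mset ps)"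
    using Cons.prems(1) k(3) by (intro Cons.IH) (simp_all add: fun_upd_def)
  then have IH: "size (off_diag d (v(k := j)) w) \<le> length ps"
      "size (off_diag d (v(k := j)) w) = length ps \<longrightarrow> off_diag d (v(k := j)) w = mset ps"
    by blast+
  have le: "size (off_diag d v w) \<le> Suc (length ps)"
    using off_diag_size_upd[of d v w k j] IH(1) by linarith
  moreover have "off_diag d v w = mset (p # ps)" if eq: "size (off_diag d v w) = Suc (length ps)"
  proof -
    have size: "size (off_diag d (v(k := j)) w) = length ps"
      using off_diag_size_upd[of d v w k j] IH(1) eq by linarith
    have ij: "i \<noteq> j" using Cons.prems(1) p by (auto simp: roots_def)
    \<comment> \<open>If \<open>v\<close> and \<open>w\<close> agreed at \<open>k\<close>, the
      replacement would create a disagreement there instead of repairing one, and the sizes would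
      not match.\<close>
    have ne: "v k \<noteq> w k"
    proof
      assume eqk: "v k = w k"
      then have "(v(k := j))(k := w k) = v" by auto
      then have "off_diag d (v(k := j)) w = add_mset (j, w k) (off_diag d v w)"
        using off_diag_upd_same[of k d "v(k := j)" w] k(1,2) ij eqk by auto
      then show False using size eq by simp
    qed
    \<comment> \<open>Any other value leaves the place in disagreement and the size
      unchanged.\<close>
    have "j = w k"
      using off_diag_upd_other[of k d v w j] k(1) ne size eq by auto
    then show ?thesis
      using off_diag_upd_same[of k d v w, OF k(1) ne] IH(2) size k(2) p by simp
  qed
  ultimately show ?case by simp
qed

text \<open>The first letter is \<open>(v k, w k)\<close> for some place \<open>k\<close>, since the
  multiset consists of such pairs. The replacement at \<open>k\<close> contributes positively by
  induction, all other places nonnegatively.\<close>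

lemma op_word_delta_pos:
  assumes "set ps \<subseteq> roots n" "v \<in> multi_indices n d" "w \<in> multi_indices n d" "mset ps = off_diag d v w"
  shows "app_op (op_word n d ps) (delta w) v > 0"
  using assms
proof (induction ps arbitrary: v)
  case Nil
  then have "\<forall>k\<in>{1..d}. v k = w k" by (simp only: mset.simps flip: off_diag_empty_iff)
  then have "v = w" by (rule multi_indices_eqI[OF Nil(2,3)])
  then show ?case by (simp add: delta_def)
next
  case (Cons p ps)
  obtain i j where p: "p = (i, j)" by (cases p)
  have upd: "v(k := j) \<in> multi_indices n d" if "k \<in> {1..d}" for k
    using Cons.prems p that by (intro multi_indices_upd) (auto simp: roots_def)
  have "(i, j) \<in># off_diag d v w" using Cons.prems(4) p by (simp flip: Cons.prems(4))
  then obtain k where k: "k \<in> {1..d}" "v k = i" "w k = j" "v k \<noteq> w k"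
    by (auto simp: off_diag_def)
  then have "mset ps = off_diag d (v(k := j)) w"
    using off_diag_upd_same[of k d v w] Cons.prems(4) p by simp
  then have "app_op (op_word n d ps) (delta w) (v(k := j)) > 0"
    using Cons.prems upd[OF k(1)] by (intro Cons.IH) (simp_all add: fun_upd_def)
  moreover have "app_op (op_word n d ps) (delta w) (v(k' := j)) \<ge> 0" if "k' \<in> {1..d}" for k'
    using Cons.prems(1) upd[OF that] by (intro op_word_delta_nonneg) auto
  ultimately have "(\<Sum>k=1..d. if v k = i then app_op (op_word n d ps) (delta w) (v(k := j)) else 0) > 0"
    using k by (intro sum_pos2[of _ k]) auto
  then show ?case
    using Cons.prems by (simp only: p op_word_Cons[of i j n v d ps] list.set insert_subset simp_thms)
qed

section \<open>Operators commuting with place permutations\<close>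

definition equivariant :: "nat \<Rightarrow> nat \<Rightarrow> linop \<Rightarrow> bool" where
  "equivariant n d A \<longleftrightarrow> (\<forall>t \<in> tensor_space n d. app_op A t \<in> tensor_space n d \<and>
     (\<forall>\<sigma>. \<sigma> permutes {1..d} \<longrightarrow> app_op A (place_perm \<sigma> t) = place_perm \<sigma> (app_op A t)))"

lemma place_perm_simps:
  "place_perm \<sigma> 0 = 0" "place_perm \<sigma> (s + t) = place_perm \<sigma> s + place_perm \<sigma> t"
  "place_perm \<sigma> (- t) = - place_perm \<sigma> t" "place_perm \<sigma> (s - t) = place_perm \<sigma> s - place_perm \<sigma> t"
  by (simp_all add: place_perm_def fun_eq_iff)

lemma tensor_space_closed:
  "0 \<in> tensor_space n d" "s \<in> tensor_space n d \<Longrightarrow> t \<in> tensor_space n d \<Longrightarrow> s + t \<in> tensor_space n d"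
  "s \<in> tensor_space n d \<Longrightarrow> t \<in> tensor_space n d \<Longrightarrow> s - t \<in> tensor_space n d"
  "t \<in> tensor_space n d \<Longrightarrow> - t \<in> tensor_space n d"
  by (simp_all add: tensor_space_def)

lemma place_perm_tensor_space:
  "\<sigma> permutes {1..d} \<Longrightarrow> t \<in> tensor_space n d \<Longrightarrow> place_perm \<sigma> t \<in> tensor_space n d"
  by (auto simp: tensor_space_def place_perm_def multi_indices_comp_iff)

lemma equivariant_0: "equivariant n d 0" and equivariant_1: "equivariant n d 1"
  and equivariant_add: "equivariant n d A \<Longrightarrow> equivariant n d B \<Longrightarrow> equivariant n d (A + B)"
  and equivariant_diff: "equivariant n d A \<Longrightarrow> equivariant n d B \<Longrightarrow> equivariant n d (A - B)"
  and equivariant_mult: "equivariant n d A \<Longrightarrow> equivariant n d B \<Longrightarrow> equivariant n d (A * B)"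
  by (simp_all add: equivariant_def tensor_space_closed place_perm_simps)

lemma equivariant_diag_op:
  assumes "\<And>\<sigma> w. \<sigma> permutes {1..d} \<Longrightarrow> w \<in> multi_indices n d \<Longrightarrow> c (w \<circ> \<sigma>) = c w"
  shows "equivariant n d (diag_op c)"
proof -
  have "c w * t (w \<circ> \<sigma>) = c (w \<circ> \<sigma>) * t (w \<circ> \<sigma>)"
    if "\<sigma> permutes {1..d}" "t \<in> tensor_space n d" for \<sigma> t w
    using that assms multi_indices_comp_iff[of \<sigma> d w n]
    by (cases "w \<in> multi_indices n d") (auto simp: tensor_space_def)
  then show ?thesis
    by (auto simp: equivariant_def place_perm_def fun_eq_iff) (simp add: tensor_space_def)
qed

lemma equivariant_scalar_op: "equivariant n d (scalar_op c)"
  unfolding scalar_op_def by (rule equivariant_diag_op) simp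

lemma equivariant_mat_op: "equivariant n d (mat_op n d i j)"
proof -
  have "app_op (mat_op n d i j) (place_perm \<sigma> t) w = place_perm \<sigma> (app_op (mat_op n d i j) t) w"
    if \<sigma>: "\<sigma> permutes {1..d}" for \<sigma> t w
  proof -
    have upd: "w(\<sigma> k := j) \<circ> \<sigma> = (w \<circ> \<sigma>)(k := j)" for k
      using permutes_inj[OF \<sigma>] by (auto simp: fun_eq_iff inj_eq)
    have "(\<Sum>k=1..d. if w k = i then t (w(k := j) \<circ> \<sigma>) else 0) =
        (\<Sum>k=1..d. if w (\<sigma> k) = i then t (w(\<sigma> k := j) \<circ> \<sigma>) else 0)"
      by (rule sum.permute[OF \<sigma>, unfolded o_def[of _ \<sigma>]])
    also have "\<dots> = (\<Sum>k=1..d. if (w \<circ> \<sigma>) k = i then t ((w \<circ> \<sigma>)(k := j)) else 0)"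
      by (simp only: upd o_apply)
    finally show ?thesis
      by (simp only: place_perm_def app_mat_op multi_indices_comp_iff[OF \<sigma>])
  qed
  then show ?thesis by (auto simp: equivariant_def fun_eq_iff) (simp add: tensor_space_def app_mat_op)
qed

text \<open>Passes from operators to the extensional maps of \<open>schur_alg\<close>; operators
  that differ only off \<open>tensor_space\<close> become equal.\<close>

definition op_res :: "nat \<Rightarrow> nat \<Rightarrow> linop \<Rightarrow> tensor \<Rightarrow> tensor" where
  "op_res n d A = (\<lambda>t \<in> tensor_space n d. app_op A t)"

lemma op_res_carrier: "equivariant n d A \<Longrightarrow> op_res n d A \<in> carrier (schur_alg n d)"
  by (auto simp: schur_alg_def op_res_def equivariant_def tensor_space_closed place_perm_tensor_space
      app_op_add app_op_scale) (simp_all add: tensor_space_def)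

lemma op_res_mult:
  "equivariant n d B \<Longrightarrow> op_res n d (A * B) = op_res n d A \<otimes>\<^bsub>schur_alg n d\<^esub> op_res n d B"
  by (auto simp: schur_alg_def op_res_def equivariant_def compose_def)

lemma op_res_add: "op_res n d (A + B) = op_res n d A \<oplus>\<^bsub>schur_alg n d\<^esub> op_res n d B"
  and op_res_1: "op_res n d 1 = \<one>\<^bsub>schur_alg n d\<^esub>"
  and op_res_0: "op_res n d 0 = \<zero>\<^bsub>schur_alg n d\<^esub>"
  and op_res_scale: "op_res n d (scalar_op c * A) = c \<odot>\<^bsub>schur_alg n d\<^esub> op_res n d A"
  by (auto simp: schur_alg_def op_res_def)

lemma op_res_diff:
  assumes "equivariant n d A" "equivariant n d B"
  shows "op_res n d (A - B) = op_res n d A \<ominus>\<^bsub>schur_alg n d\<^esub> op_res n d B"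
proof -
  interpret S: ring "schur_alg n d" by (rule ring_schur_alg)
  have "op_res n d A = op_res n d (A - B) \<oplus>\<^bsub>schur_alg n d\<^esub> op_res n d B"
    by (simp flip: op_res_add)
  then show ?thesis
    using op_res_carrier[OF assms(2)] op_res_carrier[OF equivariant_diff[OF assms]]
    by (simp add: a_minus_def S.a_assoc S.r_neg)
qed

lemma op_res_eqI:
  assumes "\<And>t w. t \<in> tensor_space n d \<Longrightarrow> app_op A t w = app_op B t w"
  shows "op_res n d A = op_res n d B"
  unfolding op_res_def using assms by (intro restrict_ext ext)

lemma op_res_diag_cong:
  "(\<And>w. w \<in> multi_indices n d \<Longrightarrow> c w = c' w) \<Longrightarrow> op_res n d (diag_op c) = op_res n d (diag_op c')"
  by (rule op_res_eqI) (auto simp: tensor_space_def)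

lemma gl_act_mat_unit:
  assumes "j \<in> {1..n}"
  shows "gl_act n d (mat_unit i j) = op_res n d (mat_op n d i j)"
proof -
  have "(\<Sum>j'=1..n. mat_unit i j (w k) j' * t (w(k := j'))) = (if w k = i then t (w(k := j)) else 0)"
    for t :: tensor and w k
  proof -
    have "(\<Sum>j'=1..n. mat_unit i j (w k) j' * t (w(k := j'))) =
        (\<Sum>j'=1..n. if j' = j then if w k = i then t (w(k := j)) else 0 else 0)"
      by (intro sum.cong) (auto simp: mat_unit_def)
    then show ?thesis using assms by simp
  qed
  then show ?thesis
    by (intro ext) (simp add: gl_act_def op_res_def app_mat_op restrict_def)
qed

lemma schur_e_op: "i \<in> {1..<n} \<Longrightarrow> schur_e n d i = op_res n d (op_e n d i)"
  and schur_f_op: "i \<in> {1..<n} \<Longrightarrow> schur_f n d i = op_res n d (op_f n d i)"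
  by (simp_all add: schur_e_def schur_f_def op_e_def op_f_def gl_act_mat_unit)

lemma schur_H_op:
  assumes "i \<in> {1..n}"
  shows "schur_H n d i = op_res n d (diag_op (\<lambda>w. of_int (index_wt d w i)))"
proof -
  have "app_op (mat_op n d i i) t w = of_int (index_wt d w i) * t w" if "t \<in> tensor_space n d" for t w
  proof -
    have "(\<Sum>k=1..d. if w k = i then t (w(k := i)) else 0) = (\<Sum>k\<in>{k \<in> {1..d}. w k = i}. t w)"
      unfolding sum.inter_filter[OF finite_atLeastAtMost] by (intro sum.cong) auto
    then show ?thesis using that by (auto simp: app_mat_op index_wt_def tensor_space_def)
  qed
  then show ?thesis
    using assms by (simp add: schur_H_def gl_act_mat_unit op_res_eqI)
qed

lemma index_wt_comp:
  assumes \<sigma>: "\<sigma> permutes {1..d}"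
  shows "index_wt d (w \<circ> \<sigma>) = index_wt d w"
proof
  fix i
  have "bij_betw \<sigma> {k \<in> {1..d}. w (\<sigma> k) = i} {k \<in> {1..d}. w k = i}"
  proof (rule bij_betw_byWitness[where f' = "inv_into UNIV \<sigma>"])
    show "\<sigma> ` {k \<in> {1..d}. w (\<sigma> k) = i} \<subseteq> {k \<in> {1..d}. w k = i}"
      using permutes_in_image[OF \<sigma>] by auto
    show "inv_into UNIV \<sigma> ` {k \<in> {1..d}. w k = i} \<subseteq> {k \<in> {1..d}. w (\<sigma> k) = i}"
      using permutes_in_image[OF permutes_inv[OF \<sigma>]] permutes_inverses[OF \<sigma>] by auto
  qed (simp_all add: permutes_inverses[OF \<sigma>])
  then show "index_wt d (w \<circ> \<sigma>) i = index_wt d w i"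
    by (simp add: index_wt_def bij_betw_same_card)
qed

lemma index_wt_Lam:
  assumes w: "w \<in> multi_indices n d"
  shows "index_wt d w \<in> Lam n d"
proof -
  have range: "w k \<in> {1..n}" if "k \<in> {1..d}" for k
    using w that by (auto simp: multi_indices_def)
  have "(\<Sum>i=1..n. card {k \<in> {1..d}. w k = i}) = card (\<Union>i\<in>{1..n}. {k \<in> {1..d}. w k = i})"
    by (rule card_UN_disjoint[symmetric]) auto
  also have "(\<Union>i\<in>{1..n}. {k \<in> {1..d}. w k = i}) = {1..d}"
    using range by auto
  finally have "(\<Sum>i=1..n. index_wt d w i) = int d"
    by (simp add: index_wt_def flip: of_nat_sum)
  moreover have "index_wt d w i = 0" if "i \<notin> {1..n}" for i
    using range that by (auto simp: index_wt_def)
  ultimately show ?thesis by (simp add: Lam_def index_wt_def)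
qed

lemma Lam_eqI:
  assumes "\<mu> \<in> Lam n d" "\<nu> \<in> Lam n d" "\<And>i. i \<in> {1..n} \<Longrightarrow> \<mu> i \<le> \<nu> i"
  shows "\<mu> = \<nu>"
proof
  fix i
  have "(\<Sum>i=1..n. \<mu> i) = (\<Sum>i=1..n. \<nu> i)" using assms(1,2) by (simp add: Lam_def)
  then have "\<mu> i = \<nu> i" if "i \<in> {1..n}"
    using sum_mono_inv[of \<mu> "{1..n}" \<nu>] assms(3) that by auto
  moreover have "\<mu> i = \<nu> i" if "i \<notin> {1..n}" using assms(1,2) that by (simp add: Lam_def)
  ultimately show "\<mu> i = \<nu> i" by blast
qed

lemma diag_op_mult: "diag_op a * diag_op b = diag_op (\<lambda>w. a w * b w)"
  and diag_op_diff: "diag_op a - diag_op b = diag_op (\<lambda>w. a w - b w)"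
  and diag_op_one: "diag_op (\<lambda>_. 1) = 1"
  by (rule linop_eqI; simp add: fun_eq_iff algebra_simps)+

lemma alg_falling_diag:
  assumes "\<And>\<sigma> w. \<sigma> permutes {1..d} \<Longrightarrow> c (w \<circ> \<sigma>) = c w"
  shows "alg_falling (schur_alg n d) (op_res n d (diag_op c)) m =
    op_res n d (diag_op (\<lambda>w. \<Prod>r=0..<m. c w - of_nat r))"
proof (induction m)
  case 0
  show ?case by (simp add: diag_op_one op_res_1)
next
  case (Suc m)
  have "of_nat m \<odot>\<^bsub>schur_alg n d\<^esub> \<one>\<^bsub>schur_alg n d\<^esub> = op_res n d (diag_op (\<lambda>_. of_nat m))"
    using op_res_scale[of n d "of_nat m" 1] by (simp add: op_res_1 scalar_op_def)
  then have "op_res n d (diag_op c) \<ominus>\<^bsub>schur_alg n d\<^esub> (of_nat m \<odot>\<^bsub>schur_alg n d\<^esub> \<one>\<^bsub>schur_alg n d\<^esub>) =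
      op_res n d (diag_op (\<lambda>w. c w - of_nat m))"
    using op_res_diff[of n d "diag_op c" "diag_op (\<lambda>_. of_nat m)"] equivariant_diag_op[of d n c, OF assms]
      equivariant_scalar_op[of n d "of_nat m"]
    by (simp add: diag_op_diff scalar_op_def)
  moreover have "equivariant n d (diag_op (\<lambda>w. c w - of_nat m))"
    by (rule equivariant_diag_op) (simp only: assms)
  ultimately show ?case
    by (simp add: Suc.IH diag_op_mult flip: op_res_mult)
qed

lemma alg_binomial_diag:
  assumes "\<And>\<sigma> w. \<sigma> permutes {1..d} \<Longrightarrow> c (w \<circ> \<sigma>) = c w"
  shows "alg_binomial (schur_alg n d) (op_res n d (diag_op c)) m = op_res n d (diag_op (\<lambda>w. c w gchoose m))"
proof -
  have "alg_falling (schur_alg n d) (op_res n d (diag_op c)) m =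
      op_res n d (diag_op (\<lambda>w. \<Prod>r=0..<m. c w - of_nat r))"
    by (rule alg_falling_diag) (rule assms)
  then show ?thesis
    by (simp add: alg_binomial_def scalar_op_def diag_op_mult gbinomial_prod_rev flip: op_res_scale)
qed

lemma foldr_binomial_diag:
  assumes "set is \<subseteq> {1..n}" "distinct is"
  shows "foldr (\<lambda>i x. alg_binomial (schur_alg n d) (schur_H n d i) (nat (\<mu> i)) \<otimes>\<^bsub>schur_alg n d\<^esub> x)
      is \<one>\<^bsub>schur_alg n d\<^esub> =
    op_res n d (diag_op (\<lambda>w. \<Prod>i\<in>set is. of_int (index_wt d w i) gchoose nat (\<mu> i)))"
  using assms
proof (induction "is")
  case Nil
  show ?case by (simp add: diag_op_one op_res_1)
next
  case (Cons i "is")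
  have "equivariant n d (diag_op (\<lambda>w. \<Prod>i\<in>set is. of_int (index_wt d w i) gchoose nat (\<mu> i)))"
    by (intro equivariant_diag_op) (simp add: index_wt_comp)
  moreover have "alg_binomial (schur_alg n d) (op_res n d (diag_op (\<lambda>w. of_int (index_wt d w i)))) m =
      op_res n d (diag_op (\<lambda>w. of_int (index_wt d w i) gchoose m))" for m
    by (rule alg_binomial_diag) (simp add: index_wt_comp)
  ultimately show ?case
    using Cons by (simp add: schur_H_op diag_op_mult flip: op_res_mult)
qed

text \<open>On a basis tensor of weight \<open>\<nu>\<close> the product acts by the product of the
  binomial coefficients of \<open>\<nu> i\<close> over \<open>\<mu> i\<close>. This is
  \<open>1\<close> for \<open>\<nu> = \<mu>\<close>. Otherwise, as both weights have total
  \<open>d\<close>, some \<open>\<nu> i\<close> is smaller than \<open>\<mu> i\<close>, and its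
  factor is zero.\<close>

lemma schur_idem_op:
  assumes \<mu>: "\<mu> \<in> Lam n d"
  shows "schur_idem n d \<mu> = op_res n d (op_idem n d \<mu>)"
proof -
  have "(\<Prod>i=1..n. of_int (index_wt d w i) gchoose nat (\<mu> i) :: rat) =
      (if w \<in> multi_indices n d \<and> index_wt d w = \<mu> then 1 else 0)" if w: "w \<in> multi_indices n d" for w
  proof -
    define a where "a i = nat (index_wt d w i)" for i
    have a: "of_int (index_wt d w i) gchoose nat (\<mu> i) = (of_nat (a i choose nat (\<mu> i)) :: rat)" for i
      by (simp add: binomial_gbinomial a_def index_wt_def)
    show ?thesis
    proof (cases "index_wt d w = \<mu>")
      case True
      then show ?thesis using w unfolding a by (simp add: a_def)
    next
      case False
      then obtain i where i: "i \<in> {1..n}" "index_wt d w i < \<mu> i"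
        using Lam_eqI[OF \<mu> index_wt_Lam[OF w]]
        by fastforce
      then have "a i choose nat (\<mu> i) = 0" by (simp add: a_def index_wt_def)
      then have "(\<Prod>i=1..n. of_nat (a i choose nat (\<mu> i)) :: rat) = 0"
        using i(1) by (intro prod_zero) auto
      then show ?thesis using False unfolding a by simp
    qed
  qed
  then have "op_res n d (diag_op (\<lambda>w. \<Prod>i=1..n. of_int (index_wt d w i) gchoose nat (\<mu> i))) =
      op_res n d (op_idem n d \<mu>)"
    unfolding op_idem_def by (rule op_res_diag_cong)
  moreover have "set [1..<n + 1] = {1..n}" by auto
  ultimately show ?thesis
    using foldr_binomial_diag[of "[1..<n + 1]" n d \<mu>] by (simp add: schur_idem_def del: upt_Suc)
qed

lemma equivariant_op_idem: "equivariant n d (op_idem n d \<mu>)"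
  unfolding op_idem_def
  by (rule equivariant_diag_op) (simp add: index_wt_comp multi_indices_comp_iff)

section \<open>Orbits of pairs of multi-indices\<close>

text \<open>The complete invariant of the orbit of \<open>(v, w)\<close>. Its part off the diagonal
  is \<open>off_diag\<close>; the weight of \<open>w\<close> gives the column totals and thereby the
  multiplicities of the pairs \<open>(j, j)\<close>.\<close>

definition place_pairs :: "nat \<Rightarrow> (nat \<Rightarrow> nat) \<Rightarrow> (nat \<Rightarrow> nat) \<Rightarrow> (nat \<times> nat) multiset" where
  "place_pairs d v w = image_mset (\<lambda>k. (v k, w k)) (mset_set {1..d})"

lemma off_diag_place_pairs: "off_diag d v w = filter_mset (\<lambda>p. fst p \<noteq> snd p) (place_pairs d v w)"
  by (simp add: off_diag_def place_pairs_def filter_mset_image_mset filter_mset_mset_set o_def)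

lemma count_image_mset_set:
  "finite A \<Longrightarrow> count (image_mset f (mset_set A)) y = card {x \<in> A. f x = y}"
proof (induction A rule: finite_induct)
  case (insert x A)
  have "{x' \<in> insert x A. f x' = y} = (if f x = y then insert x {x \<in> A. f x = y} else {x \<in> A. f x = y})"
    by auto
  then show ?case using insert by simp
qed simp

lemma index_wt_place_pairs: "index_wt d w j = int (count (image_mset snd (place_pairs d v w)) j)"
  by (simp add: index_wt_def place_pairs_def count_image_mset_set image_mset.compositionality o_def)

lemma count_image_snd:
  "count (image_mset snd m) j = count m (j, j) + count (image_mset snd (filter_mset (\<lambda>p. fst p \<noteq> snd p) m)) j"
  by (induction m) auto

lemma size_eq_sum_count:
  assumes "finite A" "set_mset m \<subseteq> A"
  shows "size m = (\<Sum>j\<in>A. count m j)"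
  unfolding size_multiset_overloaded_eq
  using assms by (intro sum.mono_neutral_left) (auto simp: not_in_iff)

lemma pbw_indexI:
  assumes "v \<in> multi_indices n d" "w \<in> multi_indices n d"
  shows "(off_diag d v w, index_wt d w) \<in> pbw_index n d"
proof -
  have "v k \<in> {1..n}" "w k \<in> {1..n}" if "k \<in> {1..d}" for k
    using assms that by (auto simp: multi_indices_def)
  then have "set_mset (off_diag d v w) \<subseteq> roots n"
    by (auto simp: off_diag_def roots_def)
  then show ?thesis
    using index_wt_Lam[OF assms(2)]
    by (simp add: pbw_index_def index_wt_place_pairs[of d w _ v] count_image_snd[of "place_pairs d v w"]
        off_diag_place_pairs)
qed

lemma place_pairs_list:
  assumes "length xs = d"
  shows "place_pairs d (\<lambda>k. fst (xs ! (k - 1))) (\<lambda>k. snd (xs ! (k - 1))) = mset xs"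
proof -
  have "map (\<lambda>k. xs ! (k - 1)) [1..<Suc d] = xs"
    using assms by (intro nth_equalityI) (auto simp del: upt_Suc)
  then have "mset xs = image_mset (\<lambda>k. xs ! (k - 1)) (mset [1..<Suc d])"
    by (metis mset_map)
  then show ?thesis
    by (simp add: place_pairs_def atLeastLessThanSuc_atLeastAtMost del: upt_Suc)
qed

text \<open>Fill up \<open>D\<close> with \<open>\<mu> j - c j\<close> copies of
  \<open>(j, j)\<close>, a number that the definition of \<open>pbw_index\<close> makes nonnegative.
  Then column \<open>j\<close> occurs \<open>\<mu> j\<close> times, there are \<open>d\<close> pairs
  in total, and any listing of them yields \<open>v\<close> and \<open>w\<close>.\<close>

lemma pbw_index_realized:
  assumes "(D, \<mu>) \<in> pbw_index n d"
  obtains v w where "v \<in> multi_indices n d" "w \<in> multi_indices n d" "off_diag d v w = D" "index_wt d w = \<mu>"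
proof -
  define c where "c j = count (image_mset snd D) j" for j
  define m where "m = D + (\<Sum>j\<in>{1..n}. replicate_mset (nat (\<mu> j) - c j) (j, j))"
  have D: "set_mset D \<subseteq> roots n" and \<mu>: "\<mu> \<in> Lam n d" and c: "int (c j) \<le> \<mu> j" for j
    using assms by (auto simp: pbw_index_def c_def)
  have offdiag: "filter_mset (\<lambda>p. fst p \<noteq> snd p) m = D"
  proof -
    have "filter_mset (\<lambda>p. fst p \<noteq> snd p) (\<Sum>j\<in>A. replicate_mset (nat (\<mu> j) - c j) (j, j)) = {#}"
      if "finite A" for A
      using that by (induction A) simp_all
    from this[of "{1..n}"]
    have "filter_mset (\<lambda>p. fst p \<noteq> snd p) (\<Sum>j\<in>{1..n}. replicate_mset (nat (\<mu> j) - c j) (j, j)) = {#}"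
      by blast
    moreover have "filter_mset (\<lambda>p. fst p \<noteq> snd p) D = D"
      using D by (induction D) (auto simp: roots_def)
    ultimately show ?thesis unfolding m_def filter_union_mset by (metis add_0_right)
  qed
  have cnt: "int (count (image_mset snd m) j) = \<mu> j" for j
  proof -
    have "count (image_mset snd (\<Sum>j\<in>A. replicate_mset (nat (\<mu> j) - c j) (j, j))) j =
        (if j \<in> A then nat (\<mu> j) - c j else 0)" if "finite A" for A
      using that by (induction A) simp_all
    then have "count (image_mset snd m) j = c j + (if j \<in> {1..n} then nat (\<mu> j) - c j else 0)"
      by (simp add: m_def c_def)
    moreover have "c j = 0" "\<mu> j = 0" if "j \<notin> {1..n}"
      using c[of j] \<mu> that by (auto simp: Lam_def)
    ultimately show ?thesis using c[of j] by (cases "j \<in> {1..n}") auto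
  qed
  have m: "set_mset m \<subseteq> {1..n} \<times> {1..n}"
  proof -
    have "set_mset (\<Sum>j\<in>A. replicate_mset (nat (\<mu> j) - c j) (j, j)) \<subseteq> A \<times> A" if "finite A" for A
      using that by (induction A) auto
    from this[of "{1..n}"] show ?thesis using D by (auto simp: m_def roots_def)
  qed
  have "snd ` set_mset m \<subseteq> {1..n}" using m by (auto simp only: mem_Sigma_iff snd_conv)
  then have "int (size m) = (\<Sum>j\<in>{1..n}. int (count (image_mset snd m) j))"
    using size_eq_sum_count[of "{1..n}" "image_mset snd m"] by (simp flip: of_nat_sum)
  also have "\<dots> = int d"
    using \<mu> by (simp add: cnt Lam_def)
  finally have size: "size m = d" by simp
  obtain xs where xs: "mset xs = m" using ex_mset by blast
  have len: "length xs = d" using size unfolding xs[symmetric] by simp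
  \<comment> \<open>Places are numbered from 1 and list entries from 0.\<close>
  define v w where "v = (\<lambda>k\<in>{1..d}. fst (xs ! (k - 1)))" and "w = (\<lambda>k\<in>{1..d}. snd (xs ! (k - 1)))"
  have "place_pairs d v w = place_pairs d (\<lambda>k. fst (xs ! (k - 1))) (\<lambda>k. snd (xs ! (k - 1)))"
    unfolding place_pairs_def by (intro image_mset_cong) (auto simp: v_def w_def)
  then have pairs: "place_pairs d v w = m"
    using place_pairs_list[OF len] xs by simp
  have "fst (xs ! (k - 1)) \<in> {1..n} \<and> snd (xs ! (k - 1)) \<in> {1..n}" if "k \<in> {1..d}" for k
  proof -
    have "xs ! (k - 1) \<in> set xs" using that len by (intro nth_mem) auto
    also have "set xs \<subseteq> {1..n} \<times> {1..n}" using m unfolding xs[symmetric] by simp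
    finally show ?thesis by (simp only: mem_Times_iff)
  qed
  then have "v \<in> multi_indices n d" "w \<in> multi_indices n d"
    by (simp_all add: multi_indices_def v_def w_def PiE_iff)
  moreover have "off_diag d v w = D" using pairs offdiag by (simp add: off_diag_place_pairs)
  moreover have "index_wt d w = \<mu>" using pairs cnt by (auto simp: index_wt_place_pairs[of d w _ v])
  ultimately show thesis by (rule that)
qed

text \<open>The pairs on the diagonal are determined by the weight once the others are known. So the
  two families of pairs agree as multisets, which means that they agree up to a permutation of the
  places.\<close>

lemma same_index_permutes:
  assumes "v \<in> multi_indices n d" "w \<in> multi_indices n d" "v' \<in> multi_indices n d" "w' \<in> multi_indices n d"
    and "off_diag d v w = off_diag d v' w'" "index_wt d w = index_wt d w'"
  obtains \<sigma> where "\<sigma> permutes {1..d}" "v = v' \<circ> \<sigma>" "w = w' \<circ> \<sigma>"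
proof -
  have "place_pairs d v w = place_pairs d v' w'"
  proof (rule multiset_eqI)
    fix p :: "nat \<times> nat"
    obtain i j where p: "p = (i, j)" by (cases p)
    show "count (place_pairs d v w) p = count (place_pairs d v' w') p"
    proof (cases "i = j")
      case True
      have "count (image_mset snd (place_pairs d v w)) j = count (image_mset snd (place_pairs d v' w')) j"
        using fun_cong[OF assms(6), of j] by (simp add: index_wt_place_pairs[of d w j v] index_wt_place_pairs[of d w' j v'])
      then show ?thesis
        using assms(5) by (simp add: count_image_snd[of "place_pairs d v w"] count_image_snd[of "place_pairs d v' w'"]
            off_diag_place_pairs p True)
    next
      case False
      then show ?thesis
        using arg_cong[OF assms(5), of "\<lambda>m. count m p"] by (simp add: off_diag_place_pairs p)
    qed
  qed
  then obtain \<sigma> where \<sigma>: "\<sigma> permutes {1..d}" "\<forall>k\<in>{1..d}. (v k, w k) = (v' (\<sigma> k), w' (\<sigma> k))"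
    unfolding place_pairs_def by (rule image_mset_eq_implies_permutes[OF finite_atLeastAtMost])
  have eqs: "\<forall>k\<in>{1..d}. v k = v' (\<sigma> k)" "\<forall>k\<in>{1..d}. w k = w' (\<sigma> k)"
    using \<sigma>(2) unfolding prod.inject by blast+
  have "u = u' \<circ> \<sigma>" if u: "u \<in> multi_indices n d" "u' \<in> multi_indices n d" "\<forall>k\<in>{1..d}. u k = u' (\<sigma> k)" for u u'
  proof (rule multi_indices_eqI[OF u(1)])
    show "u' \<circ> \<sigma> \<in> multi_indices n d" unfolding multi_indices_comp_iff[OF \<sigma>(1)] by (rule u(2))
    show "\<forall>k\<in>{1..d}. u k = (u' \<circ> \<sigma>) k" unfolding o_apply by (rule u(3))
  qed
  from that[OF \<sigma>(1) this[OF assms(1,3) eqs(1)] this[OF assms(2,4) eqs(2)]] show thesis .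
qed

section \<open>Triangular systems and the matrix entries of the spanning set\<close>

lemma triangular_solve:
  fixes A :: "'i \<Rightarrow> 'i \<Rightarrow> rat" and s :: "'i \<Rightarrow> nat"
  assumes "finite \<Theta>" and "\<And>i. i \<in> \<Theta> \<Longrightarrow> A i i \<noteq> 0"
    and "\<And>i j. i \<in> \<Theta> \<Longrightarrow> j \<in> \<Theta> \<Longrightarrow> A i j \<noteq> 0 \<Longrightarrow> i = j \<or> s i < s j"
  shows "\<exists>c. \<forall>i\<in>\<Theta>. (\<Sum>j\<in>\<Theta>. c j * A i j) = y i"
  using assms
proof (induction \<Theta> arbitrary: y rule: finite_ranking_induct[where f = s])
  case (insert x S)
  \<comment> \<open>Indices are added in order of increasing \<open>s\<close>, so row
    \<open>x\<close> has only its diagonal entry. This fixes the unknown of \<open>x\<close> as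
    \<open>y x / A x x\<close>, and the smaller system is solved for the right side corrected by
    column \<open>x\<close>.\<close>
  have zero: "A x j = 0" if "j \<in> S" "x \<notin> S" for j
    using insert.prems(2)[of x j] insert.hyps(2)[of j] that by force
  show ?case
  proof (cases "x \<in> S")
    case True
    then show ?thesis using insert by (simp add: insert_absorb)
  next
    case False
    obtain c where c: "\<forall>i\<in>S. (\<Sum>j\<in>S. c j * A i j) = y i - y x / A x x * A i x"
      using insert.IH[of "\<lambda>i. y i - y x / A x x * A i x"] insert.prems by auto
    have "(\<Sum>j\<in>S. (c(x := z)) j * A i j) = (\<Sum>j\<in>S. c j * A i j)" for i z
      using False by (intro sum.cong) auto
    then have "\<forall>i\<in>insert x S. (\<Sum>j\<in>insert x S. (c(x := y x / A x x)) j * A i j) = y i"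
      using False insert.hyps(1) insert.prems(1)[of x] c zero by auto
    then show ?thesis by blast
  qed
qed simp

text \<open>The same elimination: the equation of an index with largest \<open>s\<close> contains
  only its own unknown, which is therefore zero and drops out of the others.\<close>

lemma triangular_zero:
  fixes A :: "'i \<Rightarrow> 'i \<Rightarrow> rat" and s :: "'i \<Rightarrow> nat"
  assumes "finite \<Theta>" and "\<And>i. i \<in> \<Theta> \<Longrightarrow> A i i \<noteq> 0"
    and "\<And>i j. i \<in> \<Theta> \<Longrightarrow> j \<in> \<Theta> \<Longrightarrow> A i j \<noteq> 0 \<Longrightarrow> i = j \<or> s i < s j"
    and "\<And>i. i \<in> \<Theta> \<Longrightarrow> (\<Sum>j\<in>\<Theta>. c j * A i j) = 0"
  shows "i \<in> \<Theta> \<Longrightarrow> c i = 0"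
  using assms
proof (induction \<Theta> arbitrary: i rule: finite_ranking_induct[where f = s])
  case (insert x S)
  show ?case
  proof (cases "x \<in> S")
    case True
    then show ?thesis using insert by (simp add: insert_absorb)
  next
    case False
    have "A x j = 0" if "j \<in> S" for j
      using insert.prems(3)[of x j] insert.hyps(2)[of j] that False by force
    then have "c x = 0"
      using insert.prems(2)[of x] insert.prems(4)[of x] insert.hyps(1) False by simp
    then have "(\<Sum>j\<in>S. c j * A i j) = 0" if "i \<in> S" for i
      using insert.prems(4)[of i] insert.hyps(1) False that by simp
    then have "c i = 0" if "i \<in> S" for i
      using insert.IH[OF that] insert.prems by auto
    with \<open>c x = 0\<close> show ?thesis using insert.prems(1) by auto
  qed
qed simp

definition op_pbw :: "nat \<Rightarrow> nat \<Rightarrow> (nat \<times> nat) multiset \<times> weight \<Rightarrow> linop" where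
  "op_pbw n d \<theta> = op_word n d (mset_list (fst \<theta>)) * op_idem n d (snd \<theta>)"

lemma app_op_pbw_delta:
  assumes "w \<in> multi_indices n d"
  shows "app_op (op_pbw n d (D, \<mu>)) (delta w) v =
    (if index_wt d w = \<mu> then app_op (op_word n d (mset_list D)) (delta w) v else 0)"
  using assms by (simp add: op_pbw_def app_op_idem_delta app_op_0)

lemma op_pbw_triangular:
  assumes "v \<in> multi_indices n d" "w \<in> multi_indices n d" "(D, \<mu>) \<in> pbw_index n d"
    and "app_op (op_pbw n d (D, \<mu>)) (delta w) v \<noteq> 0"
  shows "(D, \<mu>) = (off_diag d v w, index_wt d w) \<or> size (off_diag d v w) < size D"
proof -
  have \<mu>: "index_wt d w = \<mu>" "app_op (op_word n d (mset_list D)) (delta w) v \<noteq> 0"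
    using assms(4) by (simp_all add: app_op_pbw_delta[OF assms(2)] split: if_splits)
  have "set (mset_list D) \<subseteq> roots n" using assms(3) by (simp add: pbw_index_def flip: set_mset_mset)
  from op_word_delta_nonzero[OF this assms(1) \<mu>(2)] \<mu>(1) show ?thesis
    by (auto simp flip: size_mset)
qed

lemma op_pbw_diagonal:
  assumes "v \<in> multi_indices n d" "w \<in> multi_indices n d"
  shows "app_op (op_pbw n d (off_diag d v w, index_wt d w)) (delta w) v \<noteq> 0"
proof -
  have "set (mset_list (off_diag d v w)) \<subseteq> roots n"
    using pbw_indexI[OF assms] by (simp add: pbw_index_def flip: set_mset_mset)
  from op_word_delta_pos[OF this assms] show ?thesis by (simp add: app_op_pbw_delta[OF assms(2)])
qed

lemma finite_pbw_index: "finite (pbw_index n d)"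
proof (rule finite_surj)
  show "finite (multi_indices n d \<times> multi_indices n d)"
    by (intro finite_cartesian_product finite_multi_indices)
  show "pbw_index n d \<subseteq> (\<lambda>(v, w). (off_diag d v w, index_wt d w)) ` (multi_indices n d \<times> multi_indices n d)"
  proof
    fix \<theta> assume "\<theta> \<in> pbw_index n d"
    then have "(fst \<theta>, snd \<theta>) \<in> pbw_index n d" by simp
    then obtain v w where "v \<in> multi_indices n d" "w \<in> multi_indices n d" "off_diag d v w = fst \<theta>" "index_wt d w = snd \<theta>"
      by (rule pbw_index_realized)
    then show "\<theta> \<in> (\<lambda>(v, w). (off_diag d v w, index_wt d w)) ` (multi_indices n d \<times> multi_indices n d)"
      by (intro image_eqI[of _ _ "(v, w)"]) auto
  qed
qed

section \<open>The homomorphism from the free algebra\<close>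

lemma free_alg_simps [simp]:
  "p \<otimes>\<^bsub>free_alg X\<^esub> q = p * q" "p \<oplus>\<^bsub>free_alg X\<^esub> q = p + q" "\<one>\<^bsub>free_alg X\<^esub> = 1" "\<zero>\<^bsub>free_alg X\<^esub> = 0"
  "c \<odot>\<^bsub>free_alg X\<^esub> p = nc_const c * p"
  by (simp_all add: free_alg_def)

lemma free_alg_single: "set (letters w) \<subseteq> X \<Longrightarrow> Poly_Mapping.single w c \<in> carrier (free_alg X)"
  by (auto simp: free_alg_def)

lemma free_alg_const: "nc_const c \<in> carrier (free_alg X)"
  by (simp add: nc_const_def free_alg_single zero_word_def)

lemma free_alg_gen: "g \<in> X \<Longrightarrow> nc_gen g \<in> carrier (free_alg X)"
  by (simp add: nc_gen_def free_alg_single)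

lemma free_alg_closed:
  "0 \<in> carrier (free_alg X)" "1 \<in> carrier (free_alg X)"
  "p \<in> carrier (free_alg X) \<Longrightarrow> q \<in> carrier (free_alg X) \<Longrightarrow> p + q \<in> carrier (free_alg X)"
  "p \<in> carrier (free_alg X) \<Longrightarrow> q \<in> carrier (free_alg X) \<Longrightarrow> p * q \<in> carrier (free_alg X)"
  "p \<in> carrier (free_alg X) \<Longrightarrow> - p \<in> carrier (free_alg X)"
proof -
  interpret F: ring "free_alg X" by (rule ring_free_alg)
  show "0 \<in> carrier (free_alg X)" using F.zero_closed by simp
  show "1 \<in> carrier (free_alg X)" using F.one_closed by simp
  show "p \<in> carrier (free_alg X) \<Longrightarrow> q \<in> carrier (free_alg X) \<Longrightarrow> p + q \<in> carrier (free_alg X)"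
    using F.a_closed[of p q] by simp
  show "p \<in> carrier (free_alg X) \<Longrightarrow> q \<in> carrier (free_alg X) \<Longrightarrow> p * q \<in> carrier (free_alg X)"
    using F.m_closed[of p q] by simp
  show "p \<in> carrier (free_alg X) \<Longrightarrow> - p \<in> carrier (free_alg X)"
    by (simp add: free_alg_def)
qed

lemma free_alg_diff:
  "p \<in> carrier (free_alg X) \<Longrightarrow> q \<in> carrier (free_alg X) \<Longrightarrow> p - q \<in> carrier (free_alg X)"
  using free_alg_closed(3)[of p X "- q"] free_alg_closed(5)[of q X] by simp

lemma free_alg_if:
  "(b \<Longrightarrow> p \<in> carrier (free_alg X)) \<Longrightarrow> (\<not> b \<Longrightarrow> q \<in> carrier (free_alg X)) \<Longrightarrow>
    (if b then p else q) \<in> carrier (free_alg X)"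
  by simp

lemma free_alg_sum:
  "(\<And>i. i \<in> I \<Longrightarrow> p i \<in> carrier (free_alg X)) \<Longrightarrow> sum p I \<in> carrier (free_alg X)"
  by (induction I rule: infinite_finite_induct) (auto intro: free_alg_closed)

lemma free_alg_induct [consumes 1, case_names zero add]:
  assumes p: "p \<in> carrier (free_alg X)" and zero: "Q 0"
    and add: "\<And>w c q. set (letters w) \<subseteq> X \<Longrightarrow> q \<in> carrier (free_alg X) \<Longrightarrow> Q q \<Longrightarrow>
      Q (Poly_Mapping.single w c + q)"
  shows "Q p"
proof -
  have "p = (\<Sum>w\<in>Poly_Mapping.keys p. Poly_Mapping.single w (Poly_Mapping.lookup p w))"
    by (rule poly_mapping_eqI)
      (auto simp: Poly_Mapping.lookup_sum lookup_single when_def in_keys_iff)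
  moreover have "Q (\<Sum>w\<in>A. Poly_Mapping.single w (Poly_Mapping.lookup p w))"
    if "finite A" "A \<subseteq> Poly_Mapping.keys p" for A
    using that
  proof (induction A)
    case (insert w A)
    have "set (letters w) \<subseteq> X" if "w \<in> Poly_Mapping.keys p" for w
      using p that by (simp add: free_alg_def)
    with insert show ?case
      by (auto intro!: add free_alg_sum free_alg_single)
  qed (simp add: zero)
  ultimately show ?thesis by (metis finite_keys order_refl)
qed

lemma ncpoly_induct [case_names zero add]:
  fixes p :: "'g ncpoly"
  assumes "Q 0" "\<And>w c q. Q q \<Longrightarrow> Q (Poly_Mapping.single w c + q)"
  shows "Q p"
proof -
  have "p \<in> carrier (free_alg UNIV)" by (simp add: free_alg_def)
  then show ?thesis by (induction rule: free_alg_induct) (use assms in auto)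
qed

section \<open>Evaluation of noncommutative polynomials\<close>

context rat_scalars
begin

text \<open>The homomorphism given by the universal property of the free algebra. It is used for
  operators on tensors and for the product of the presented algebras.\<close>

definition nc_subst :: "('g \<Rightarrow> 'a) \<Rightarrow> 'g ncpoly \<Rightarrow> 'a" where
  "nc_subst g p = (\<Sum>w\<in>Poly_Mapping.keys p. \<kappa> (Poly_Mapping.lookup p w) * prod_list (map g (letters w)))"

lemma nc_subst_superset:
  "finite A \<Longrightarrow> Poly_Mapping.keys p \<subseteq> A \<Longrightarrow>
    nc_subst g p = (\<Sum>w\<in>A. \<kappa> (Poly_Mapping.lookup p w) * prod_list (map g (letters w)))"
  unfolding nc_subst_def by (intro sum.mono_neutral_left) (auto simp: in_keys_iff)

lemma nc_subst_single: "nc_subst g (Poly_Mapping.single w c) = \<kappa> c * prod_list (map g (letters w))"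
  by (subst nc_subst_superset[of "{w}"]) auto

lemma nc_subst_0 [simp]: "nc_subst g 0 = 0"
  by (simp add: nc_subst_def)

lemma nc_subst_add: "nc_subst g (p + q) = nc_subst g p + nc_subst g q"
proof -
  let ?A = "Poly_Mapping.keys p \<union> Poly_Mapping.keys q"
  have "Poly_Mapping.keys (p + q) \<subseteq> ?A" by (rule Poly_Mapping.keys_add)
  then show ?thesis
    by (simp add: nc_subst_superset[of ?A] lookup_add scalar_add distrib_right sum.distrib)
qed

lemma nc_subst_minus: "nc_subst g (- p) = - nc_subst g p"
  using nc_subst_add[of g p "- p"] by (simp add: eq_neg_iff_add_eq_0 add.commute)

lemma nc_subst_diff: "nc_subst g (p - q) = nc_subst g p - nc_subst g q"
  using nc_subst_add[of g p "- q"] by (simp add: nc_subst_minus)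

lemma nc_subst_sum: "nc_subst g (sum p I) = (\<Sum>i\<in>I. nc_subst g (p i))"
  using sum_comp_morphism[of "nc_subst g" p I] by (simp add: nc_subst_add o_def)

lemma nc_subst_mult: "nc_subst g (p * q) = nc_subst g p * nc_subst g q"
proof (induction p rule: ncpoly_induct)
  case (add w c p)
  have "nc_subst g (Poly_Mapping.single w c * q) = nc_subst g (Poly_Mapping.single w c) * nc_subst g q"
  proof (induction q rule: ncpoly_induct)
    case (add v b q)
    let ?a = "prod_list (map g (letters w))" and ?b = "prod_list (map g (letters v))"
    have "?a * (\<kappa> b * ?b) = \<kappa> b * (?a * ?b)" by (rule scalar_left_commute)
    then have "nc_subst g (Poly_Mapping.single w c * Poly_Mapping.single v b) =
        nc_subst g (Poly_Mapping.single w c) * nc_subst g (Poly_Mapping.single v b)"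
      by (simp add: mult_single nc_subst_single plus_word_def scalar_mult mult.assoc del: V.scale_scale)
    then show ?case
      using add by (simp only: distrib_left nc_subst_add)
  qed simp
  then show ?case using add by (simp add: distrib_right nc_subst_add)
qed simp

lemma nc_subst_const [simp]: "nc_subst g (nc_const c) = \<kappa> c"
  by (simp add: nc_const_def nc_subst_single zero_word_def)

lemma nc_subst_gen [simp]: "nc_subst g (nc_gen x) = g x"
  by (simp add: nc_gen_def nc_subst_single scalar_1)

lemma nc_subst_1 [simp]: "nc_subst g 1 = 1"
  using nc_subst_const[of g 1] by (simp add: nc_const_def scalar_1)

lemma nc_subst_root_vec: "nc_subst g (root_vec x i m) = root_vec (\<lambda>k. nc_subst g (x k)) i m"
  by (induction m arbitrary: i) (simp_all add: lie_def nc_subst_diff nc_subst_mult)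

lemma nc_subst_mat_word:
  "nc_subst g (mat_word x y ps) = mat_word (\<lambda>k. nc_subst g (x k)) (\<lambda>k. nc_subst g (y k)) ps"
proof (induction ps)
  case (Cons p ps)
  have "nc_subst g (mat_elt x y p) = mat_elt (\<lambda>k. nc_subst g (x k)) (\<lambda>k. nc_subst g (y k)) p"
    by (simp add: mat_elt_def nc_subst_minus nc_subst_root_vec split: prod.split)
  then show ?case using Cons by (simp add: nc_subst_mult)
qed simp

text \<open>The cubic Serre polynomial is the double bracket written out, the form in which the
  relations enter \<open>gl_relations\<close>.\<close>

lemma nc_subst_serre:
  "nc_subst g (serre x i j) =
    (if j = Suc i \<or> i = Suc j then lie (nc_subst g (x i)) (lie (nc_subst g (x i)) (nc_subst g (x j)))
     else lie (nc_subst g (x i)) (nc_subst g (x j)))"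
proof -
  have "nc_subst g 2 = 2"
    using nc_subst_add[of g 1 1] by simp
  moreover have "\<bar>int i - int j\<bar> = 1 \<longleftrightarrow> j = Suc i \<or> i = Suc j" by auto
  ultimately show ?thesis
    by (auto simp: serre_def lie_def nc_subst_add nc_subst_diff nc_subst_mult power2_eq_square mult_2 algebra_simps)
qed

end

lemma root_vec_free_alg:
  "(\<And>k. k \<in> {i..i + m} \<Longrightarrow> x k \<in> carrier (free_alg X)) \<Longrightarrow> root_vec x i m \<in> carrier (free_alg X)"
  by (induction m arbitrary: i) (auto simp: lie_def intro!: free_alg_diff free_alg_closed)

lemma mat_word_free_alg:
  assumes "\<And>k. k \<in> {1..<n} \<Longrightarrow> x k \<in> carrier (free_alg X)" "\<And>k. k \<in> {1..<n} \<Longrightarrow> y k \<in> carrier (free_alg X)"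
    and "set ps \<subseteq> roots n"
  shows "mat_word x y ps \<in> carrier (free_alg X)"
  using assms(3)
proof (induction ps)
  case (Cons p ps)
  have "mat_elt x y p \<in> carrier (free_alg X)"
    using Cons.prems assms(1,2)
    by (auto simp: mat_elt_def roots_def split: prod.split
        intro!: root_vec_free_alg free_alg_closed(5)[of "root_vec _ _ _"] free_alg_closed(5)[of "y _"])
  then show ?case using Cons by (auto intro: free_alg_closed)
qed (simp add: free_alg_closed)

lemma serre_free_alg:
  "x i \<in> carrier (free_alg X) \<Longrightarrow> x j \<in> carrier (free_alg X) \<Longrightarrow> serre x i j \<in> carrier (free_alg X)"
proof -
  have "2 \<in> carrier (free_alg X)"
    using free_alg_closed(3)[of 1 X 1] free_alg_closed(2)[of X] by simp
  then show "x i \<in> carrier (free_alg X) \<Longrightarrow> x j \<in> carrier (free_alg X) \<Longrightarrow> serre x i j \<in> carrier (free_alg X)"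
    by (auto simp: serre_def power2_eq_square intro!: free_alg_diff free_alg_closed(3,4))
qed

lemma I1_free_alg: "\<mu> \<in> Lam n d \<Longrightarrow> I1 \<mu> \<in> carrier (free_alg (schur_gens n d))"
  and E1_free_alg: "i \<in> {1..<n} \<Longrightarrow> E1 i \<in> carrier (free_alg (schur_gens n d))"
  and F1_free_alg: "i \<in> {1..<n} \<Longrightarrow> F1 i \<in> carrier (free_alg (schur_gens n d))"
  by (auto simp: schur_gens_def intro: free_alg_gen)

lemma schur_rels_free_alg: "schur_rels n d \<subseteq> carrier (free_alg (schur_gens n d))"
  unfolding schur_rels_def rel_R1'_def rel_R2'_def rel_R3'_def rel_R4_def rel_R5_def
  by (safe intro!: free_alg_diff free_alg_if free_alg_closed(1-4) free_alg_sum free_alg_const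
      I1_free_alg E1_free_alg F1_free_alg serre_free_alg)

section \<open>The relations hold in the Schur algebra\<close>

interpretation op: rat_scalars scalar_op
  by unfold_locales (rule linop_eqI; simp add: fun_eq_iff algebra_simps app_op_scale)+

lemma app_op_sum_left: "app_op (sum A I) t w = (\<Sum>i\<in>I. app_op (A i) t w)"
  by (induction I rule: infinite_finite_induct) simp_all

lemma op_idem_mult: "op_idem n d \<mu> * op_idem n d \<nu> = (if \<mu> = \<nu> then op_idem n d \<mu> else 0)"
  by (rule linop_eqI) (auto simp: op_idem_def fun_eq_iff)

lemma op_idem_outside: "\<mu> \<notin> Lam n d \<Longrightarrow> op_idem n d \<mu> = 0"
  using index_wt_Lam[of _ n d] by (intro linop_eqI ext) (auto simp: op_idem_def)

text \<open>With \<open>c\<close> constantly \<open>1\<close> this is the projection onto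
  \<open>tensor_space\<close>; with \<open>c\<close> an entry of the weight it is a diagonal matrix
  unit.\<close>

lemma sum_Lam_op_idem:
  "app_op (\<Sum>\<mu>\<in>Lam n d. scalar_op (c \<mu>) * op_idem n d \<mu>) t w =
    (if w \<in> multi_indices n d then c (index_wt d w) * t w else 0)"
proof -
  have "app_op (\<Sum>\<mu>\<in>Lam n d. scalar_op (c \<mu>) * op_idem n d \<mu>) t w =
      (\<Sum>\<mu>\<in>Lam n d. if \<mu> = index_wt d w then if w \<in> multi_indices n d then c (index_wt d w) * t w else 0 else 0)"
    unfolding app_op_sum_left by (intro sum.cong) (auto simp: op_idem_def)
  then show ?thesis using index_wt_Lam[of w n d] by (auto simp: finite_Lam)
qed

lemma index_wt_upd:
  assumes "k \<in> {1..d}"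
  shows "index_wt d (w(k := j)) + eps (w k) = index_wt d w + eps j"
proof
  fix l :: nat
  have card: "int (card {k' \<in> {1..d}. u k' = l}) = (if u k = l then 1 else 0) + int (card {k' \<in> {1..d} - {k}. u k' = l})" for u
  proof -
    have "{k' \<in> {1..d}. u k' = l} = (if u k = l then insert k {k' \<in> {1..d} - {k}. u k' = l} else {k' \<in> {1..d} - {k}. u k' = l})"
      using assms by auto
    then show ?thesis by simp
  qed
  have "{k' \<in> {1..d} - {k}. (w(k := j)) k' = l} = {k' \<in> {1..d} - {k}. w k' = l}" by auto
  then show "(index_wt d (w(k := j)) + eps (w k)) l = (index_wt d w + eps j) l"
    using card[of w] card[of "w(k := j)"] by (auto simp: index_wt_def eps_def)
qed

text \<open>In an index \<open>w\<close> with \<open>w k = i\<close>, writing \<open>j\<close> at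
  \<open>k\<close> lowers the weight by \<open>eps i - eps j\<close>. The idempotent on the left has
  to make up for this.\<close>

lemma mat_op_idem:
  assumes "j \<in> {1..n}"
  shows "mat_op n d i j * op_idem n d \<mu> = op_idem n d (\<mu> + (eps i - eps j)) * mat_op n d i j"
proof (rule linop_eqI, rule ext)
  fix t :: tensor and w :: "nat \<Rightarrow> nat"
  show "app_op (mat_op n d i j * op_idem n d \<mu>) t w =
    app_op (op_idem n d (\<mu> + (eps i - eps j)) * mat_op n d i j) t w"
  proof (cases "w \<in> multi_indices n d")
    case True
    have "(if w k = i then app_op (op_idem n d \<mu>) t (w(k := j)) else 0) =
        (if index_wt d w = \<mu> + (eps i - eps j) then if w k = i then t (w(k := j)) else 0 else 0)"
      if k: "k \<in> {1..d}" for k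
    proof (cases "w k = i")
      case w: True
      have "index_wt d (w(k := j)) = \<mu> \<longleftrightarrow> index_wt d w = \<mu> + (eps i - eps j)"
      proof -
        have *: "index_wt d (w(k := j)) = index_wt d w + eps j - eps i"
          using index_wt_upd[OF k, of w j] unfolding w by (simp only: eq_diff_eq)
        show ?thesis unfolding * by (simp only: diff_eq_eq add_diff_eq eq_diff_eq)
      qed
      then show ?thesis using multi_indices_upd[OF True k assms] w by (simp add: op_idem_def)
    qed simp
    then have "(\<Sum>k=1..d. if w k = i then app_op (op_idem n d \<mu>) t (w(k := j)) else 0) =
        (\<Sum>k=1..d. if index_wt d w = \<mu> + (eps i - eps j) then if w k = i then t (w(k := j)) else 0 else 0)"
      by (rule sum.cong[OF refl])
    then show ?thesis using True by (simp add: app_mat_op) (simp add: op_idem_def app_mat_op)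
  qed (simp add: app_mat_op op_idem_def)
qed

lemma lie_op_e_f:
  assumes "i \<in> {1..<n}" "j \<in> {1..<n}"
  shows "lie (op_e n d i) (op_f n d j) =
    (if i = j then \<Sum>\<mu>\<in>Lam n d. scalar_op (of_int (\<mu> j - \<mu> (j + 1))) * op_idem n d \<mu> else 0)"
proof -
  have "mat_op n d i i = (\<Sum>\<mu>\<in>Lam n d. scalar_op (of_int (\<mu> i)) * op_idem n d \<mu>)" for i
  proof (rule linop_eqI, rule ext)
    fix t :: tensor and w :: "nat \<Rightarrow> nat"
    have "(\<Sum>k=1..d. if w k = i then t (w(k := i)) else 0) = (\<Sum>k\<in>{k \<in> {1..d}. w k = i}. t w)"
      unfolding sum.inter_filter[OF finite_atLeastAtMost] by (intro sum.cong) auto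
    then show "app_op (mat_op n d i i) t w = app_op (\<Sum>\<mu>\<in>Lam n d. scalar_op (of_int (\<mu> i)) * op_idem n d \<mu>) t w"
      by (simp add: sum_Lam_op_idem app_mat_op index_wt_def)
  qed
  then have "mat_op n d j j - mat_op n d (j + 1) (j + 1) =
      (\<Sum>\<mu>\<in>Lam n d. scalar_op (of_int (\<mu> j - \<mu> (j + 1))) * op_idem n d \<mu>)"
    by (simp add: op.scalar_diff left_diff_distrib sum_subtractf)
  then show ?thesis using assms by (auto simp: op_e_def op_f_def lie_mat_op)
qed

primrec op_gen :: "nat \<Rightarrow> nat \<Rightarrow> schur_gen \<Rightarrow> linop" where
  "op_gen n d (GIdem \<mu>) = op_idem n d \<mu>"
| "op_gen n d (GE i) = op_e n d i"
| "op_gen n d (GF i) = op_f n d i"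

definition schur_hom :: "nat \<Rightarrow> nat \<Rightarrow> schur_gen ncpoly \<Rightarrow> tensor \<Rightarrow> tensor" where
  "schur_hom n d p = op_res n d (op.nc_subst (op_gen n d) p)"

lemma equivariant_nc_subst: "equivariant n d (op.nc_subst (op_gen n d) p)"
proof (induction p rule: ncpoly_induct)
  case (add w c q)
  have "equivariant n d (op_gen n d g)" for g
    by (cases g) (simp_all add: op_e_def op_f_def equivariant_mat_op equivariant_op_idem)
  then have "equivariant n d (prod_list (map (op_gen n d) gs))" for gs
    by (induction gs) (simp_all add: equivariant_1 equivariant_mult)
  then show ?case
    using add by (simp add: op.nc_subst_add op.nc_subst_single equivariant_add equivariant_mult equivariant_scalar_op)
qed (simp add: equivariant_0)

lemma schur_hom_ring_hom: "schur_hom n d \<in> ring_hom (free_alg X) (schur_alg n d)"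
  by (rule ring_hom_memI)
    (simp_all add: schur_hom_def op_res_carrier equivariant_nc_subst op.nc_subst_mult op.nc_subst_add
      op_res_mult op_res_add op_res_1)

lemma schur_hom_scale: "schur_hom n d (nc_const c * p) = c \<odot>\<^bsub>schur_alg n d\<^esub> schur_hom n d p"
  by (simp add: schur_hom_def op.nc_subst_mult op_res_scale)

lemma schur_hom_gen: "g \<in> schur_gens n d \<Longrightarrow> schur_hom n d (nc_gen g) = schur_gen_elt n d g"
  by (auto simp: schur_hom_def schur_gens_def schur_idem_op schur_e_op schur_f_op)

lemma schur_hom_rels:
  assumes "r \<in> schur_rels n d"
  shows "schur_hom n d r = \<zero>\<^bsub>schur_alg n d\<^esub>"
proof -
  note subst = op.nc_subst_diff op.nc_subst_mult op.nc_subst_sum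
  have e: "op_e n d i * op_idem n d \<mu> = op_idem n d (\<mu> + sroot i) * op_e n d i"
    and f: "op_f n d i * op_idem n d \<mu> = op_idem n d (\<mu> - sroot i) * op_f n d i" if "i \<in> {1..<n}" for i \<mu>
    using that mat_op_idem[of "Suc i" n d i \<mu>] mat_op_idem[of i n d "Suc i" \<mu>]
    by (simp_all add: op_e_def op_f_def sroot_def algebra_simps)
  \<comment> \<open>The relations with the idempotent on the left are \<open>e\<close> and
    \<open>f\<close> read at a shifted weight, where the idempotent is zero outside
    \<open>\<Lambda>(n,d)\<close>.\<close>
  have e0: "op_idem n d \<mu> * op_e n d i = 0" if "i \<in> {1..<n}" "\<mu> - sroot i \<notin> Lam n d" for i \<mu>
    using e[OF that(1), of "\<mu> - sroot i"] op_idem_outside[OF that(2)] by simp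
  have f0: "op_idem n d \<mu> * op_f n d i = 0" if "i \<in> {1..<n}" "\<mu> + sroot i \<notin> Lam n d" for i \<mu>
    using f[OF that(1), of "\<mu> + sroot i"] op_idem_outside[OF that(2)] by simp
  consider "r \<in> rel_R1' n d" | "r \<in> rel_R2' n d" | "r \<in> rel_R3' n d" | "r \<in> rel_R4 n" | "r \<in> rel_R5 n"
    using assms by (auto simp: schur_rels_def)
  then have "op_res n d (op.nc_subst (op_gen n d) r) = op_res n d 0"
  proof cases
    case 1
    then consider \<mu> \<nu> where "r = I1 \<mu> * I1 \<nu> - (if \<mu> = \<nu> then I1 \<mu> else 0)" | "r = (\<Sum>\<mu>\<in>Lam n d. I1 \<mu>) - 1"
      by (auto simp: rel_R1'_def)
    then show ?thesis
    proof cases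
      case 1
      then show ?thesis by (simp add: subst op_idem_mult)
    next
      case 2
      \<comment> \<open>The weight projections add up to the identity only on
        \<open>tensor_space\<close>, so this relation is an equation between restrictions.\<close>
      have "app_op (\<Sum>\<mu>\<in>Lam n d. op_idem n d \<mu>) t w = t w" if "t \<in> tensor_space n d" for t w
        using sum_Lam_op_idem[of "\<lambda>_. 1" n d t w] that by (auto simp: op.scalar_1 tensor_space_def)
      then show ?thesis using 2 by (intro op_res_eqI) (simp add: subst)
    qed
  next
    case 2
    then show ?thesis
      unfolding rel_R2'_def by (auto simp: subst e f e0 f0 op_idem_outside)
  next
    case 3
    then obtain i j where "i \<in> {1..<n}" "j \<in> {1..<n}" and r: "r = E1 i * F1 j - F1 j * E1 i -
       (if i = j then \<Sum>\<mu> \<in> Lam n d. nc_const (of_int (\<mu> j - \<mu> (j + 1))) * I1 \<mu> else 0)"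
      by (auto simp: rel_R3'_def)
    then have "op.nc_subst (op_gen n d) r = lie (op_e n d i) (op_f n d j) -
       (if i = j then \<Sum>\<mu>\<in>Lam n d. scalar_op (of_int (\<mu> j - \<mu> (j + 1))) * op_idem n d \<mu> else 0)"
      by (simp add: subst lie_def)
    then show ?thesis using lie_op_e_f[of i n j d] \<open>i \<in> {1..<n}\<close> \<open>j \<in> {1..<n}\<close> by simp
  next
    case 4
    then show ?thesis by (auto simp: rel_R4_def op.nc_subst_serre op_e_def lie_mat_op)
  next
    case 5
    then show ?thesis by (auto simp: rel_R5_def op.nc_subst_serre op_f_def lie_mat_op)
  qed
  then show ?thesis by (simp add: schur_hom_def op_res_0)
qed

text \<open>Lifting the spanning products to the free algebra allows the same combination to be
  evaluated in \<open>S(n,d)\<close> and in the quotient.\<close>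

definition nc_pbw :: "(nat \<times> nat) multiset \<times> weight \<Rightarrow> schur_gen ncpoly" where
  "nc_pbw \<theta> = mat_word E1 F1 (mset_list (fst \<theta>)) * I1 (snd \<theta>)"

definition nc_comb :: "nat \<Rightarrow> nat \<Rightarrow> ((nat \<times> nat) multiset \<times> weight \<Rightarrow> rat) \<Rightarrow> schur_gen ncpoly" where
  "nc_comb n d c = (\<Sum>\<theta>\<in>pbw_index n d. nc_const (c \<theta>) * nc_pbw \<theta>)"

lemma pbw_index_words: "\<theta> \<in> pbw_index n d \<Longrightarrow> set (mset_list (fst \<theta>)) \<subseteq> roots n"
  by (auto simp: pbw_index_def simp flip: set_mset_mset)

lemma nc_comb_free_alg: "nc_comb n d c \<in> carrier (free_alg (schur_gens n d))"
  unfolding nc_comb_def nc_pbw_def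
proof (intro free_alg_sum free_alg_closed(4) free_alg_const)
  fix \<theta> assume \<theta>: "\<theta> \<in> pbw_index n d"
  show "mat_word E1 F1 (mset_list (fst \<theta>)) \<in> carrier (free_alg (schur_gens n d))"
    using pbw_index_words[OF \<theta>] by (intro mat_word_free_alg E1_free_alg F1_free_alg)
  show "I1 (snd \<theta>) \<in> carrier (free_alg (schur_gens n d))"
    using \<theta> by (intro I1_free_alg) (auto simp: pbw_index_def)
qed

lemma app_op_nc_comb:
  "app_op (op.nc_subst (op_gen n d) (nc_comb n d c)) t v = (\<Sum>\<theta>\<in>pbw_index n d. c \<theta> * app_op (op_pbw n d \<theta>) t v)"
proof -
  have "op.nc_subst (op_gen n d) (nc_pbw \<theta>) = op_pbw n d \<theta>" for \<theta>
    by (simp add: nc_pbw_def op_pbw_def op.nc_subst_mult op.nc_subst_mat_word)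
  then show ?thesis
    by (simp add: nc_comb_def op.nc_subst_sum op.nc_subst_mult app_op_sum_left)
qed

section \<open>Endomorphisms as functions on orbits\<close>

lemma delta_tensor_space: "w \<in> multi_indices n d \<Longrightarrow> delta w \<in> tensor_space n d"
  by (auto simp: delta_def tensor_space_def)

lemma schur_hom_delta: "w \<in> multi_indices n d \<Longrightarrow>
    schur_hom n d p (delta w) = app_op (op.nc_subst (op_gen n d) p) (delta w)"
  by (simp add: schur_hom_def op_res_def delta_tensor_space)

lemma schur_alg_expand:
  assumes f: "f \<in> carrier (schur_alg n d)" and t: "t \<in> tensor_space n d"
  shows "f t v = (\<Sum>w\<in>multi_indices n d. t w * f (delta w) v)"
proof -
  have scale: "s \<in> tensor_space n d \<Longrightarrow> (\<lambda>u. c * s u) \<in> tensor_space n d" for c and s :: tensor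
    by (simp add: tensor_space_def)
  have f_add: "s \<in> tensor_space n d \<Longrightarrow> t \<in> tensor_space n d \<Longrightarrow> f (s + t) = f s + f t"
    and f_scale: "s \<in> tensor_space n d \<Longrightarrow> f (\<lambda>u. c * s u) = (\<lambda>u. c * f s u)" for s t c
    using f by (auto simp: schur_alg_def)
  have f_0: "f 0 = 0" using f_add[of 0 0] by (simp add: tensor_space_closed)
  define part where "part A = (\<Sum>w\<in>A. (\<lambda>u. t w * delta w u))" for A
  have "part A \<in> tensor_space n d \<and> f (part A) v = (\<Sum>w\<in>A. t w * f (delta w) v)"
    if "finite A" "A \<subseteq> multi_indices n d" for A
    using that
  proof (induction A)
    case empty
    show ?case
      using f_0 tensor_space_closed(1)[of n d] by (simp add: part_def zero_fun_def)
  next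
    case (insert w A)
    have w: "(\<lambda>u. t w * delta w u) \<in> tensor_space n d"
      using insert.prems by (intro scale delta_tensor_space) auto
    have "part (insert w A) = (\<lambda>u. t w * delta w u) + part A"
      unfolding part_def using insert.hyps by (rule sum.insert)
    moreover have "(\<lambda>u. t w * delta w u) + part A \<in> tensor_space n d"
      using insert w by (intro tensor_space_closed(2)) simp_all
    ultimately show ?case
      using insert w f_add[of "\<lambda>u. t w * delta w u" "part A"] f_scale[OF delta_tensor_space, of w "t w"]
      by (simp add: plus_fun_def)
  qed
  moreover have "part (multi_indices n d) = t"
  proof
    fix u
    have "part (multi_indices n d) u = (\<Sum>w\<in>multi_indices n d. t w * delta w u)"
      unfolding part_def using sum_comp_morphism[of "\<lambda>s. s u" "\<lambda>w u. t w * delta w u" "multi_indices n d"]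
      by (simp add: o_def)
    also have "\<dots> = (\<Sum>w\<in>multi_indices n d. if w = u then t u else 0)"
      by (intro sum.cong) (auto simp: delta_def)
    finally show "part (multi_indices n d) u = t u"
      using t by (auto simp: finite_multi_indices tensor_space_def)
  qed
  ultimately show ?thesis using finite_multi_indices by (metis order_refl)
qed

text \<open>Place permutations permute the basis tensors: \<open>place_perm \<sigma>\<close> sends
  \<open>delta (w \<circ> \<sigma>)\<close> to \<open>delta w\<close>. Hence the matrix of
  \<open>f\<close> is constant on orbits.\<close>

lemma schur_alg_invariant:
  assumes f: "f \<in> carrier (schur_alg n d)" and \<sigma>: "\<sigma> permutes {1..d}" and w: "w \<in> multi_indices n d"
  shows "f (delta (w \<circ> \<sigma>)) (v \<circ> \<sigma>) = f (delta w) v"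
proof -
  have "place_perm \<sigma> (delta (w \<circ> \<sigma>)) = delta w"
    using permutes_surj[OF \<sigma>] by (auto simp: place_perm_def delta_def fun_eq_iff) (metis surjD)
  moreover have "delta (w \<circ> \<sigma>) \<in> tensor_space n d"
    using w \<sigma> by (intro delta_tensor_space) (simp add: multi_indices_comp_iff)
  ultimately have "f (delta w) = place_perm \<sigma> (f (delta (w \<circ> \<sigma>)))"
    using f \<sigma> unfolding schur_alg_def by simp metis
  then show ?thesis by (simp add: place_perm_def)
qed

definition orbit_rep :: "nat \<Rightarrow> nat \<Rightarrow> (nat \<times> nat) multiset \<times> weight \<Rightarrow> (nat \<Rightarrow> nat) \<times> (nat \<Rightarrow> nat)" where
  "orbit_rep n d \<theta> = (SOME p. fst p \<in> multi_indices n d \<and> snd p \<in> multi_indices n d \<and>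
     off_diag d (fst p) (snd p) = fst \<theta> \<and> index_wt d (snd p) = snd \<theta>)"

lemma orbit_rep:
  assumes "\<theta> \<in> pbw_index n d"
  shows "fst (orbit_rep n d \<theta>) \<in> multi_indices n d" "snd (orbit_rep n d \<theta>) \<in> multi_indices n d"
    "off_diag d (fst (orbit_rep n d \<theta>)) (snd (orbit_rep n d \<theta>)) = fst \<theta>"
    "index_wt d (snd (orbit_rep n d \<theta>)) = snd \<theta>"
proof -
  have "(fst \<theta>, snd \<theta>) \<in> pbw_index n d" using assms by simp
  then obtain v w where "v \<in> multi_indices n d" "w \<in> multi_indices n d" "off_diag d v w = fst \<theta>" "index_wt d w = snd \<theta>"
    by (rule pbw_index_realized)
  then have "\<exists>p. fst p \<in> multi_indices n d \<and> snd p \<in> multi_indices n d \<and>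
     off_diag d (fst p) (snd p) = fst \<theta> \<and> index_wt d (snd p) = snd \<theta>"
    by (intro exI[of _ "(v, w)"]) simp
  from someI_ex[OF this, folded orbit_rep_def]
  show "fst (orbit_rep n d \<theta>) \<in> multi_indices n d" "snd (orbit_rep n d \<theta>) \<in> multi_indices n d"
    "off_diag d (fst (orbit_rep n d \<theta>)) (snd (orbit_rep n d \<theta>)) = fst \<theta>"
    "index_wt d (snd (orbit_rep n d \<theta>)) = snd \<theta>"
    by blast+
qed

definition orbit_coeff :: "nat \<Rightarrow> nat \<Rightarrow> (tensor \<Rightarrow> tensor) \<Rightarrow> (nat \<times> nat) multiset \<times> weight \<Rightarrow> rat" where
  "orbit_coeff n d f \<theta> = f (delta (snd (orbit_rep n d \<theta>))) (fst (orbit_rep n d \<theta>))"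

text \<open>Every pair of multi-indices is a permuted representative of its orbit, so the values at
  the representatives determine all matrix entries.\<close>

lemma schur_alg_eqI:
  assumes f: "f \<in> carrier (schur_alg n d)" and g: "g \<in> carrier (schur_alg n d)"
    and eq: "\<And>\<theta>. \<theta> \<in> pbw_index n d \<Longrightarrow> orbit_coeff n d f \<theta> = orbit_coeff n d g \<theta>"
  shows "f = g"
proof -
  have delta_eq: "f (delta w) v = g (delta w) v" if w: "w \<in> multi_indices n d" for v w
  proof (cases "v \<in> multi_indices n d")
    case v: True
    let ?\<theta> = "(off_diag d v w, index_wt d w)"
    have \<theta>: "?\<theta> \<in> pbw_index n d" using v w by (rule pbw_indexI)
    note rep = orbit_rep[OF \<theta>]
    obtain \<sigma> where \<sigma>: "\<sigma> permutes {1..d}" "v = fst (orbit_rep n d ?\<theta>) \<circ> \<sigma>" "w = snd (orbit_rep n d ?\<theta>) \<circ> \<sigma>"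
      by (rule same_index_permutes[OF v w rep(1,2)]) (simp_all add: rep(3,4))
    have "h (delta w) v = orbit_coeff n d h ?\<theta>" if "h \<in> carrier (schur_alg n d)" for h
      unfolding orbit_coeff_def
      using schur_alg_invariant[OF that \<sigma>(1) rep(2), of "fst (orbit_rep n d ?\<theta>)"]
      by (simp only: \<sigma>(2,3)[symmetric])
    then show ?thesis using f g eq[OF \<theta>] by simp
  next
    case False
    then show ?thesis
      using f g delta_tensor_space[OF w] by (auto simp: schur_alg_def tensor_space_def PiE_iff)
  qed
  show ?thesis
  proof
    fix t
    show "f t = g t"
    proof (cases "t \<in> tensor_space n d")
      case True
      then show ?thesis
        by (intro ext) (simp add: schur_alg_expand[OF f] schur_alg_expand[OF g] delta_eq)
    next
      case False
      then show ?thesis using f g by (auto simp: schur_alg_def PiE_iff extensional_def)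
    qed
  qed
qed

definition orbit_matrix :: "nat \<Rightarrow> nat \<Rightarrow> (nat \<times> nat) multiset \<times> weight \<Rightarrow> (nat \<times> nat) multiset \<times> weight \<Rightarrow> rat" where
  "orbit_matrix n d \<theta> \<theta>' = app_op (op_pbw n d \<theta>') (delta (snd (orbit_rep n d \<theta>))) (fst (orbit_rep n d \<theta>))"

lemma orbit_coeff_nc_comb:
  "\<theta> \<in> pbw_index n d \<Longrightarrow>
    orbit_coeff n d (schur_hom n d (nc_comb n d c)) \<theta> = (\<Sum>\<theta>'\<in>pbw_index n d. c \<theta>' * orbit_matrix n d \<theta> \<theta>')"
  by (simp add: orbit_coeff_def orbit_matrix_def schur_hom_delta orbit_rep(2) app_op_nc_comb)

lemma orbit_matrix_diag: "\<theta> \<in> pbw_index n d \<Longrightarrow> orbit_matrix n d \<theta> \<theta> \<noteq> 0"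
  using op_pbw_diagonal[of "fst (orbit_rep n d \<theta>)" n d "snd (orbit_rep n d \<theta>)"]
  by (simp add: orbit_matrix_def orbit_rep)

lemma orbit_matrix_triangular:
  assumes "\<theta> \<in> pbw_index n d" "\<theta>' \<in> pbw_index n d" "orbit_matrix n d \<theta> \<theta>' \<noteq> 0"
  shows "\<theta> = \<theta>' \<or> size (fst \<theta>) < size (fst \<theta>')"
  using op_pbw_triangular[of "fst (orbit_rep n d \<theta>)" n d "snd (orbit_rep n d \<theta>)" "fst \<theta>'" "snd \<theta>'"] assms
  by (auto simp: orbit_matrix_def orbit_rep)

lemma schur_hom_surj: "schur_hom n d ` carrier (free_alg (schur_gens n d)) = carrier (schur_alg n d)"
proof
  show "schur_hom n d ` carrier (free_alg (schur_gens n d)) \<subseteq> carrier (schur_alg n d)"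
    by (auto simp: schur_hom_def op_res_carrier equivariant_nc_subst)
  show "carrier (schur_alg n d) \<subseteq> schur_hom n d ` carrier (free_alg (schur_gens n d))"
  proof
    fix f assume f: "f \<in> carrier (schur_alg n d)"
    have "\<exists>c. \<forall>\<theta>\<in>pbw_index n d. (\<Sum>\<theta>'\<in>pbw_index n d. c \<theta>' * orbit_matrix n d \<theta> \<theta>') = orbit_coeff n d f \<theta>"
      by (rule triangular_solve[where s = "\<lambda>\<theta>. size (fst \<theta>)"])
        (simp_all add: finite_pbw_index orbit_matrix_diag orbit_matrix_triangular)
    then obtain c where c: "\<forall>\<theta>\<in>pbw_index n d. (\<Sum>\<theta>'\<in>pbw_index n d. c \<theta>' * orbit_matrix n d \<theta> \<theta>') = orbit_coeff n d f \<theta>" ..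
    have "schur_hom n d (nc_comb n d c) = f"
    proof (rule schur_alg_eqI[OF _ f])
      show "schur_hom n d (nc_comb n d c) \<in> carrier (schur_alg n d)"
        by (simp add: schur_hom_def op_res_carrier equivariant_nc_subst)
    qed (use c in \<open>simp add: orbit_coeff_nc_comb\<close>)
    then show "f \<in> schur_hom n d ` carrier (free_alg (schur_gens n d))"
      using nc_comb_free_alg by blast
  qed
qed

text \<open>All coefficients vanish, so the conclusion is an equation in the free algebra itself.
  Modulo the relations every element is such a combination, which makes this enough for
  injectivity.\<close>

lemma schur_hom_nc_comb_inj:
  assumes "schur_hom n d (nc_comb n d c) = \<zero>\<^bsub>schur_alg n d\<^esub>"
  shows "nc_comb n d c = 0"
proof -
  have zero: "(\<Sum>\<theta>'\<in>pbw_index n d. c \<theta>' * orbit_matrix n d \<theta> \<theta>') = 0" if "\<theta> \<in> pbw_index n d" for \<theta>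
    using orbit_coeff_nc_comb[OF that, of c] assms delta_tensor_space[OF orbit_rep(2)[OF that]]
    by (simp add: orbit_coeff_def schur_alg_def)
  have "c \<theta> = 0" if "\<theta> \<in> pbw_index n d" for \<theta>
    by (rule triangular_zero[where A = "orbit_matrix n d" and s = "\<lambda>\<theta>. size (fst \<theta>)", OF _ _ _ _ that])
      (simp_all add: zero finite_pbw_index orbit_matrix_diag orbit_matrix_triangular)
  then show ?thesis by (simp add: nc_comb_def nc_const_def)
qed

section \<open>The quotients as a type\<close>

definition rel_ideal :: "nat \<times> nat \<Rightarrow> schur_gen ncpoly set" where
  "rel_ideal k = Idl\<^bsub>free_alg (schur_gens (fst k) (snd k))\<^esub> (schur_rels (fst k) (snd k))"

abbreviation gen_alg :: "nat \<times> nat \<Rightarrow> (rat, schur_gen ncpoly) module" where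
  "gen_alg k \<equiv> free_alg (schur_gens (fst k) (snd k))"

abbreviation pres_alg :: "nat \<times> nat \<Rightarrow> schur_gen ncpoly set ring" where
  "pres_alg k \<equiv> gen_alg k Quot rel_ideal k"

lemma ideal_rel_ideal: "ideal (rel_ideal k) (gen_alg k)"
  unfolding rel_ideal_def by (rule ring.genideal_ideal[OF ring_free_alg schur_rels_free_alg])

lemma ring_pres_alg: "ring (pres_alg k)"
  using ideal_rel_ideal by (rule ideal.quotient_is_ring)

lemma coset_hom: "(+>\<^bsub>gen_alg k\<^esub>) (rel_ideal k) \<in> ring_hom (gen_alg k) (pres_alg k)"
  using ideal_rel_ideal by (rule ideal.rcos_ring_hom)

lemma free_alg_minus_eq:
  assumes "p \<in> carrier (free_alg X)" "q \<in> carrier (free_alg X)"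
  shows "p \<ominus>\<^bsub>free_alg X\<^esub> q = p - q"
proof -
  interpret F: ring "free_alg X" by (rule ring_free_alg)
  have "q \<oplus>\<^bsub>free_alg X\<^esub> \<ominus>\<^bsub>free_alg X\<^esub> q = 0"
    using F.r_neg[OF assms(2)] by simp
  then have "\<ominus>\<^bsub>free_alg X\<^esub> q = - q"
    by (simp add: add_eq_0_iff)
  then show ?thesis by (simp add: a_minus_def)
qed

lemma coset_eq_iff:
  assumes "p \<in> carrier (gen_alg k)" "q \<in> carrier (gen_alg k)"
  shows "rel_ideal k +>\<^bsub>gen_alg k\<^esub> p = rel_ideal k +>\<^bsub>gen_alg k\<^esub> q \<longleftrightarrow> p - q \<in> rel_ideal k"
  using ring.quotient_eq_iff_same_a_r_cos[OF ring_free_alg ideal_rel_ideal assms] free_alg_minus_eq[OF assms]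
  by simp

lemma rel_ideal_kernel:
  "p \<in> rel_ideal (n, d) \<Longrightarrow> schur_hom n d p = \<zero>\<^bsub>schur_alg n d\<^esub>"
proof -
  let ?F = "free_alg (schur_gens n d)"
  interpret h: ring_hom_ring ?F "schur_alg n d" "schur_hom n d"
    by (rule ring_hom_ringI2[OF ring_free_alg ring_schur_alg schur_hom_ring_hom])
  have "schur_rels n d \<subseteq> a_kernel ?F (schur_alg n d) (schur_hom n d)"
    using schur_rels_free_alg[of n d] schur_hom_rels[of _ n d] unfolding a_kernel_def' by blast
  then have "rel_ideal (n, d) \<subseteq> a_kernel ?F (schur_alg n d) (schur_hom n d)"
    unfolding rel_ideal_def fst_conv snd_conv by (rule h.R.genideal_minimal[OF h.kernel_is_ideal])
  then show "p \<in> rel_ideal (n, d) \<Longrightarrow> schur_hom n d p = \<zero>\<^bsub>schur_alg n d\<^esub>"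
    unfolding a_kernel_def' by blast
qed

text \<open>The class \<open>ring_1\<close> demands \<open>0 \<noteq> 1\<close> in the product of
  all quotients, for which one nonzero factor is enough. For \<open>n = d = 0\<close> tensor space
  is a line with the empty index as basis, which as an extensional function is
  \<open>\<lambda>_. undefined\<close>.\<close>

lemma one_notin_rel_ideal: "1 \<notin> rel_ideal (0, 0)"
proof
  assume "1 \<in> rel_ideal (0, 0)"
  then have eq: "(\<lambda>t \<in> tensor_space 0 0. t) = (\<lambda>t \<in> tensor_space 0 0. 0)"
    using rel_ideal_kernel[of 1 0 0] by (simp add: schur_hom_def op_res_def schur_alg_def)
  have "(\<lambda>_. undefined) \<in> multi_indices 0 0" by (simp add: multi_indices_def)
  then have "delta (\<lambda>_. undefined) \<in> tensor_space 0 0" by (rule delta_tensor_space)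
  then have "delta (\<lambda>_. undefined) = 0" using fun_cong[OF eq, of "delta (\<lambda>_. undefined)"] by simp
  then have "delta (\<lambda>_. undefined) (\<lambda>_. undefined) = 0" by simp
  then show False by (simp add: delta_def)
qed

text \<open>The quotients \<^term>\<open>pres_alg (n, d)\<close> depend on the numbers \<open>n\<close> and \<open>d\<close> and hence are not types.
  The product of all of them is one, which makes the type class \<^class>\<open>ring_1\<close> available for
  computations in each factor.\<close>

typedef pres_prod = "{x :: nat \<times> nat \<Rightarrow> schur_gen ncpoly set. \<forall>k. x k \<in> carrier (pres_alg k)}"
  morphisms component Abs_pres_prod
proof
  show "(\<lambda>k. \<zero>\<^bsub>pres_alg k\<^esub>) \<in> {x. \<forall>k. x k \<in> carrier (pres_alg k)}"
    using ring.ring_simprules(2)[OF ring_pres_alg] by blast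
qed

setup_lifting type_definition_pres_prod

lemma component_carrier: "component x k \<in> carrier (pres_alg k)"
  using component[of x] by blast

lemma pres_prod_eqI: "(\<And>k. component x k = component y k) \<Longrightarrow> x = y"
  by (simp add: fun_eq_iff flip: component_inject)

instantiation pres_prod :: ring_1
begin

lift_definition zero_pres_prod :: pres_prod is "\<lambda>k. \<zero>\<^bsub>pres_alg k\<^esub>"
  by (rule ring.ring_simprules(2)[OF ring_pres_alg])
lift_definition one_pres_prod :: pres_prod is "\<lambda>k. \<one>\<^bsub>pres_alg k\<^esub>"
  by (rule ring.ring_simprules(6)[OF ring_pres_alg])
lift_definition plus_pres_prod :: "pres_prod \<Rightarrow> pres_prod \<Rightarrow> pres_prod" is "\<lambda>x y k. x k \<oplus>\<^bsub>pres_alg k\<^esub> y k"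
  by (simp add: ring.ring_simprules(1)[OF ring_pres_alg])
lift_definition times_pres_prod :: "pres_prod \<Rightarrow> pres_prod \<Rightarrow> pres_prod" is "\<lambda>x y k. x k \<otimes>\<^bsub>pres_alg k\<^esub> y k"
  by (simp add: ring.ring_simprules(5)[OF ring_pres_alg])
lift_definition uminus_pres_prod :: "pres_prod \<Rightarrow> pres_prod" is "\<lambda>x k. \<ominus>\<^bsub>pres_alg k\<^esub> x k"
  by (simp add: ring.ring_simprules(3)[OF ring_pres_alg])
lift_definition minus_pres_prod :: "pres_prod \<Rightarrow> pres_prod \<Rightarrow> pres_prod" is "\<lambda>x y k. x k \<ominus>\<^bsub>pres_alg k\<^esub> y k"
  by (simp add: ring.ring_simprules(4)[OF ring_pres_alg])

instance
proof
  fix a b c :: pres_prod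
  note Q = ring.ring_simprules[OF ring_pres_alg]
  note eqs = plus_pres_prod.rep_eq times_pres_prod.rep_eq zero_pres_prod.rep_eq one_pres_prod.rep_eq
    uminus_pres_prod.rep_eq minus_pres_prod.rep_eq
  show "a + b + c = a + (b + c)" by (rule pres_prod_eqI) (simp add: eqs Q(7) component_carrier)
  show "a + b = b + a" by (rule pres_prod_eqI) (simp add: eqs Q(10) component_carrier)
  show "0 + a = a" by (rule pres_prod_eqI) (simp add: eqs Q(8) component_carrier)
  show "- a + a = 0" by (rule pres_prod_eqI) (simp add: eqs Q(9) component_carrier)
  show "a - b = a + - b" by (rule pres_prod_eqI) (simp add: eqs a_minus_def)
  show "a * b * c = a * (b * c)" by (rule pres_prod_eqI) (simp add: eqs Q(11) component_carrier)
  show "1 * a = a" by (rule pres_prod_eqI) (simp add: eqs Q(12) component_carrier)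
  show "a * 1 = a"
    by (rule pres_prod_eqI)
      (simp add: eqs component_carrier monoid.r_one[OF ring.is_monoid[OF ring_pres_alg]])
  show "(a + b) * c = a * c + b * c" by (rule pres_prod_eqI) (simp add: eqs Q(13) component_carrier)
  show "a * (b + c) = a * b + a * c" by (rule pres_prod_eqI) (simp add: eqs ring.ring_simprules(23)[OF ring_pres_alg] component_carrier)
  show "(0 :: pres_prod) \<noteq> 1"
  proof
    assume "(0 :: pres_prod) = 1"
    then have "\<zero>\<^bsub>pres_alg (0, 0)\<^esub> = \<one>\<^bsub>pres_alg (0, 0)\<^esub>"
      by (metis zero_pres_prod.rep_eq one_pres_prod.rep_eq)
    then have "rel_ideal (0, 0) +>\<^bsub>gen_alg (0, 0)\<^esub> 1 = rel_ideal (0, 0) +>\<^bsub>gen_alg (0, 0)\<^esub> 0"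
      using ring_hom_one[OF coset_hom, of "(0, 0)"]
        ring_hom_zero[OF coset_hom ring_free_alg ring_pres_alg, of "(0, 0)"] by simp
    then show False
      using coset_eq_iff[OF free_alg_closed(2,1), of "(0, 0)"] one_notin_rel_ideal by simp
  qed
qed

end

text \<open>The quotient with index \<open>l\<close> as one factor of the product. On the free
  algebra this respects sums and products but not the unit: \<open>emb l 1\<close> is the idempotent
  that cuts out the factor.\<close>

lift_definition emb :: "nat \<times> nat \<Rightarrow> schur_gen ncpoly \<Rightarrow> pres_prod" is
  "\<lambda>l p k. if k = l \<and> p \<in> carrier (gen_alg l) then rel_ideal l +>\<^bsub>gen_alg l\<^esub> p else \<zero>\<^bsub>pres_alg k\<^esub>"
proof -
  fix l p k
  show "(if k = l \<and> p \<in> carrier (gen_alg l) then rel_ideal l +>\<^bsub>gen_alg l\<^esub> p else \<zero>\<^bsub>pres_alg k\<^esub>)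
      \<in> carrier (pres_alg k)"
    using ring_hom_closed[OF coset_hom[of l], of p] ring.ring_simprules(2)[OF ring_pres_alg, of k]
    by (cases "k = l \<and> p \<in> carrier (gen_alg l)") (simp_all only: if_True if_False simp_thms)
qed

text \<open>Scalars sit in all factors at once, so that \<open>scal 1\<close> is the unit of the
  product.\<close>

lift_definition scal :: "rat \<Rightarrow> pres_prod" is "\<lambda>c k. rel_ideal k +>\<^bsub>gen_alg k\<^esub> nc_const c"
  by (rule ring_hom_closed[OF coset_hom free_alg_const])

lemma component_simps:
  "component (x + y) k = component x k \<oplus>\<^bsub>pres_alg k\<^esub> component y k" "component (x * y) k = component x k \<otimes>\<^bsub>pres_alg k\<^esub> component y k"
  "component 0 k = \<zero>\<^bsub>pres_alg k\<^esub>" "component 1 k = \<one>\<^bsub>pres_alg k\<^esub>"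
  by (simp_all only: plus_pres_prod.rep_eq times_pres_prod.rep_eq zero_pres_prod.rep_eq one_pres_prod.rep_eq)

lemma nc_const_comm: "p * nc_const c = nc_const c * p"
proof (induction p rule: ncpoly_induct)
  case (add w b q)
  then show ?case
    by (simp add: distrib_left distrib_right nc_const_def mult_single mult.commute)
qed simp

lemma nc_const_simps: "nc_const (a + b) = nc_const a + nc_const b" "nc_const (a * b) = nc_const a * nc_const b"
  "nc_const 1 = 1"
  by (simp_all add: nc_const_def single_add mult_single)

lemma coset_simps:
  assumes "p \<in> carrier (gen_alg k)" "q \<in> carrier (gen_alg k)"
  shows "(rel_ideal k +>\<^bsub>gen_alg k\<^esub> p) \<oplus>\<^bsub>pres_alg k\<^esub> (rel_ideal k +>\<^bsub>gen_alg k\<^esub> q) = rel_ideal k +>\<^bsub>gen_alg k\<^esub> (p + q)"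
    and "(rel_ideal k +>\<^bsub>gen_alg k\<^esub> p) \<otimes>\<^bsub>pres_alg k\<^esub> (rel_ideal k +>\<^bsub>gen_alg k\<^esub> q) = rel_ideal k +>\<^bsub>gen_alg k\<^esub> (p * q)"
  using ring_hom_add[OF coset_hom assms] ring_hom_mult[OF coset_hom assms] by simp_all

lemma coset_0: "rel_ideal k +>\<^bsub>gen_alg k\<^esub> 0 = \<zero>\<^bsub>pres_alg k\<^esub>"
  and coset_1: "rel_ideal k +>\<^bsub>gen_alg k\<^esub> 1 = \<one>\<^bsub>pres_alg k\<^esub>"
  using ring_hom_zero[OF coset_hom ring_free_alg ring_pres_alg, of k] ring_hom_one[OF coset_hom, of k] by simp_all

lemma pres_alg_coset:
  assumes "X \<in> carrier (pres_alg k)"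
  obtains p where "p \<in> carrier (gen_alg k)" "X = rel_ideal k +>\<^bsub>gen_alg k\<^esub> p"
  using assms by (auto simp: FactRing_def A_RCOSETS_def')

interpretation pres: rat_scalars scal
proof unfold_locales
  fix a b :: rat and z :: pres_prod
  show "scal (a + b) = scal a + scal b"
    by (rule pres_prod_eqI) (simp add: component_simps scal.rep_eq coset_simps free_alg_const nc_const_simps)
  show "scal (a * b) = scal a * scal b"
    by (rule pres_prod_eqI) (simp add: component_simps scal.rep_eq coset_simps free_alg_const nc_const_simps)
  show "scal 1 = 1"
    by (rule pres_prod_eqI) (simp add: component_simps scal.rep_eq coset_1 nc_const_simps)
  show "z * scal a = scal a * z"
  proof (rule pres_prod_eqI)
    fix k
    obtain p where "p \<in> carrier (gen_alg k)" "component z k = rel_ideal k +>\<^bsub>gen_alg k\<^esub> p"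
      using component_carrier by (rule pres_alg_coset)
    then show "component (z * scal a) k = component (scal a * z) k"
      by (simp add: component_simps scal.rep_eq coset_simps free_alg_const nc_const_comm)
  qed
qed

lemma emb_0: "emb l 0 = 0"
  by (rule pres_prod_eqI) (simp add: emb.rep_eq component_simps coset_0)

lemma emb_simps:
  assumes p: "p \<in> carrier (gen_alg l)" and q: "q \<in> carrier (gen_alg l)"
  shows emb_add: "emb l (p + q) = emb l p + emb l q"
    and emb_mult: "emb l (p * q) = emb l p * emb l q"
    and emb_scale: "emb l (nc_const c * p) = scal c * emb l p"
    and emb_eq_iff: "emb l p = emb l q \<longleftrightarrow> p - q \<in> rel_ideal l"
proof -
  note Q = ring.ring_simprules[OF ring_pres_alg]
  have c: "nc_const c * p \<in> carrier (gen_alg l)"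
    using free_alg_closed(4)[OF free_alg_const p] .
  have zero: "\<zero>\<^bsub>pres_alg k\<^esub> \<oplus>\<^bsub>pres_alg k\<^esub> \<zero>\<^bsub>pres_alg k\<^esub> = \<zero>\<^bsub>pres_alg k\<^esub>"
    "\<zero>\<^bsub>pres_alg k\<^esub> \<otimes>\<^bsub>pres_alg k\<^esub> \<zero>\<^bsub>pres_alg k\<^esub> = \<zero>\<^bsub>pres_alg k\<^esub>"
    "component (scal c) k \<otimes>\<^bsub>pres_alg k\<^esub> \<zero>\<^bsub>pres_alg k\<^esub> = \<zero>\<^bsub>pres_alg k\<^esub>" for k
    by (rule Q(8)[OF Q(2)], rule Q(24)[OF Q(2)], rule Q(25)[OF component_carrier])
  have emb: "component (emb l r) k = (if k = l then rel_ideal l +>\<^bsub>gen_alg l\<^esub> r else \<zero>\<^bsub>pres_alg k\<^esub>)"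
    if "r \<in> carrier (gen_alg l)" for r k
    using that by (simp only: emb.rep_eq simp_thms)
  show "emb l (p + q) = emb l p + emb l q"
  proof (rule pres_prod_eqI)
    fix k show "component (emb l (p + q)) k = component (emb l p + emb l q) k"
      unfolding component_simps emb[OF p] emb[OF q] emb[OF free_alg_closed(3)[OF p q]]
      using coset_simps(1)[OF p q] zero(1)[of k] by (cases "k = l") (simp_all only: if_True if_False simp_thms)
  qed
  show "emb l (p * q) = emb l p * emb l q"
  proof (rule pres_prod_eqI)
    fix k show "component (emb l (p * q)) k = component (emb l p * emb l q) k"
      unfolding component_simps emb[OF p] emb[OF q] emb[OF free_alg_closed(4)[OF p q]]
      using coset_simps(2)[OF p q] zero(2)[of k] by (cases "k = l") (simp_all only: if_True if_False simp_thms)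
  qed
  show "emb l (nc_const c * p) = scal c * emb l p"
  proof (rule pres_prod_eqI)
    fix k show "component (emb l (nc_const c * p)) k = component (scal c * emb l p) k"
      unfolding component_simps emb[OF p] emb[OF c]
      using coset_simps(2)[OF free_alg_const p, of c] zero(3)[of k]
      by (cases "k = l") (simp_all only: if_True if_False simp_thms scal.rep_eq)
  qed
  show "emb l p = emb l q \<longleftrightarrow> p - q \<in> rel_ideal l"
  proof
    assume "emb l p = emb l q"
    then have "component (emb l p) l = component (emb l q) l" by simp
    then show "p - q \<in> rel_ideal l"
      unfolding emb[OF p] emb[OF q] by (simp only: if_True simp_thms coset_eq_iff[OF p q])
  next
    assume "p - q \<in> rel_ideal l"
    then show "emb l p = emb l q"
      by (intro pres_prod_eqI) (simp only: emb[OF p] emb[OF q] coset_eq_iff[OF p q, symmetric])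
  qed
qed

definition gen_val :: "nat \<times> nat \<Rightarrow> schur_gen \<Rightarrow> pres_prod" where
  "gen_val l g = (if g \<in> schur_gens (fst l) (snd l) then emb l (nc_gen g) else 0)"

text \<open>The factor \<open>emb l 1\<close> matters for the empty word, whose value is the unit of
  the whole product and not that of the factor.\<close>

lemma gen_val_word:
  "set gs \<subseteq> schur_gens (fst l) (snd l) \<Longrightarrow>
    prod_list (map (gen_val l) gs) * emb l 1 = emb l (Poly_Mapping.single (Word gs) 1)"
proof (induction gs)
  case Nil
  then show ?case by (simp flip: zero_word_def)
next
  case (Cons g gs)
  have "emb l (nc_gen g) * emb l (Poly_Mapping.single (Word gs) 1) = emb l (nc_gen g * Poly_Mapping.single (Word gs) 1)"
    using Cons.prems by (intro emb_mult[symmetric] free_alg_gen free_alg_single) auto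
  moreover have "nc_gen g * Poly_Mapping.single (Word gs) 1 = Poly_Mapping.single (Word (g # gs)) 1"
    by (simp add: nc_gen_def mult_single plus_word_def)
  ultimately show ?case
    using Cons by (simp add: mult.assoc gen_val_def)
qed

lemma nc_subst_emb:
  assumes "p \<in> carrier (gen_alg l)"
  shows "pres.nc_subst (gen_val l) p * emb l 1 = emb l p"
  using assms
proof (induction rule: free_alg_induct)
  case zero
  then show ?case by (simp add: emb_0)
next
  case (add w c q)
  have word: "Poly_Mapping.single w 1 \<in> carrier (gen_alg l)"
    using add(1) by (rule free_alg_single)
  have single: "Poly_Mapping.single w c = nc_const c * Poly_Mapping.single w 1"
    by (simp add: nc_const_def mult_single)
  have "pres.nc_subst (gen_val l) (Poly_Mapping.single w c) * emb l 1 = emb l (Poly_Mapping.single w c)"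
    using gen_val_word[OF add(1)] emb_scale[OF word word, of c]
    by (simp add: pres.nc_subst_single mult.assoc flip: single)
  then show ?case
    using add emb_add[OF free_alg_single[OF add(1)] add(2), of c]
    by (simp add: pres.nc_subst_add distrib_right)
qed

lemma (in rat_scalars) span_finite_image:
  assumes "z \<in> V.span (f ` I)" "finite I"
  shows "\<exists>c. z = (\<Sum>i\<in>I. \<kappa> (c i) * f i)"
  using assms(1)
proof (induction rule: V.span_induct_alt)
  case base
  show ?case by (rule exI[of _ "\<lambda>_. 0"]) simp
next
  case (step a x y)
  then obtain j c where j: "x = f j" "j \<in> I" and c: "y = (\<Sum>i\<in>I. \<kappa> (c i) * f i)" by auto
  have "(\<Sum>i\<in>I. \<kappa> ((c(j := a + c j)) i) * f i) = (\<Sum>i\<in>I. (if i = j then \<kappa> a * f j else 0) + \<kappa> (c i) * f i)"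
    by (intro sum.cong) (auto simp: scalar_add distrib_right)
  also have "\<dots> = \<kappa> a * x + y"
    using j c assms(2) by (simp add: sum.distrib)
  finally show ?case by metis
qed

section \<open>The relations in the quotient and its spanning set\<close>

context
  fixes n d :: nat
begin

definition pres_P :: "weight \<Rightarrow> pres_prod" where
  "pres_P \<mu> = (if \<mu> \<in> Lam n d then emb (n, d) (I1 \<mu>) else 0)"

definition pres_e :: "nat \<Rightarrow> pres_prod" where "pres_e i = emb (n, d) (E1 i)"
definition pres_f :: "nat \<Rightarrow> pres_prod" where "pres_f i = emb (n, d) (F1 i)"

abbreviation "pres_subst \<equiv> pres.nc_subst (gen_val (n, d))"
abbreviation "pres_one \<equiv> emb (n, d) 1"

lemma gen_val_simps:
  "\<mu> \<in> Lam n d \<Longrightarrow> gen_val (n, d) (GIdem \<mu>) = pres_P \<mu>"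
  "i \<in> {1..<n} \<Longrightarrow> gen_val (n, d) (GE i) = pres_e i"
  "i \<in> {1..<n} \<Longrightarrow> gen_val (n, d) (GF i) = pres_f i"
  by (auto simp: gen_val_def schur_gens_def pres_P_def pres_e_def pres_f_def)

lemma emb_unit: "p \<in> carrier (gen_alg (n, d)) \<Longrightarrow> emb (n, d) p * pres_one = emb (n, d) p"
  using emb_mult[OF _ free_alg_closed(2), of p "(n, d)"] by simp

lemma pres_P_unit: "pres_P \<mu> * pres_one = pres_P \<mu>"
  using emb_unit[of "I1 \<mu>"] I1_free_alg[of \<mu> n d] by (simp add: pres_P_def)

lemma pres_e_unit: "i \<in> {1..<n} \<Longrightarrow> pres_e i * pres_one = pres_e i"
  and pres_f_unit: "i \<in> {1..<n} \<Longrightarrow> pres_f i * pres_one = pres_f i"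
  using emb_unit[of "E1 i"] E1_free_alg[of i n d] emb_unit[of "F1 i"] F1_free_alg[of i n d]
  by (simp_all add: pres_e_def pres_f_def)

lemma rel_zero:
  assumes "r \<in> schur_rels n d"
  shows "pres_subst r * pres_one = 0"
proof -
  have r: "r \<in> carrier (gen_alg (n, d))" using schur_rels_free_alg assms by auto
  have "schur_rels n d \<subseteq> rel_ideal (n, d)"
    using ring.genideal_self[OF ring_free_alg schur_rels_free_alg[of n d]] by (simp add: rel_ideal_def)
  then have "emb (n, d) r = emb (n, d) 0"
    using emb_eq_iff[OF r free_alg_closed(1)] assms by auto
  then show ?thesis using nc_subst_emb[OF r] by (simp add: emb_0)
qed

lemmas subst_simps = pres.nc_subst_diff pres.nc_subst_mult pres.nc_subst_sum left_diff_distrib sum_distrib_right mult.assoc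

lemma pres_unit: "(\<Sum>\<mu>\<in>Lam n d. pres_P \<mu>) = pres_one"
proof -
  have "(\<Sum>\<mu>\<in>Lam n d. I1 \<mu>) - 1 \<in> schur_rels n d"
    by (simp add: schur_rels_def rel_R1'_def)
  from rel_zero[OF this] show ?thesis by (simp add: subst_simps gen_val_simps pres_P_unit)
qed

lemma pres_P_mult: "pres_P \<mu> * pres_P \<nu> = (if \<mu> = \<nu> then pres_P \<mu> else 0)"
proof (cases "\<mu> \<in> Lam n d \<and> \<nu> \<in> Lam n d")
  case True
  then have "I1 \<mu> * I1 \<nu> - (if \<mu> = \<nu> then I1 \<mu> else 0) \<in> schur_rels n d"
    by (auto simp: schur_rels_def rel_R1'_def)
  from rel_zero[OF this] True show ?thesis
    by (auto simp: subst_simps gen_val_simps pres_P_unit split: if_splits)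
qed (auto simp: pres_P_def)

lemma pres_e_P:
  assumes i: "i \<in> {1..<n}"
  shows "pres_e i * pres_P \<mu> = pres_P (\<mu> + sroot i) * pres_e i"
proof (cases "\<mu> \<in> Lam n d")
  case True
  then have "E1 i * I1 \<mu> - (if \<mu> + sroot i \<in> Lam n d then I1 (\<mu> + sroot i) * E1 i else 0) \<in> schur_rels n d"
    using i unfolding schur_rels_def rel_R2'_def by blast
  from rel_zero[OF this] True i show ?thesis
    by (cases "\<mu> + sroot i \<in> Lam n d") (simp_all add: subst_simps gen_val_simps pres_P_unit pres_e_unit, simp add: pres_P_def)
next
  case False
  show ?thesis
  proof (cases "\<mu> + sroot i \<in> Lam n d")
    case True
    \<comment> \<open>Here \<open>pres_P \<mu>\<close> is zero by convention. The right side
      vanishes by the relation for the idempotent of \<open>\<mu> + sroot i\<close> in front of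
      \<open>E1 i\<close>, whose shifted weight is \<open>\<mu>\<close> again.\<close>
    then have "I1 (\<mu> + sroot i) * E1 i - (if (\<mu> + sroot i) - sroot i \<in> Lam n d then E1 i * I1 ((\<mu> + sroot i) - sroot i) else 0) \<in> schur_rels n d"
      using i unfolding schur_rels_def rel_R2'_def by blast
    from rel_zero[OF this] True False i show ?thesis
      by (simp add: subst_simps gen_val_simps pres_e_unit) (simp add: pres_P_def)
  qed (simp add: pres_P_def False)
qed

lemma pres_f_P:
  assumes i: "i \<in> {1..<n}"
  shows "pres_f i * pres_P \<mu> = pres_P (\<mu> - sroot i) * pres_f i"
proof (cases "\<mu> \<in> Lam n d")
  case True
  then have "F1 i * I1 \<mu> - (if \<mu> - sroot i \<in> Lam n d then I1 (\<mu> - sroot i) * F1 i else 0) \<in> schur_rels n d"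
    using i unfolding schur_rels_def rel_R2'_def by blast
  from rel_zero[OF this] True i show ?thesis
    by (cases "\<mu> - sroot i \<in> Lam n d") (simp_all add: subst_simps gen_val_simps pres_P_unit pres_f_unit, simp add: pres_P_def)
next
  case False
  show ?thesis
  proof (cases "\<mu> - sroot i \<in> Lam n d")
    case True
    then have "I1 (\<mu> - sroot i) * F1 i - (if (\<mu> - sroot i) + sroot i \<in> Lam n d then F1 i * I1 ((\<mu> - sroot i) + sroot i) else 0) \<in> schur_rels n d"
      using i unfolding schur_rels_def rel_R2'_def by blast
    from rel_zero[OF this] True False i show ?thesis
      by (simp add: subst_simps gen_val_simps pres_f_unit) (simp add: pres_P_def)
  qed (simp add: pres_P_def False)
qed

lemma pres_lie_e_f:
  assumes "i \<in> {1..<n}" "j \<in> {1..<n}"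
  shows "lie (pres_e i) (pres_f j) =
      (if i = j then (\<Sum>\<mu>\<in>Lam n d. scal (of_int (\<mu> j - \<mu> (Suc j))) * pres_P \<mu>) else 0)"
proof -
  have "E1 i * F1 j - F1 j * E1 i - (if i = j then \<Sum>\<mu> \<in> Lam n d. nc_const (of_int (\<mu> j - \<mu> (j + 1))) * I1 \<mu> else 0)
      \<in> schur_rels n d"
    using assms unfolding schur_rels_def rel_R3'_def by blast
  from rel_zero[OF this] assms show ?thesis
    by (cases "i = j") (simp_all add: subst_simps lie_def gen_val_simps pres_P_unit pres_e_unit pres_f_unit)
qed

lemma pres_serre:
  assumes i: "i \<in> {1..<n}" and j: "j \<in> {1..<n}"
  shows "j = Suc i \<or> i = Suc j \<Longrightarrow> lie (pres_e i) (lie (pres_e i) (pres_e j)) = 0"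
    and "j = Suc i \<or> i = Suc j \<Longrightarrow> lie (pres_f i) (lie (pres_f i) (pres_f j)) = 0"
    and "\<not> (j = Suc i \<or> i = Suc j) \<Longrightarrow> lie (pres_e i) (pres_e j) = 0"
    and "\<not> (j = Suc i \<or> i = Suc j) \<Longrightarrow> lie (pres_f i) (pres_f j) = 0"
proof -
  have unit: "lie x y * pres_one = lie x y" if "x * pres_one = x" "y * pres_one = y" for x y
    using that by (simp add: lie_def left_diff_distrib mult.assoc)
  have "serre E1 i j \<in> schur_rels n d" "serre F1 i j \<in> schur_rels n d"
    using i j unfolding schur_rels_def rel_R4_def rel_R5_def by blast+
  then have rel: "pres_subst (serre E1 i j) * pres_one = 0" "pres_subst (serre F1 i j) * pres_one = 0"
    by (simp_all add: rel_zero)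
  note units = unit pres_e_unit[OF i] pres_e_unit[OF j] pres_f_unit[OF i] pres_f_unit[OF j]
  show "j = Suc i \<or> i = Suc j \<Longrightarrow> lie (pres_e i) (lie (pres_e i) (pres_e j)) = 0"
    "j = Suc i \<or> i = Suc j \<Longrightarrow> lie (pres_f i) (lie (pres_f i) (pres_f j)) = 0"
    "\<not> (j = Suc i \<or> i = Suc j) \<Longrightarrow> lie (pres_e i) (pres_e j) = 0"
    "\<not> (j = Suc i \<or> i = Suc j) \<Longrightarrow> lie (pres_f i) (pres_f j) = 0"
    using rel unfolding pres.nc_subst_serre pres.nc_subst_gen gen_val_simps(2,3)[OF i] gen_val_simps(2,3)[OF j]
    by (simp_all only: if_True if_False units)
qed

interpretation pres: schur_presentation scal n d pres_P pres_e pres_f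
proof unfold_locales
  fix i j :: nat assume i: "i \<in> {1..<n}" and j: "j \<in> {1..<n}"
  show "Suc i < j \<or> Suc j < i \<Longrightarrow> lie (pres_e i) (pres_e j) = 0"
    "Suc i < j \<or> Suc j < i \<Longrightarrow> lie (pres_f i) (pres_f j) = 0"
    using pres_serre(3,4)[OF i j] by linarith+
  show "j = Suc i \<or> i = Suc j \<Longrightarrow> lie (pres_e i) (lie (pres_e i) (pres_e j)) = 0"
    "j = Suc i \<or> i = Suc j \<Longrightarrow> lie (pres_f i) (lie (pres_f i) (pres_f j)) = 0"
    by (fact pres_serre(1,2)[OF i j])+
qed (simp_all only: pres_P_mult pres_e_P pres_f_P pres_unit pres_e_unit pres_f_unit pres_lie_e_f,
  simp add: pres_P_def)

lemma nc_comb_emb: "emb (n, d) (nc_comb n d c) = (\<Sum>\<theta>\<in>pbw_index n d. scal (c \<theta>) * pres.pbw \<theta>)"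
proof -
  have word: "mat_word (\<lambda>k. gen_val (n, d) (GE k)) (\<lambda>k. gen_val (n, d) (GF k)) ps = mat_word pres_e pres_f ps"
    if "set ps \<subseteq> roots n" for ps
    using that
  proof (induction ps)
    case (Cons p ps)
    have vec: "root_vec x i m = root_vec y i m" if "\<And>k. k \<in> {i..i + m} \<Longrightarrow> x k = y k" for x y :: "nat \<Rightarrow> pres_prod" and i m
      using that by (induction m arbitrary: i) simp_all
    have "mat_elt (\<lambda>k. gen_val (n, d) (GE k)) (\<lambda>k. gen_val (n, d) (GF k)) p = mat_elt pres_e pres_f p"
      using Cons.prems by (auto simp: mat_elt_def roots_def gen_val_simps split: prod.split intro!: vec)
    then show ?case using Cons by simp
  qed simp
  have "pres_subst (nc_pbw \<theta>) * pres_one = pres.pbw \<theta>" if "\<theta> \<in> pbw_index n d" for \<theta>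
  proof -
    have "snd \<theta> \<in> Lam n d" using that by (auto simp: pbw_index_def)
    then show ?thesis
      using word[OF pbw_index_words[OF that]]
      by (simp add: nc_pbw_def pres.pbw_def pres.nc_subst_mult pres.nc_subst_mat_word gen_val_simps pres_P_unit mult.assoc)
  qed
  then have "pres_subst (nc_comb n d c) * pres_one = (\<Sum>\<theta>\<in>pbw_index n d. scal (c \<theta>) * pres.pbw \<theta>)"
    by (simp add: nc_comb_def pres.nc_subst_sum pres.nc_subst_mult sum_distrib_right mult.assoc)
  then show ?thesis
    using nc_subst_emb[of "nc_comb n d c" "(n, d)"] nc_comb_free_alg[of n d c] by simp
qed

lemma emb_pbw_span:
  assumes "p \<in> carrier (gen_alg (n, d))"
  shows "emb (n, d) p \<in> pres.pbw_span"
proof -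
  have word: "prod_list (map (gen_val (n, d)) gs) * pres_one \<in> pres.pbw_span" if "set gs \<subseteq> schur_gens n d" for gs
    using that
  proof (induction gs)
    case Nil
    then show ?case using pres.unit_pbw_span by (simp add: pres_unit)
  next
    case (Cons g gs)
    then have IH: "prod_list (map (gen_val (n, d)) gs) * pres_one \<in> pres.pbw_span" by simp
    have "g \<in> schur_gens n d" using Cons.prems by simp
    then have "gen_val (n, d) g * (prod_list (map (gen_val (n, d)) gs) * pres_one) \<in> pres.pbw_span"
      unfolding schur_gens_def
      using pres.P_pbw_span[OF IH] pres.e_pbw_span[OF _ IH] pres.f_pbw_span[OF _ IH]
      by (elim UnE imageE) (simp_all only: gen_val_simps)
    then show ?case by (simp add: mult.assoc)
  qed
  have "pres_subst p * pres_one = (\<Sum>w\<in>Poly_Mapping.keys p. scal (Poly_Mapping.lookup p w) * (prod_list (map (gen_val (n, d)) (letters w)) * pres_one))"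
    by (simp add: pres.nc_subst_def sum_distrib_right mult.assoc)
  also have "\<dots> \<in> pres.pbw_span"
  proof -
    have "set (letters w) \<subseteq> schur_gens n d" if "w \<in> Poly_Mapping.keys p" for w
      using assms that by (simp add: free_alg_def)
    then show ?thesis
      using word unfolding pres.pbw_span_def by (intro pres.V.span_sum pres.V.span_scale) blast
  qed
  finally show ?thesis using nc_subst_emb[OF assms] by simp
qed

text \<open>The spanning property read back in the free algebra, where equal images under
  \<open>emb\<close> mean congruence modulo the ideal.\<close>

lemma nc_comb_mod_rel_ideal:
  assumes "p \<in> carrier (gen_alg (n, d))"
  shows "\<exists>c. p - nc_comb n d c \<in> rel_ideal (n, d)"
proof -
  obtain c where "emb (n, d) p = (\<Sum>\<theta>\<in>pbw_index n d. scal (c \<theta>) * pres.pbw \<theta>)"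
    using pres.span_finite_image[of "emb (n, d) p" pres.pbw "pbw_index n d"] emb_pbw_span[OF assms] finite_pbw_index
    unfolding pres.pbw_span_def by blast
  then have "emb (n, d) p = emb (n, d) (nc_comb n d c)" by (simp add: nc_comb_emb)
  then show ?thesis using emb_eq_iff[OF assms] nc_comb_free_alg by auto
qed

end

text \<open>An element of the kernel is congruent to some \<open>nc_comb n d c\<close>, which is
  then sent to zero as well and is therefore zero. So the element lies in the ideal.\<close>

lemma schur_hom_kernel:
  "a_kernel (free_alg (schur_gens n d)) (schur_alg n d) (schur_hom n d) = rel_ideal (n, d)"
proof -
  let ?F = "free_alg (schur_gens n d)"
  have "p \<in> rel_ideal (n, d)" if p: "p \<in> carrier ?F" and zero: "schur_hom n d p = \<zero>\<^bsub>schur_alg n d\<^esub>" for p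
  proof -
    obtain c where c: "p - nc_comb n d c \<in> rel_ideal (n, d)"
      using nc_comb_mod_rel_ideal[of p n d] p by auto
    have "schur_hom n d (p - nc_comb n d c) = \<zero>\<^bsub>schur_alg n d\<^esub>"
      using rel_ideal_kernel[OF c] .
    moreover have "schur_hom n d p = schur_hom n d (p - nc_comb n d c) \<oplus>\<^bsub>schur_alg n d\<^esub> schur_hom n d (nc_comb n d c)"
      by (simp add: schur_hom_def op.nc_subst_diff flip: op_res_add)
    moreover have "schur_hom n d (nc_comb n d c) \<in> carrier (schur_alg n d)"
      by (simp add: schur_hom_def op_res_carrier equivariant_nc_subst)
    ultimately have "schur_hom n d (nc_comb n d c) = \<zero>\<^bsub>schur_alg n d\<^esub>"
      using zero ring.ring_simprules(8)[OF ring_schur_alg] by simp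
    then have "nc_comb n d c = 0" by (rule schur_hom_nc_comb_inj)
    then show ?thesis using c by simp
  qed
  moreover have "rel_ideal (n, d) \<subseteq> carrier ?F"
    using additive_subgroup.a_subset[OF ideal.axioms(1)[OF ideal_rel_ideal[of "(n, d)"]]] by simp
  ultimately show ?thesis
    using rel_ideal_kernel unfolding a_kernel_def' by blast
qed

theorem theorem1p4:
  fixes n d :: nat
  assumes "n \<ge> 1"
  shows "presented_by (schur_alg n d) (schur_gens n d) (schur_gen_elt n d) (schur_rels n d)"
proof -
  let ?F = "free_alg (schur_gens n d)" and ?h = "schur_hom n d"
  \<comment> \<open>\<open>the_elem\<close> reads off the constant value of the homomorphism on a
    coset of its kernel.\<close>
  let ?I = "rel_ideal (n, d)" and ?\<phi> = "\<lambda>X. the_elem (schur_hom n d ` X)"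
  interpret h: ring_hom_ring ?F "schur_alg n d" ?h
    by (rule ring_hom_ringI2[OF ring_free_alg ring_schur_alg schur_hom_ring_hom])
  have iso: "?\<phi> \<in> ring_iso (?F Quot ?I) (schur_alg n d)"
    using h.FactRing_iso_set[OF schur_hom_surj] by (simp only: schur_hom_kernel)
  have val: "?\<phi> (?I +>\<^bsub>?F\<^esub> p) = ?h p" if "p \<in> carrier ?F" for p
    using h.the_elem_simp[OF that] by (simp only: schur_hom_kernel)
  have scale: "?\<phi> (?I +>\<^bsub>?F\<^esub> (c \<odot>\<^bsub>?F\<^esub> p)) = c \<odot>\<^bsub>schur_alg n d\<^esub> ?\<phi> (?I +>\<^bsub>?F\<^esub> p)" if "p \<in> carrier ?F" for c p
    using that free_alg_closed(4)[OF free_alg_const that] by (simp add: val schur_hom_scale)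
  have gen: "?\<phi> (?I +>\<^bsub>?F\<^esub> nc_gen g) = schur_gen_elt n d g" if "g \<in> schur_gens n d" for g
    using that free_alg_gen[OF that] by (simp add: val schur_hom_gen)
  have ideal: "Idl\<^bsub>?F\<^esub> (schur_rels n d) = ?I"
    by (simp add: rel_ideal_def)
  show ?thesis
    unfolding presented_by_def Let_def ideal
  proof (intro conjI bexI[OF _ iso] allI ballI)
    show "schur_rels n d \<subseteq> carrier ?F" by (rule schur_rels_free_alg)
  qed (rule scale, assumption, rule gen, assumption)
qed

end
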